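(* Let $T$ be a complete continuous first-order theory (in a language of arbitrary cardinality). If $M^0$ and $M^1$ are constructible models of $T$, then $M^0$ and $M^1$ are isomorphic.
   Context: The setting is continuous first-order logic for metric structures; models are metric structures whose underlying metric spaces are complete. Elements and parameter sets are taken in a monster model of $T$ with metric $d$, and $b' \equiv_A b$ means $\operatorname{tp}(b'/A) = \operatorname{tp}(b/A)$. For a set of parameters $A$ and a finite tuple $b$, the type $\operatorname{tp}(b/A)$ is atomic if there is an $A$-definable predicate $D(x)$ such that for every $c$ in the monster model, $D(c) = \inf\{d(c,b') : b' \equiv_A b\}$. A sequence $(b_i)_{i<\alpha}$ of elements (single elements, indexed by an ordinal $\alpha$) is a construction sequence over $A$ if for each $i<\alpha$, $\operatorname{tp}(b_i/A\cup\{b_j : j<i\})$ is atomic. A model $M \supseteq A$ is constructible over $A$ if it can be enumerated by a construction sequence over $A$ (so every element of $M$ appears in the sequence, and all entries of the sequence lie in $M$). $M$ is constructible if it is constructible over $\varnothing$. *)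

theory Defs
  imports "HOL-Analysis.Analysis"
begin

unbundle cardinal_syntax

section \<open>Languages, formulas and metric structures\<close>

text \<open>
  Single-sorted continuous first-order logic. A language comes with an arity and a modulus of
  uniform continuity for each symbol, a compact interval containing the values of each predicate
  symbol, and a bound on the diameter of its structures. Constants are 0-ary function symbols.
\<close>

record ('f, 'r) language =
  Funs :: "'f set"
  Rels :: "'r set"
  farity :: "'f \<Rightarrow> nat"
  rarity :: "'r \<Rightarrow> nat"
  fmodulus :: "'f \<Rightarrow> real \<Rightarrow> real"
  rmodulus :: "'r \<Rightarrow> real \<Rightarrow> real"
  rlower :: "'r \<Rightarrow> real"
  rupper :: "'r \<Rightarrow> real"
  diam_bound :: real

definition wf_language :: "('f, 'r) language \<Rightarrow> bool" where
  "wf_language L \<longleftrightarrow>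
     (\<forall>f\<in>Funs L. \<forall>\<epsilon>>0. fmodulus L f \<epsilon> > 0) \<and>
     (\<forall>R\<in>Rels L. \<forall>\<epsilon>>0. rmodulus L R \<epsilon> > 0)"

datatype 'f tm = Var nat | Fn 'f "'f tm list"

text \<open>
  Every continuous function \<open>\<real>\<^sup>n \<Rightarrow> \<real>\<close> is a connective. It is presented as a
  function \<open>u\<close> of infinitely many real arguments, continuous for the product topology, which
  is evaluated with the arguments from the \<open>n\<close>-th on set to 0; the functions on
  \<open>\<real>\<^sup>n\<close> arising in this way are exactly the continuous ones.
\<close>

datatype ('f, 'r) fm =
    Dist "'f tm" "'f tm"
  | Rel 'r "'f tm list"
  | Conn "(nat \<Rightarrow> real) \<Rightarrow> real" "('f, 'r) fm list"
  | Sup_fm nat "('f, 'r) fm"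
  | Inf_fm nat "('f, 'r) fm"

fun wf_tm :: "('f, 'r) language \<Rightarrow> 'f tm \<Rightarrow> bool" where
  "wf_tm L (Var x) \<longleftrightarrow> True"
| "wf_tm L (Fn f ts) \<longleftrightarrow> f \<in> Funs L \<and> length ts = farity L f \<and> (\<forall>t\<in>set ts. wf_tm L t)"

fun wf_fm :: "('f, 'r) language \<Rightarrow> ('f, 'r) fm \<Rightarrow> bool" where
  "wf_fm L (Dist t t') \<longleftrightarrow> wf_tm L t \<and> wf_tm L t'"
| "wf_fm L (Rel R ts) \<longleftrightarrow> R \<in> Rels L \<and> length ts = rarity L R \<and> (\<forall>t\<in>set ts. wf_tm L t)"
| "wf_fm L (Conn u \<phi>s) \<longleftrightarrow> continuous_on UNIV u \<and> (\<forall>\<phi>\<in>set \<phi>s. wf_fm L \<phi>)"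
| "wf_fm L (Sup_fm x \<phi>) \<longleftrightarrow> wf_fm L \<phi>"
| "wf_fm L (Inf_fm x \<phi>) \<longleftrightarrow> wf_fm L \<phi>"

fun fv_tm :: "'f tm \<Rightarrow> nat set" where
  "fv_tm (Var x) = {x}"
| "fv_tm (Fn f ts) = (\<Union>t\<in>set ts. fv_tm t)"

fun fv :: "('f, 'r) fm \<Rightarrow> nat set" where
  "fv (Dist t t') = fv_tm t \<union> fv_tm t'"
| "fv (Rel R ts) = (\<Union>t\<in>set ts. fv_tm t)"
| "fv (Conn u \<phi>s) = (\<Union>\<phi>\<in>set \<phi>s. fv \<phi>)"
| "fv (Sup_fm x \<phi>) = fv \<phi> - {x}"
| "fv (Inf_fm x \<phi>) = fv \<phi> - {x}"

record ('a, 'f, 'r) metric_structure =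
  univ :: "'a set"
  mdist :: "'a \<Rightarrow> 'a \<Rightarrow> real"
  fun_int :: "'f \<Rightarrow> 'a list \<Rightarrow> 'a"
  rel_int :: "'r \<Rightarrow> 'a list \<Rightarrow> real"

definition tuples :: "('a, 'f, 'r) metric_structure \<Rightarrow> nat \<Rightarrow> 'a list set" where
  "tuples M n = {xs. set xs \<subseteq> univ M \<and> length xs = n}"

text \<open>The maximum metric on tuples; the inserted 0 only matters for the empty tuple.\<close>

definition tuple_dist :: "('a, 'f, 'r) metric_structure \<Rightarrow> 'a list \<Rightarrow> 'a list \<Rightarrow> real" where
  "tuple_dist M xs ys = Max (insert 0 ((\<lambda>i. mdist M (xs ! i) (ys ! i)) ` {..<length xs}))"

text \<open>
  The library predicate \<^const>\<open>Metric_space\<close> also asks the distance to be nonnegative and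
  symmetric outside the universe. This is no restriction, as values outside the universe are
  irrelevant everywhere below.
\<close>

definition is_structure :: "('f, 'r) language \<Rightarrow> ('a, 'f, 'r) metric_structure \<Rightarrow> bool" where
  "is_structure L M \<longleftrightarrow>
     univ M \<noteq> {} \<and>
     Metric_space (univ M) (mdist M) \<and>
     Metric_space.mcomplete (univ M) (mdist M) \<and>
     (\<forall>x\<in>univ M. \<forall>y\<in>univ M. mdist M x y \<le> diam_bound L) \<and>
     (\<forall>f\<in>Funs L. \<forall>xs\<in>tuples M (farity L f). fun_int M f xs \<in> univ M) \<and>
     (\<forall>f\<in>Funs L. \<forall>\<epsilon>>0. \<forall>xs\<in>tuples M (farity L f). \<forall>ys\<in>tuples M (farity L f).
        tuple_dist M xs ys < fmodulus L f \<epsilon> \<longrightarrow>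
        mdist M (fun_int M f xs) (fun_int M f ys) \<le> \<epsilon>) \<and>
     (\<forall>R\<in>Rels L. \<forall>xs\<in>tuples M (rarity L R). rel_int M R xs \<in> {rlower L R..rupper L R}) \<and>
     (\<forall>R\<in>Rels L. \<forall>\<epsilon>>0. \<forall>xs\<in>tuples M (rarity L R). \<forall>ys\<in>tuples M (rarity L R).
        tuple_dist M xs ys < rmodulus L R \<epsilon> \<longrightarrow>
        \<bar>rel_int M R xs - rel_int M R ys\<bar> \<le> \<epsilon>)"

fun tm_val :: "('a, 'f, 'r) metric_structure \<Rightarrow> (nat \<Rightarrow> 'a) \<Rightarrow> 'f tm \<Rightarrow> 'a" where
  "tm_val M s (Var x) = s x"
| "tm_val M s (Fn f ts) = fun_int M f (map (tm_val M s) ts)"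

fun fm_val :: "('a, 'f, 'r) metric_structure \<Rightarrow> (nat \<Rightarrow> 'a) \<Rightarrow> ('f, 'r) fm \<Rightarrow> real" where
  "fm_val M s (Dist t t') = mdist M (tm_val M s t) (tm_val M s t')"
| "fm_val M s (Rel R ts) = rel_int M R (map (tm_val M s) ts)"
| "fm_val M s (Conn u \<phi>s) =
     u (\<lambda>i. if i < length \<phi>s then map (fm_val M s) \<phi>s ! i else 0)"
| "fm_val M s (Sup_fm x \<phi>) = (SUP a\<in>univ M. fm_val M (s(x := a)) \<phi>)"
| "fm_val M s (Inf_fm x \<phi>) = (INF a\<in>univ M. fm_val M (s(x := a)) \<phi>)"

text \<open>
  The value of a formula whose free variables are among the first \<open>length xs\<close> ones; the
  assignment is immaterial beyond these.
\<close>

definition val :: "('a, 'f, 'r) metric_structure \<Rightarrow> ('f, 'r) fm \<Rightarrow> 'a list \<Rightarrow> real" where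
  "val M \<phi> xs = fm_val M (\<lambda>i. xs ! i) \<phi>"


section \<open>Theories, isomorphisms, elementary substructures\<close>

text \<open>
  A theory is a set of sentences; a sentence \<open>\<phi>\<close> in it stands for the closed condition
  \<open>\<phi> = 0\<close>. A theory is complete if it is the theory of some structure. As a definition
  cannot quantify over types, the type of the elements of that structure is a parameter.
\<close>

definition sentence :: "('f, 'r) language \<Rightarrow> ('f, 'r) fm \<Rightarrow> bool" where
  "sentence L \<phi> \<longleftrightarrow> wf_fm L \<phi> \<and> fv \<phi> = {}"

definition Th :: "('f, 'r) language \<Rightarrow> ('a, 'f, 'r) metric_structure \<Rightarrow> ('f, 'r) fm set" where
  "Th L M = {\<phi>. sentence L \<phi> \<and> val M \<phi> [] = 0}"

definition complete_theory :: "'a itself \<Rightarrow> ('f, 'r) language \<Rightarrow> ('f, 'r) fm set \<Rightarrow> bool" where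
  "complete_theory A L T \<longleftrightarrow>
     (\<exists>M :: ('a, 'f, 'r) metric_structure. is_structure L M \<and> T = Th L M)"

definition is_model ::
  "('f, 'r) language \<Rightarrow> ('f, 'r) fm set \<Rightarrow> ('a, 'f, 'r) metric_structure \<Rightarrow> bool" where
  "is_model L T M \<longleftrightarrow> is_structure L M \<and> (\<forall>\<phi>\<in>T. val M \<phi> [] = 0)"

definition isomorphism ::
  "('f, 'r) language \<Rightarrow> ('a, 'f, 'r) metric_structure \<Rightarrow> ('b, 'f, 'r) metric_structure \<Rightarrow>
   ('a \<Rightarrow> 'b) \<Rightarrow> bool" where
  "isomorphism L M N h \<longleftrightarrow>
     bij_betw h (univ M) (univ N) \<and>
     (\<forall>x\<in>univ M. \<forall>y\<in>univ M. mdist N (h x) (h y) = mdist M x y) \<and>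
     (\<forall>f\<in>Funs L. \<forall>xs\<in>tuples M (farity L f). fun_int N f (map h xs) = h (fun_int M f xs)) \<and>
     (\<forall>R\<in>Rels L. \<forall>xs\<in>tuples M (rarity L R). rel_int N R (map h xs) = rel_int M R xs)"

definition isomorphic ::
  "('f, 'r) language \<Rightarrow> ('a, 'f, 'r) metric_structure \<Rightarrow> ('b, 'f, 'r) metric_structure \<Rightarrow> bool" where
  "isomorphic L M N \<longleftrightarrow> (\<exists>h. isomorphism L M N h)"

definition elementary_substructure ::
  "('f, 'r) language \<Rightarrow> ('a, 'f, 'r) metric_structure \<Rightarrow> ('a, 'f, 'r) metric_structure \<Rightarrow> bool" where
  "elementary_substructure L M N \<longleftrightarrow>
     is_structure L M \<and> is_structure L N \<and> univ M \<subseteq> univ N \<and>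
     (\<forall>x\<in>univ M. \<forall>y\<in>univ M. mdist M x y = mdist N x y) \<and>
     (\<forall>f\<in>Funs L. \<forall>xs\<in>tuples M (farity L f). fun_int M f xs = fun_int N f xs) \<and>
     (\<forall>R\<in>Rels L. \<forall>xs\<in>tuples M (rarity L R). rel_int M R xs = rel_int N R xs) \<and>
     (\<forall>\<phi> xs. wf_fm L \<phi> \<and> set xs \<subseteq> univ M \<and> fv \<phi> \<subseteq> {..<length xs} \<longrightarrow> val M \<phi> xs = val N \<phi> xs)"


section \<open>Types and definable predicates\<close>

text \<open>
  \<open>param_fm L A n \<phi> as\<close>: the pair \<open>(\<phi>, as)\<close> is a formula in \<open>n\<close> variables
  with parameters in \<open>A\<close>. The variables from the \<open>n\<close>-th on stand for the parameters
  \<open>as\<close>, so that the value at an \<open>n\<close>-tuple \<open>c\<close> is \<open>val M \<phi> (c @ as)\<close>.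
\<close>

definition param_fm ::
  "('f, 'r) language \<Rightarrow> 'a set \<Rightarrow> nat \<Rightarrow> ('f, 'r) fm \<Rightarrow> 'a list \<Rightarrow> bool" where
  "param_fm L A n \<phi> as \<longleftrightarrow> wf_fm L \<phi> \<and> set as \<subseteq> A \<and> fv \<phi> \<subseteq> {..<n + length as}"

text \<open>The conditions \<open>\<phi>(x, as) = 0\<close> over \<open>A\<close> that hold of \<open>b\<close>.\<close>

definition tp ::
  "('f, 'r) language \<Rightarrow> ('a, 'f, 'r) metric_structure \<Rightarrow> 'a set \<Rightarrow> 'a list \<Rightarrow>
   (('f, 'r) fm \<times> 'a list) set" where
  "tp L M A b = {(\<phi>, as). param_fm L A (length b) \<phi> as \<and> val M \<phi> (b @ as) = 0}"

definition realizations ::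
  "('f, 'r) language \<Rightarrow> ('a, 'f, 'r) metric_structure \<Rightarrow> 'a set \<Rightarrow> 'a list \<Rightarrow> 'a list set" where
  "realizations L M A b = {b' \<in> tuples M (length b). tp L M A b' = tp L M A b}"

text \<open>Definable predicates are the uniform limits of formulas with parameters.\<close>

definition definable_predicate ::
  "('f, 'r) language \<Rightarrow> ('a, 'f, 'r) metric_structure \<Rightarrow> 'a set \<Rightarrow> nat \<Rightarrow> ('a list \<Rightarrow> real) \<Rightarrow> bool" where
  "definable_predicate L M A n D \<longleftrightarrow>
     (\<exists>\<phi> as. (\<forall>k. param_fm L A n (\<phi> k) (as k)) \<and>
             uniform_limit (tuples M n) (\<lambda>k c. val M (\<phi> k) (c @ as k)) D sequentially)"


section \<open>Monster models\<close>

definition saturated ::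
  "('f, 'r) language \<Rightarrow> 'k rel \<Rightarrow> ('a, 'f, 'r) metric_structure \<Rightarrow> bool" where
  "saturated L \<kappa> M \<longleftrightarrow>
     (\<forall>A n \<Gamma>. A \<subseteq> univ M \<and> |A| <o \<kappa> \<and> (\<forall>(\<phi>, as)\<in>\<Gamma>. param_fm L A n \<phi> as) \<and>
        (\<forall>\<Delta>\<subseteq>\<Gamma>. finite \<Delta> \<longrightarrow> (\<exists>c\<in>tuples M n. \<forall>(\<phi>, as)\<in>\<Delta>. val M \<phi> (c @ as) = 0)) \<longrightarrow>
        (\<exists>c\<in>tuples M n. \<forall>(\<phi>, as)\<in>\<Gamma>. val M \<phi> (c @ as) = 0))"

definition strongly_homogeneous ::
  "('f, 'r) language \<Rightarrow> 'k rel \<Rightarrow> ('a, 'f, 'r) metric_structure \<Rightarrow> bool" where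
  "strongly_homogeneous L \<kappa> M \<longleftrightarrow>
     (\<forall>A h. A \<subseteq> univ M \<and> |A| <o \<kappa> \<and> h ` A \<subseteq> univ M \<and>
        (\<forall>\<phi> as. param_fm L A 0 \<phi> as \<longrightarrow> val M \<phi> (map h as) = val M \<phi> as) \<longrightarrow>
        (\<exists>g. isomorphism L M M g \<and> (\<forall>a\<in>A. g a = h a)))"

text \<open>Sets of cardinality less than \<open>\<kappa>\<close> are the small ones.\<close>

definition monster_model ::
  "('f, 'r) language \<Rightarrow> ('f, 'r) fm set \<Rightarrow> 'k rel \<Rightarrow> ('a, 'f, 'r) metric_structure \<Rightarrow> bool" where
  "monster_model L T \<kappa> U \<longleftrightarrow>
     is_model L T U \<and>
     Card_order \<kappa> \<and> natLeq <o \<kappa> \<and> |Funs L| <o \<kappa> \<and> |Rels L| <o \<kappa> \<and>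
     saturated L \<kappa> U \<and> strongly_homogeneous L \<kappa> U"


section \<open>Atomic types and constructible models\<close>

text \<open>In this section \<open>U\<close> is the monster model.\<close>

definition atomic_type ::
  "('f, 'r) language \<Rightarrow> ('a, 'f, 'r) metric_structure \<Rightarrow> 'a set \<Rightarrow> 'a list \<Rightarrow> bool" where
  "atomic_type L U A b \<longleftrightarrow>
     (\<exists>D. definable_predicate L U A (length b) D \<and>
          (\<forall>c\<in>tuples U (length b). D c = (INF b'\<in>realizations L U A b. tuple_dist U c b')))"

text \<open>
  Ordinals are represented by well-orders \<open>r\<close>, with the elements of \<open>Field r\<close> as
  indices.
\<close>

definition construction_sequence ::
  "('f, 'r) language \<Rightarrow> ('a, 'f, 'r) metric_structure \<Rightarrow> 'a set \<Rightarrow> 'i rel \<Rightarrow> ('i \<Rightarrow> 'a) \<Rightarrow> bool" where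
  "construction_sequence L U A r b \<longleftrightarrow>
     Well_order r \<and> b ` Field r \<subseteq> univ U \<and>
     (\<forall>i\<in>Field r. atomic_type L U (A \<union> b ` underS r i) [b i])"

text \<open>
  The type \<open>'i\<close> of the indices is a parameter, since a definition cannot quantify over
  ordinals of arbitrary size.
\<close>

definition constructible_over ::
  "'i itself \<Rightarrow> ('f, 'r) language \<Rightarrow> ('a, 'f, 'r) metric_structure \<Rightarrow> 'a set \<Rightarrow>
   ('a, 'f, 'r) metric_structure \<Rightarrow> bool" where
  "constructible_over I L U A M \<longleftrightarrow>
     elementary_substructure L M U \<and> A \<subseteq> univ M \<and>
     (\<exists>(r :: 'i rel) b. construction_sequence L U A r b \<and> b ` Field r = univ M)"

text \<open>
  A model need not be given as a subset of the monster model; it is constructible if an isomorphic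
  elementary substructure of the monster model is.
\<close>

definition constructible ::
  "'i itself \<Rightarrow> ('f, 'r) language \<Rightarrow> ('u, 'f, 'r) metric_structure \<Rightarrow>
   ('a, 'f, 'r) metric_structure \<Rightarrow> bool" where
  "constructible I L U M \<longleftrightarrow> (\<exists>N. isomorphic L M N \<and> constructible_over I L U {} N)"

end

theory Submission
  imports Defs
begin

text \<open>
  A constructible model can be enumerated without repetition by a well-order in which the type of
  each element over its predecessors is isolated: up to any given error, the set of conjugates of the
  element is defined by a formula, with parameters from a fixed countable set. If \<open>C\<close> contains
  these parameters for each of its elements, then by an orthogonality argument every finite tuple of
  the model has an isolated type over \<open>C\<close>.

  An isolated type over \<open>A\<close> may become non-isolated after naming a realization of another one,
  so an exact back-and-forth between two constructible models breaks down. Instead, a partial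
  elementary map whose domain and range are closures of such sets \<open>C\<close> is extended by an
  approximate back-and-forth between countable sets, in which the points already treated are moved by
  summable amounts; the limits give a map between the closures of two larger sets of the same kind.
  By homogeneity the partial maps are restrictions of automorphisms of the monster model, and by
  Zorn's lemma there is a maximal one, which maps one model onto the other.
\<close>

section \<open>Values of formulas\<close>

text \<open>Automorphisms of \<open>U\<close> stand in for types: conjugacy over a small set
  replaces equality of types, and strong homogeneity completes any map on a small set that
  automorphisms approximate on finite subsets. Isolation is phrased with a gap between two
  thresholds: the isolating function is at most 0 at the given tuple, and a value below 1 already
  forces a conjugate within \<epsilon>. The gap absorbs continuity errors, and strict inequalities
  pass through infima, which need not be attained. Finite tuples, not just single elements, have to
  be isolated over \<open>C\<close>, because a back-and-forth step moves every point chosen so far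
  and needs one automorphism controlling all of them. Passing to closures costs nothing for
  isolation, as an automorphism that fixes a set pointwise fixes its closure; and the models are
  closed in \<open>U\<close> because they are complete. Since supports are countable, a countable
  set can be closed under supports and under the choices of the back-and-forth at once, so each
  extension in the Zorn argument is a limit over the natural numbers.\<close>

lemma finite_fv_tm [simp]: "finite (fv_tm t)"
  by (induction t) auto

lemma finite_fv [simp]: "finite (fv \<phi>)"
  by (induction \<phi>) auto

lemma tm_val_cong:
  "(\<And>x. x \<in> fv_tm t \<Longrightarrow> s x = s' x) \<Longrightarrow> tm_val M s t = tm_val M s' t"
proof (induction t)
  case (Fn f ts)
  then have "map (tm_val M s) ts = map (tm_val M s') ts"
    by (auto intro!: map_cong)
  then show ?case
    by (simp only: tm_val.simps)
qed simp

lemma fm_val_cong: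
  "(\<And>x. x \<in> fv \<phi> \<Longrightarrow> s x = s' x) \<Longrightarrow> fm_val M s \<phi> = fm_val M s' \<phi>"
proof (induction \<phi> arbitrary: s s')
  case (Dist t t')
  then show ?case
    by (metis UnCI fm_val.simps(1) fv.simps(1) tm_val_cong)
next
  case (Rel R ts)
  then have "map (tm_val M s) ts = map (tm_val M s') ts"
    by (intro map_cong tm_val_cong refl) auto
  then show ?case
    by (simp only: fm_val.simps)
next
  case (Conn u \<phi>s)
  have "map (fm_val M s) \<phi>s = map (fm_val M s') \<phi>s"
  proof (rule map_cong[OF refl])
    fix \<phi> assume "\<phi> \<in> set \<phi>s"
    then show "fm_val M s \<phi> = fm_val M s' \<phi>"
      using Conn.prems by (intro Conn.IH) auto
  qed
  then show ?case
    by (simp only: fm_val.simps)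
next
  case (Sup_fm x \<phi>)
  have "fm_val M (s(x := a)) \<phi> = fm_val M (s'(x := a)) \<phi>" for a
    using Sup_fm.prems by (intro Sup_fm.IH) auto
  then show ?case
    by simp
next
  case (Inf_fm x \<phi>)
  have "fm_val M (s(x := a)) \<phi> = fm_val M (s'(x := a)) \<phi>" for a
    using Inf_fm.prems by (intro Inf_fm.IH) auto
  then show ?case
    by simp
qed

section \<open>Capture-avoiding renaming of variables\<close>

fun ren_tm :: "(nat \<Rightarrow> nat) \<Rightarrow> 'f tm \<Rightarrow> 'f tm" where
  "ren_tm \<rho> (Var x) = Var (\<rho> x)"
| "ren_tm \<rho> (Fn f ts) = Fn f (map (ren_tm \<rho>) ts)"

lemma tm_val_ren [simp]: "tm_val M s (ren_tm \<rho> t) = tm_val M (s \<circ> \<rho>) t"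
proof (induction t)
  case (Fn f ts)
  then have "map (tm_val M s \<circ> ren_tm \<rho>) ts = map (tm_val M (s \<circ> \<rho>)) ts"
    by (simp add: comp_def)
  then show ?case
    by (simp only: ren_tm.simps tm_val.simps map_map)
qed simp

lemma fv_tm_ren [simp]: "fv_tm (ren_tm \<rho> t) = \<rho> ` fv_tm t"
  by (induction t) auto

lemma wf_tm_ren [simp]: "wf_tm L (ren_tm \<rho> t) = wf_tm L t"
  by (induction t) auto

definition fresh :: "nat set \<Rightarrow> nat" where
  "fresh V = (SOME z. z \<notin> V)"

lemma fresh_notin: "finite V \<Longrightarrow> fresh V \<notin> V"
  unfolding fresh_def by (rule someI_ex) (rule ex_new_if_finite[OF infinite_UNIV_nat])

text \<open>The renaming need not be injective: identifying variables is needed later, when several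
  of them stand for the same element. Each bound variable is therefore replaced by one outside the
  image of the remaining free variables.\<close>

fun ren_fm :: "(nat \<Rightarrow> nat) \<Rightarrow> ('f, 'r) fm \<Rightarrow> ('f, 'r) fm" where
  "ren_fm \<rho> (Dist t t') = Dist (ren_tm \<rho> t) (ren_tm \<rho> t')"
| "ren_fm \<rho> (Rel R ts) = Rel R (map (ren_tm \<rho>) ts)"
| "ren_fm \<rho> (Conn u \<phi>s) = Conn u (map (ren_fm \<rho>) \<phi>s)"
| "ren_fm \<rho> (Sup_fm x \<phi>) =
     (let z = fresh (\<rho> ` (fv \<phi> - {x})) in Sup_fm z (ren_fm (\<rho>(x := z)) \<phi>))"
| "ren_fm \<rho> (Inf_fm x \<phi>) =
     (let z = fresh (\<rho> ` (fv \<phi> - {x})) in Inf_fm z (ren_fm (\<rho>(x := z)) \<phi>))"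

lemma wf_fm_ren [simp]: "wf_fm L (ren_fm \<rho> \<phi>) = wf_fm L \<phi>"
proof (induction \<phi> arbitrary: \<rho>)
  case (Conn u \<phi>s)
  then show ?case by simp
qed (simp_all add: Let_def)

lemma fun_upd_image_subset: "\<rho>(x := z) ` V \<subseteq> insert z (\<rho> ` (V - {x}))"
  by auto

lemma fv_ren: "fv (ren_fm \<rho> \<phi>) \<subseteq> \<rho> ` fv \<phi>"
proof (induction \<phi> arbitrary: \<rho>)
  case (Sup_fm x \<phi>)
  show ?case
    using order_trans[OF Sup_fm.IH[of "\<rho>(x := fresh (\<rho> ` (fv \<phi> - {x})))"] fun_upd_image_subset]
    by (auto simp: Let_def simp del: fun_upd_apply)
next
  case (Inf_fm x \<phi>)
  show ?case
    using order_trans[OF Inf_fm.IH[of "\<rho>(x := fresh (\<rho> ` (fv \<phi> - {x})))"] fun_upd_image_subset]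
    by (auto simp: Let_def simp del: fun_upd_apply)
next
  case (Conn u \<phi>s)
  then show ?case by fastforce
next
  case (Dist t t')
  show ?case by (simp add: image_Un)
next
  case (Rel R ts)
  show ?case by (simp add: image_UN)
qed

lemma fm_val_ren_fresh:
  assumes "finite V" and "fv \<phi> - {x} \<subseteq> V"
  shows "fm_val M ((s(fresh (\<rho> ` V) := a)) \<circ> \<rho>(x := fresh (\<rho> ` V))) \<phi>
       = fm_val M ((s \<circ> \<rho>)(x := a)) \<phi>"
proof (rule fm_val_cong)
  fix y assume "y \<in> fv \<phi>"
  have "\<rho> y \<noteq> fresh (\<rho> ` V)" if "y \<noteq> x"
    using assms fresh_notin[of "\<rho> ` V"] that \<open>y \<in> fv \<phi>\<close> by force
  then show "((s(fresh (\<rho> ` V) := a)) \<circ> \<rho>(x := fresh (\<rho> ` V))) y = ((s \<circ> \<rho>)(x := a)) y"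
    by simp
qed

lemma fm_val_ren: "fm_val M s (ren_fm \<rho> \<phi>) = fm_val M (s \<circ> \<rho>) \<phi>"
proof (induction \<phi> arbitrary: s \<rho>)
  case (Rel R ts)
  have "map (tm_val M s \<circ> ren_tm \<rho>) ts = map (tm_val M (s \<circ> \<rho>)) ts"
    by (simp add: comp_def)
  then show ?case
    by (simp only: ren_fm.simps fm_val.simps map_map)
next
  case (Conn u \<phi>s)
  have "map (fm_val M s \<circ> ren_fm \<rho>) \<phi>s = map (fm_val M (s \<circ> \<rho>)) \<phi>s"
    by (rule map_cong[OF refl], subst comp_apply, rule Conn.IH)
  then show ?case
    by (simp only: ren_fm.simps fm_val.simps length_map map_map)
next
  case (Sup_fm x \<phi>)
  show ?case
    unfolding ren_fm.simps Let_def fm_val.simps Sup_fm.IH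
    by (subst fm_val_ren_fresh) auto
next
  case (Inf_fm x \<phi>)
  show ?case
    unfolding ren_fm.simps Let_def fm_val.simps Inf_fm.IH
    by (subst fm_val_ren_fresh) auto
qed simp

subsection \<open>Boundedness and uniform continuity\<close>

text \<open>Tychonoff's theorem. A connective is a continuous function of infinitely many arguments,
  so its boundedness and uniform continuity on bounded arguments come from compactness of this
  cube.\<close>

lemma compact_bounded_sequences: "compact {v :: nat \<Rightarrow> real. \<forall>i. \<bar>v i\<bar> \<le> B}"
proof -
  have "compactin (product_topology (\<lambda>_. euclidean) UNIV) (PiE UNIV (\<lambda>_ :: nat. {-B..B}))"
    by (subst compactin_PiE) auto
  moreover have "PiE UNIV (\<lambda>_ :: nat. {-B..B}) = {v. \<forall>i. \<bar>v i\<bar> \<le> B}"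
    by (auto simp: PiE_UNIV_domain abs_le_iff minus_le_iff)
  ultimately show ?thesis
    by (simp add: euclidean_product_topology compactin_euclidean_iff)
qed

text \<open>The library metric on sequences is a sum of coordinate distances truncated at 1 with
  weights \<open>(1/2)^n\<close>; the factor 2 is the sum of the weights.\<close>

lemma dist_sequences_le:
  fixes v w :: "nat \<Rightarrow> real"
  assumes "\<And>i. \<bar>v i - w i\<bar> \<le> \<delta>"
  shows "dist v w \<le> 2 * \<delta>"
proof -
  have "(\<lambda>n. (1/2)^n * min (dist (v (from_nat n)) (w (from_nat n))) 1) sums dist v w"
    unfolding dist_fun_def
    by (rule summable_sums, rule summable_comparison_test'[of "\<lambda>n. (1/2)^n"])
       (auto simp: summable_geometric_iff)
  moreover have "(\<lambda>n. (1/2)^n * \<delta>) sums (2 * \<delta>)"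
    using sums_mult2[OF geometric_sums[of "1/2 :: real"], of \<delta>] by simp
  ultimately show ?thesis
    by (rule sums_le[rotated]) (auto simp: dist_real_def assms min.coboundedI1)
qed

lemma connective_unif_cont:
  fixes u :: "(nat \<Rightarrow> real) \<Rightarrow> real"
  assumes "continuous_on UNIV u" and "\<epsilon> > 0"
  shows "\<exists>\<delta>>0. \<forall>v w. (\<forall>i. \<bar>v i\<bar> \<le> B \<and> \<bar>w i\<bar> \<le> B \<and> \<bar>v i - w i\<bar> \<le> \<delta>) \<longrightarrow> \<bar>u v - u w\<bar> < \<epsilon>"
proof -
  let ?K = "{v :: nat \<Rightarrow> real. \<forall>i. \<bar>v i\<bar> \<le> B}"
  have "uniformly_continuous_on ?K u"
    using assms(1) by (intro compact_uniformly_continuous compact_bounded_sequences)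
      (auto intro: continuous_on_subset)
  then have "\<exists>\<delta>>0. \<forall>v\<in>?K. \<forall>w\<in>?K. dist w v < \<delta> \<longrightarrow> dist (u w) (u v) < \<epsilon>"
    unfolding uniformly_continuous_on_def using \<open>\<epsilon> > 0\<close> by blast
  then obtain \<delta> where \<delta>: "\<delta> > 0" "\<And>v w. v \<in> ?K \<Longrightarrow> w \<in> ?K \<Longrightarrow> dist w v < \<delta> \<Longrightarrow> dist (u w) (u v) < \<epsilon>"
    by blast
  \<comment> \<open>With a third of \<delta>, the factor 2 of \<open>dist_sequences_le\<close> still
    leaves a distance strictly below \<delta>.\<close>
  have "\<bar>u v - u w\<bar> < \<epsilon>" if "\<forall>i. \<bar>v i\<bar> \<le> B \<and> \<bar>w i\<bar> \<le> B \<and> \<bar>v i - w i\<bar> \<le> \<delta> / 3" for v w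
  proof -
    have "dist v w \<le> 2 * (\<delta> / 3)"
      using that by (intro dist_sequences_le) auto
    then show ?thesis
      using \<delta>(2)[of w v] that \<open>\<delta> > 0\<close> by (auto simp: dist_real_def)
  qed
  then show ?thesis
    using \<open>\<delta> > 0\<close> by (intro exI[of _ "\<delta> / 3"]) auto
qed

lemma connective_bounded:
  fixes u :: "(nat \<Rightarrow> real) \<Rightarrow> real"
  assumes "continuous_on UNIV u"
  shows "\<exists>C. \<forall>v. (\<forall>i. \<bar>v i\<bar> \<le> B) \<longrightarrow> \<bar>u v\<bar> \<le> C"
proof -
  have "bounded (u ` {v. \<forall>i. \<bar>v i\<bar> \<le> B})"
    by (intro compact_imp_bounded compact_continuous_image compact_bounded_sequences
        continuous_on_subset[OF assms]) auto
  then obtain C where "\<forall>x\<in>u ` {v. \<forall>i. \<bar>v i\<bar> \<le> B}. norm x \<le> C"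
    unfolding bounded_iff by blast
  then show ?thesis
    by (intro exI[of _ C]) simp
qed

lemma abs_SUP_diff_le:
  fixes f g :: "'c \<Rightarrow> real"
  assumes "A \<noteq> {}" "bdd_above (f ` A)" "bdd_above (g ` A)" "\<And>a. a \<in> A \<Longrightarrow> \<bar>f a - g a\<bar> \<le> \<epsilon>"
  shows "\<bar>(SUP a\<in>A. f a) - (SUP a\<in>A. g a)\<bar> \<le> \<epsilon>"
proof -
  have "(SUP a\<in>A. f a) \<le> (SUP a\<in>A. g a) + \<epsilon>"
  proof (rule cSUP_least[OF assms(1)])
    fix a assume "a \<in> A"
    then show "f a \<le> (SUP a\<in>A. g a) + \<epsilon>"
      using cSUP_upper[OF _ assms(3), of a] assms(4)[of a] by linarith
  qed
  moreover have "(SUP a\<in>A. g a) \<le> (SUP a\<in>A. f a) + \<epsilon>"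
  proof (rule cSUP_least[OF assms(1)])
    fix a assume "a \<in> A"
    then show "g a \<le> (SUP a\<in>A. f a) + \<epsilon>"
      using cSUP_upper[OF _ assms(2), of a] assms(4)[of a] by linarith
  qed
  ultimately show ?thesis by linarith
qed

lemma abs_INF_diff_le:
  fixes f g :: "'c \<Rightarrow> real"
  assumes "A \<noteq> {}" "bdd_below (f ` A)" "bdd_below (g ` A)" "\<And>a. a \<in> A \<Longrightarrow> \<bar>f a - g a\<bar> \<le> \<epsilon>"
  shows "\<bar>(INF a\<in>A. f a) - (INF a\<in>A. g a)\<bar> \<le> \<epsilon>"
proof -
  have "(INF a\<in>A. f a) - \<epsilon> \<le> (INF a\<in>A. g a)"
  proof (rule cINF_greatest[OF assms(1)])
    fix a assume "a \<in> A"
    then show "(INF a\<in>A. f a) - \<epsilon> \<le> g a"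
      using cINF_lower[OF assms(2), of a] assms(4)[of a] by linarith
  qed
  moreover have "(INF a\<in>A. g a) - \<epsilon> \<le> (INF a\<in>A. f a)"
  proof (rule cINF_greatest[OF assms(1)])
    fix a assume "a \<in> A"
    then show "(INF a\<in>A. g a) - \<epsilon> \<le> f a"
      using cINF_lower[OF assms(3), of a] assms(4)[of a] by linarith
  qed
  ultimately show ?thesis by linarith
qed

lemma tuple_dist_less:
  assumes "\<epsilon> > 0" and "\<And>i. i < length xs \<Longrightarrow> mdist M (xs ! i) (ys ! i) < \<epsilon>"
  shows "tuple_dist M xs ys < \<epsilon>"
  unfolding tuple_dist_def using assms by (subst Max_less_iff) auto

locale language_structure =
  fixes L :: "('f, 'r) language" and U :: "('u, 'f, 'r) metric_structure"
  assumes wf_L: "wf_language L" and struct_U: "is_structure L U"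
begin

abbreviation d :: "'u \<Rightarrow> 'u \<Rightarrow> real" where
  "d \<equiv> mdist U"

sublocale Metric_space "univ U" d
  using struct_U by (simp add: is_structure_def)

lemma univ_nonempty: "univ U \<noteq> {}"
  using struct_U by (simp add: is_structure_def)

lemma mcomplete_U: "mcomplete"
  using struct_U by (simp add: is_structure_def)

lemma fun_modulus:
  assumes "f \<in> Funs L" "xs \<in> tuples U (farity L f)" "ys \<in> tuples U (farity L f)" "\<epsilon> > 0"
    and "tuple_dist U xs ys < fmodulus L f \<epsilon>"
  shows "d (fun_int U f xs) (fun_int U f ys) \<le> \<epsilon>"
  using assms struct_U unfolding is_structure_def by blast

lemma rel_modulus:
  assumes "R \<in> Rels L" "xs \<in> tuples U (rarity L R)" "ys \<in> tuples U (rarity L R)" "\<epsilon> > 0"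
    and "tuple_dist U xs ys < rmodulus L R \<epsilon>"
  shows "\<bar>rel_int U R xs - rel_int U R ys\<bar> \<le> \<epsilon>"
  using assms struct_U unfolding is_structure_def by blast

lemma tm_val_in:
  "wf_tm L t \<Longrightarrow> s ` fv_tm t \<subseteq> univ U \<Longrightarrow> tm_val U s t \<in> univ U"
proof (induction t)
  case (Fn f ts)
  then have "map (tm_val U s) ts \<in> tuples U (farity L f)"
    by (auto simp: tuples_def)
  then show ?case
    using Fn.prems struct_U by (auto simp: is_structure_def)
qed auto

lemma tm_vals_in:
  assumes "\<And>t. t \<in> set ts \<Longrightarrow> wf_tm L t" and "s ` (\<Union>t\<in>set ts. fv_tm t) \<subseteq> univ U"
  shows "map (tm_val U s) ts \<in> tuples U (length ts)"
  using assms by (auto simp: tuples_def intro!: tm_val_in)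

definition close :: "nat set \<Rightarrow> real \<Rightarrow> (nat \<Rightarrow> 'u) \<Rightarrow> (nat \<Rightarrow> 'u) \<Rightarrow> bool" where
  "close V \<delta> s s' \<longleftrightarrow> s ` V \<subseteq> univ U \<and> s' ` V \<subseteq> univ U \<and> (\<forall>x\<in>V. d (s x) (s' x) < \<delta>)"

lemma close_mono: "close V \<delta> s s' \<Longrightarrow> W \<subseteq> V \<Longrightarrow> \<delta> \<le> \<epsilon> \<Longrightarrow> close W \<epsilon> s s'"
  unfolding close_def by (auto, force)

lemma close_upd: "close (V - {x}) \<delta> s s' \<Longrightarrow> a \<in> univ U \<Longrightarrow> \<delta> > 0 \<Longrightarrow> close V \<delta> (s(x := a)) (s'(x := a))"
  unfolding close_def by auto

text \<open>Quantifying over all sufficiently small \<delta> lets the moduli of the finitely many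
  subterms be combined by \<open>eventually_ball_finite\<close>, without forming minima.\<close>

lemma tm_unif_cont:
  assumes "wf_tm L t" and "\<epsilon> > 0"
  shows "\<forall>\<^sub>F \<delta> in at_right 0. \<forall>s s'. close (fv_tm t) \<delta> s s' \<longrightarrow> d (tm_val U s t) (tm_val U s' t) < \<epsilon>"
  using assms
proof (induction t arbitrary: \<epsilon>)
  case (Var x)
  have "\<forall>\<^sub>F \<delta> in at_right 0. \<delta> < \<epsilon>"
    using Var.prems(2) by (simp add: eventually_at_right_less eventually_at_right_real
        order_tendstoD(2)[OF tendsto_ident_at])
  then show ?case
    by (rule eventually_mono) (auto simp: close_def)
next
  case (Fn f ts)
  \<comment> \<open>\<open>fun_modulus\<close> concludes only a weak inequality, so it is applied to
    half of \<epsilon>.\<close>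
  let ?\<eta> = "fmodulus L f (\<epsilon> / 2)"
  have \<eta>: "?\<eta> > 0"
    using Fn.prems wf_L by (auto simp: wf_language_def)
  have "\<forall>\<^sub>F \<delta> in at_right 0. \<forall>t\<in>set ts. \<forall>s s'. close (fv_tm t) \<delta> s s' \<longrightarrow> d (tm_val U s t) (tm_val U s' t) < ?\<eta>"
    using Fn \<eta> by (intro eventually_ball_finite) auto
  then show ?case
  proof (rule eventually_mono, intro allI impI)
    fix \<delta> s s'
    assume *: "\<forall>t\<in>set ts. \<forall>s s'. close (fv_tm t) \<delta> s s' \<longrightarrow> d (tm_val U s t) (tm_val U s' t) < ?\<eta>"
      and c: "close (fv_tm (Fn f ts)) \<delta> s s'"
    have "close (fv_tm t) \<delta> s s'" if "t \<in> set ts" for t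
      using close_mono[OF c, of "fv_tm t" \<delta>] that by auto
    with * have "d (tm_val U s t) (tm_val U s' t) < ?\<eta>" if "t \<in> set ts" for t
      using that by blast
    then have "tuple_dist U (map (tm_val U s) ts) (map (tm_val U s') ts) < ?\<eta>"
      using \<eta> by (intro tuple_dist_less) auto
    moreover have "map (tm_val U s) ts \<in> tuples U (farity L f)" "map (tm_val U s') ts \<in> tuples U (farity L f)"
      using tm_vals_in[of ts s] tm_vals_in[of ts s'] Fn.prems c by (auto simp: close_def)
    ultimately have "d (tm_val U s (Fn f ts)) (tm_val U s' (Fn f ts)) \<le> \<epsilon> / 2"
      using fun_modulus[of f _ _ "\<epsilon> / 2"] Fn.prems unfolding tm_val.simps wf_tm.simps by auto
    then show "d (tm_val U s (Fn f ts)) (tm_val U s' (Fn f ts)) < \<epsilon>"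
      using Fn.prems by simp
  qed
qed

text \<open>Suprema and infima of reals are meaningful only for bounded families, and a connective
  is uniformly continuous only on bounded arguments; both uses need this bound.\<close>

lemma fm_bounded:
  "wf_fm L \<phi> \<Longrightarrow> \<exists>B. \<forall>s. s ` fv \<phi> \<subseteq> univ U \<longrightarrow> \<bar>fm_val U s \<phi>\<bar> \<le> B"
proof (induction \<phi>)
  case (Dist t t')
  then have "\<bar>fm_val U s (Dist t t')\<bar> \<le> diam_bound L" if "s ` fv (Dist t t') \<subseteq> univ U" for s
    using that struct_U tm_val_in[of t s] tm_val_in[of t' s]
    by (auto simp: is_structure_def image_Un)
  then show ?case by blast
next
  case (Rel R ts)
  have "\<bar>fm_val U s (Rel R ts)\<bar> \<le> max \<bar>rlower L R\<bar> \<bar>rupper L R\<bar>" if "s ` fv (Rel R ts) \<subseteq> univ U" for s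
  proof -
    have "map (tm_val U s) ts \<in> tuples U (rarity L R)"
      using tm_vals_in[of ts s] Rel that by auto
    then have "rel_int U R (map (tm_val U s) ts) \<in> {rlower L R..rupper L R}"
      using struct_U Rel unfolding is_structure_def by auto
    then show ?thesis
      by (auto simp: max_def abs_if)
  qed
  then show ?case by blast
next
  case (Conn u \<phi>s)
  then obtain B where B: "\<And>\<phi> s. \<phi> \<in> set \<phi>s \<Longrightarrow> s ` fv \<phi> \<subseteq> univ U \<Longrightarrow> \<bar>fm_val U s \<phi>\<bar> \<le> B \<phi>"
    by (simp, metis)
  \<comment> \<open>The inserted 0 makes \<open>B'\<close> nonnegative, so that it also bounds the
    zeros that fill the arguments of \<open>u\<close> beyond the list.\<close>
  define B' where "B' = Max (insert 0 (B ` set \<phi>s))"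
  obtain C where C: "\<And>v. (\<And>i. \<bar>v i\<bar> \<le> B') \<Longrightarrow> \<bar>u v\<bar> \<le> C"
    using connective_bounded[of u B'] Conn.prems by auto
  have "\<bar>fm_val U s (Conn u \<phi>s)\<bar> \<le> C" if "s ` fv (Conn u \<phi>s) \<subseteq> univ U" for s
  proof -
    have "\<bar>fm_val U s \<phi>\<bar> \<le> B'" if "\<phi> \<in> set \<phi>s" for \<phi>
    proof -
      have "\<bar>fm_val U s \<phi>\<bar> \<le> B \<phi>"
        using that \<open>s ` fv (Conn u \<phi>s) \<subseteq> univ U\<close> by (intro B) auto
      also have "B \<phi> \<le> B'"
        unfolding B'_def using that by (intro Max_ge) auto
      finally show ?thesis .
    qed
    moreover have "0 \<le> B'"
      unfolding B'_def by (intro Max_ge) auto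
    ultimately show ?thesis
      by (auto intro!: C)
  qed
  then show ?case by blast
next
  case (Sup_fm x \<phi>)
  then obtain B where B: "\<And>s. s ` fv \<phi> \<subseteq> univ U \<Longrightarrow> \<bar>fm_val U s \<phi>\<bar> \<le> B"
    by auto
  have "\<bar>fm_val U s (Sup_fm x \<phi>)\<bar> \<le> B" if "s ` fv (Sup_fm x \<phi>) \<subseteq> univ U" for s
  proof -
    have "\<bar>fm_val U (s(x := a)) \<phi>\<bar> \<le> B" if "a \<in> univ U" for a
      using that \<open>s ` fv (Sup_fm x \<phi>) \<subseteq> univ U\<close> by (intro B) auto
    then show ?thesis
      using univ_nonempty by (auto intro!: cSup_abs_le)
  qed
  then show ?case by blast
next
  case (Inf_fm x \<phi>)
  then obtain B where B: "\<And>s. s ` fv \<phi> \<subseteq> univ U \<Longrightarrow> \<bar>fm_val U s \<phi>\<bar> \<le> B"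
    by auto
  have "\<bar>fm_val U s (Inf_fm x \<phi>)\<bar> \<le> B" if "s ` fv (Inf_fm x \<phi>) \<subseteq> univ U" for s
  proof -
    have "\<bar>fm_val U (s(x := a)) \<phi>\<bar> \<le> B" if "a \<in> univ U" for a
      using that \<open>s ` fv (Inf_fm x \<phi>) \<subseteq> univ U\<close> by (intro B) auto
    then show ?thesis
      using univ_nonempty by (auto intro!: cInf_abs_ge)
  qed
  then show ?case by blast
qed

lemma fm_bdd:
  assumes "wf_fm L \<phi>" and "s ` (fv \<phi> - {x}) \<subseteq> univ U"
  shows "bdd_below ((\<lambda>a. fm_val U (s(x := a)) \<phi>) ` univ U)"
    and "bdd_above ((\<lambda>a. fm_val U (s(x := a)) \<phi>) ` univ U)"
proof -
  obtain B where B: "\<And>s. s ` fv \<phi> \<subseteq> univ U \<Longrightarrow> \<bar>fm_val U s \<phi>\<bar> \<le> B"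
    using fm_bounded[OF assms(1)] by auto
  have *: "\<bar>fm_val U (s(x := a)) \<phi>\<bar> \<le> B" if "a \<in> univ U" for a
    using that assms(2) by (intro B) auto
  show "bdd_below ((\<lambda>a. fm_val U (s(x := a)) \<phi>) ` univ U)"
    using * by (intro bdd_belowI2[of _ "-B"]) (auto simp: abs_le_iff minus_le_iff)
  show "bdd_above ((\<lambda>a. fm_val U (s(x := a)) \<phi>) ` univ U)"
    using * by (intro bdd_aboveI2[of _ _ "B"]) (auto simp: abs_le_iff)
qed

text \<open>In the quantifier cases a modulus of the body works unchanged, as both assignments
  receive the same value at the bound variable. There they have distance 0, which is below \<delta>
  only because \<delta> is kept positive.\<close>

lemma fm_unif_cont:
  assumes "wf_fm L \<phi>" and "\<epsilon> > 0"
  shows "\<forall>\<^sub>F \<delta> in at_right 0. \<forall>s s'. close (fv \<phi>) \<delta> s s' \<longrightarrow> \<bar>fm_val U s \<phi> - fm_val U s' \<phi>\<bar> < \<epsilon>"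
  using assms
proof (induction \<phi> arbitrary: \<epsilon>)
  case (Dist t t')
  have "\<forall>\<^sub>F \<delta> in at_right 0. (\<forall>s s'. close (fv_tm t) \<delta> s s' \<longrightarrow> d (tm_val U s t) (tm_val U s' t) < \<epsilon> / 2)
      \<and> (\<forall>s s'. close (fv_tm t') \<delta> s s' \<longrightarrow> d (tm_val U s t') (tm_val U s' t') < \<epsilon> / 2)"
    using Dist tm_unif_cont[of t "\<epsilon> / 2"] tm_unif_cont[of t' "\<epsilon> / 2"]
    unfolding wf_fm.simps by (intro eventually_conj) (simp_all only: half_gt_zero)
  then show ?case
  proof (rule eventually_mono, intro allI impI)
    fix \<delta> s s'
    assume *: "(\<forall>s s'. close (fv_tm t) \<delta> s s' \<longrightarrow> d (tm_val U s t) (tm_val U s' t) < \<epsilon> / 2)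
      \<and> (\<forall>s s'. close (fv_tm t') \<delta> s s' \<longrightarrow> d (tm_val U s t') (tm_val U s' t') < \<epsilon> / 2)"
      and c: "close (fv (Dist t t')) \<delta> s s'"
    have "d (tm_val U s t) (tm_val U s' t) < \<epsilon> / 2" "d (tm_val U s t') (tm_val U s' t') < \<epsilon> / 2"
      using * close_mono[OF c, of "fv_tm t" \<delta>] close_mono[OF c, of "fv_tm t'" \<delta>] by auto
    moreover have "tm_val U s t \<in> univ U" "tm_val U s' t \<in> univ U" "tm_val U s t' \<in> univ U" "tm_val U s' t' \<in> univ U"
      using c Dist.prems by (auto simp: close_def image_Un intro!: tm_val_in)
    ultimately show "\<bar>fm_val U s (Dist t t') - fm_val U s' (Dist t t')\<bar> < \<epsilon>"
      using triangle[of "tm_val U s t" "tm_val U s' t" "tm_val U s t'"]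
        triangle[of "tm_val U s' t" "tm_val U s' t'" "tm_val U s t'"]
        triangle[of "tm_val U s' t" "tm_val U s t" "tm_val U s' t'"]
        triangle[of "tm_val U s t" "tm_val U s t'" "tm_val U s' t'"]
        commute[of "tm_val U s t" "tm_val U s' t"] commute[of "tm_val U s t'" "tm_val U s' t'"]
      by simp
  qed
next
  case (Rel R ts)
  let ?\<eta> = "rmodulus L R (\<epsilon> / 2)"
  have \<eta>: "?\<eta> > 0"
    using Rel.prems wf_L by (auto simp: wf_language_def)
  have "\<forall>\<^sub>F \<delta> in at_right 0. \<forall>t\<in>set ts. \<forall>s s'. close (fv_tm t) \<delta> s s' \<longrightarrow> d (tm_val U s t) (tm_val U s' t) < ?\<eta>"
    using Rel \<eta> tm_unif_cont by (intro eventually_ball_finite) auto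
  then show ?case
  proof (rule eventually_mono, intro allI impI)
    fix \<delta> s s'
    assume *: "\<forall>t\<in>set ts. \<forall>s s'. close (fv_tm t) \<delta> s s' \<longrightarrow> d (tm_val U s t) (tm_val U s' t) < ?\<eta>"
      and c: "close (fv (Rel R ts)) \<delta> s s'"
    have "close (fv_tm t) \<delta> s s'" if "t \<in> set ts" for t
      using close_mono[OF c, of "fv_tm t" \<delta>] that by auto
    with * have "d (tm_val U s t) (tm_val U s' t) < ?\<eta>" if "t \<in> set ts" for t
      using that by blast
    then have "tuple_dist U (map (tm_val U s) ts) (map (tm_val U s') ts) < ?\<eta>"
      using \<eta> by (intro tuple_dist_less) auto
    moreover have "map (tm_val U s) ts \<in> tuples U (rarity L R)" "map (tm_val U s') ts \<in> tuples U (rarity L R)"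
      using tm_vals_in[of ts s] tm_vals_in[of ts s'] Rel.prems c by (auto simp: close_def)
    ultimately have "\<bar>fm_val U s (Rel R ts) - fm_val U s' (Rel R ts)\<bar> \<le> \<epsilon> / 2"
      using rel_modulus[of R _ _ "\<epsilon> / 2"] Rel.prems unfolding fm_val.simps wf_fm.simps by auto
    then show "\<bar>fm_val U s (Rel R ts) - fm_val U s' (Rel R ts)\<bar> < \<epsilon>"
      using Rel.prems by simp
  qed
next
  case (Conn u \<phi>s)
  have "\<forall>\<phi>\<in>set \<phi>s. \<exists>B. \<forall>s. s ` fv \<phi> \<subseteq> univ U \<longrightarrow> \<bar>fm_val U s \<phi>\<bar> \<le> B"
    using Conn.prems fm_bounded by simp
  then obtain B where B: "\<And>\<phi> s. \<phi> \<in> set \<phi>s \<Longrightarrow> s ` fv \<phi> \<subseteq> univ U \<Longrightarrow> \<bar>fm_val U s \<phi>\<bar> \<le> B \<phi>"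
    by metis
  define B' where "B' = Max (insert 0 (B ` set \<phi>s))"
  have B': "\<bar>fm_val U s \<phi>\<bar> \<le> B'" if "\<phi> \<in> set \<phi>s" "s ` fv (Conn u \<phi>s) \<subseteq> univ U" for s \<phi>
  proof -
    have "\<bar>fm_val U s \<phi>\<bar> \<le> B \<phi>"
      using that by (intro B) auto
    also have "B \<phi> \<le> B'"
      unfolding B'_def using that by (intro Max_ge) auto
    finally show ?thesis .
  qed
  have "0 \<le> B'"
    unfolding B'_def by (intro Max_ge) auto
  obtain \<eta> where \<eta>: "\<eta> > 0"
    "\<And>v w. (\<And>i. \<bar>v i\<bar> \<le> B' \<and> \<bar>w i\<bar> \<le> B' \<and> \<bar>v i - w i\<bar> \<le> \<eta>) \<Longrightarrow> \<bar>u v - u w\<bar> < \<epsilon>"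
    using connective_unif_cont[of u \<epsilon> B'] Conn.prems by auto
  have "\<forall>\<^sub>F \<delta> in at_right 0. \<forall>\<phi>\<in>set \<phi>s. \<forall>s s'. close (fv \<phi>) \<delta> s s' \<longrightarrow> \<bar>fm_val U s \<phi> - fm_val U s' \<phi>\<bar> < \<eta>"
    using Conn \<eta>(1) by (intro eventually_ball_finite) auto
  then show ?case
  proof (rule eventually_mono, intro allI impI)
    fix \<delta> s s'
    assume *: "\<forall>\<phi>\<in>set \<phi>s. \<forall>s s'. close (fv \<phi>) \<delta> s s' \<longrightarrow> \<bar>fm_val U s \<phi> - fm_val U s' \<phi>\<bar> < \<eta>"
      and c: "close (fv (Conn u \<phi>s)) \<delta> s s'"
    have "close (fv \<phi>) \<delta> s s'" if "\<phi> \<in> set \<phi>s" for \<phi>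
      using close_mono[OF c, of "fv \<phi>" \<delta>] that by auto
    with * have 1: "\<bar>fm_val U s \<phi> - fm_val U s' \<phi>\<bar> < \<eta>" if "\<phi> \<in> set \<phi>s" for \<phi>
      using that by blast
    have 2: "s ` fv (Conn u \<phi>s) \<subseteq> univ U" "s' ` fv (Conn u \<phi>s) \<subseteq> univ U"
      using c by (auto simp: close_def)
    show "\<bar>fm_val U s (Conn u \<phi>s) - fm_val U s' (Conn u \<phi>s)\<bar> < \<epsilon>"
      unfolding fm_val.simps
      using B'[OF _ 2(1)] B'[OF _ 2(2)] 1[THEN less_imp_le] \<eta>(1) \<open>0 \<le> B'\<close>
      by (intro \<eta>(2)) auto
  qed
next
  case (Sup_fm x \<phi>)
  then have "\<forall>\<^sub>F \<delta> in at_right 0. 0 < \<delta> \<and> (\<forall>s s'. close (fv \<phi>) \<delta> s s' \<longrightarrow> \<bar>fm_val U s \<phi> - fm_val U s' \<phi>\<bar> < \<epsilon> / 2)"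
    using Sup_fm.IH[of "\<epsilon> / 2"] unfolding wf_fm.simps
    by (intro eventually_conj eventually_at_right_less) (simp only: half_gt_zero)
  then show ?case
  proof (rule eventually_mono, intro allI impI)
    fix \<delta> s s'
    assume *: "0 < \<delta> \<and> (\<forall>s s'. close (fv \<phi>) \<delta> s s' \<longrightarrow> \<bar>fm_val U s \<phi> - fm_val U s' \<phi>\<bar> < \<epsilon> / 2)"
      and c: "close (fv (Sup_fm x \<phi>)) \<delta> s s'"
    have "\<bar>fm_val U (s(x := a)) \<phi> - fm_val U (s'(x := a)) \<phi>\<bar> < \<epsilon> / 2" if "a \<in> univ U" for a
      using * that c by (simp add: close_upd)
    moreover have "s ` (fv \<phi> - {x}) \<subseteq> univ U" "s' ` (fv \<phi> - {x}) \<subseteq> univ U"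
      using c by (auto simp: close_def)
    ultimately have "\<bar>fm_val U s (Sup_fm x \<phi>) - fm_val U s' (Sup_fm x \<phi>)\<bar> \<le> \<epsilon> / 2"
      unfolding fm_val.simps using Sup_fm.prems univ_nonempty
      by (intro abs_SUP_diff_le fm_bdd) (auto intro: less_imp_le)
    then show "\<bar>fm_val U s (Sup_fm x \<phi>) - fm_val U s' (Sup_fm x \<phi>)\<bar> < \<epsilon>"
      using Sup_fm.prems by linarith
  qed
next
  case (Inf_fm x \<phi>)
  then have "\<forall>\<^sub>F \<delta> in at_right 0. 0 < \<delta> \<and> (\<forall>s s'. close (fv \<phi>) \<delta> s s' \<longrightarrow> \<bar>fm_val U s \<phi> - fm_val U s' \<phi>\<bar> < \<epsilon> / 2)"
    using Inf_fm.IH[of "\<epsilon> / 2"] unfolding wf_fm.simps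
    by (intro eventually_conj eventually_at_right_less) (simp only: half_gt_zero)
  then show ?case
  proof (rule eventually_mono, intro allI impI)
    fix \<delta> s s'
    assume *: "0 < \<delta> \<and> (\<forall>s s'. close (fv \<phi>) \<delta> s s' \<longrightarrow> \<bar>fm_val U s \<phi> - fm_val U s' \<phi>\<bar> < \<epsilon> / 2)"
      and c: "close (fv (Inf_fm x \<phi>)) \<delta> s s'"
    have "\<bar>fm_val U (s(x := a)) \<phi> - fm_val U (s'(x := a)) \<phi>\<bar> < \<epsilon> / 2" if "a \<in> univ U" for a
      using * that c by (simp add: close_upd)
    moreover have "s ` (fv \<phi> - {x}) \<subseteq> univ U" "s' ` (fv \<phi> - {x}) \<subseteq> univ U"
      using c by (auto simp: close_def)
    ultimately have "\<bar>fm_val U s (Inf_fm x \<phi>) - fm_val U s' (Inf_fm x \<phi>)\<bar> \<le> \<epsilon> / 2"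
      unfolding fm_val.simps using Inf_fm.prems univ_nonempty
      by (intro abs_INF_diff_le fm_bdd) (auto intro: less_imp_le)
    then show "\<bar>fm_val U s (Inf_fm x \<phi>) - fm_val U s' (Inf_fm x \<phi>)\<bar> < \<epsilon>"
      using Inf_fm.prems by linarith
  qed
qed

end

section \<open>Isomorphisms\<close>

lemma map_tuples: "(\<And>x. x \<in> univ M \<Longrightarrow> h x \<in> univ N) \<Longrightarrow> xs \<in> tuples M n \<Longrightarrow> map h xs \<in> tuples N n"
  by (auto simp: tuples_def)

lemma isomorphism_in: "isomorphism L M N h \<Longrightarrow> x \<in> univ M \<Longrightarrow> h x \<in> univ N"
  by (auto simp: isomorphism_def bij_betw_def)

lemma isomorphism_comp:
  assumes "isomorphism L M N h" "isomorphism L N K k"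
  shows "isomorphism L M K (k \<circ> h)"
  unfolding isomorphism_def
proof (intro conjI ballI)
  show "bij_betw (k \<circ> h) (univ M) (univ K)"
    using assms by (auto simp: isomorphism_def intro: bij_betw_trans)
  show "mdist K ((k \<circ> h) x) ((k \<circ> h) y) = mdist M x y" if "x \<in> univ M" "y \<in> univ M" for x y
    using assms isomorphism_in[OF assms(1)] that by (simp add: isomorphism_def)
  fix xs
  show "fun_int K f (map (k \<circ> h) xs) = (k \<circ> h) (fun_int M f xs)"
    if "f \<in> Funs L" "xs \<in> tuples M (farity L f)" for f
  proof -
    have "map h xs \<in> tuples N (farity L f)"
      using isomorphism_in[OF assms(1)] that(2) by (rule map_tuples)
    then have "fun_int K f (map k (map h xs)) = k (fun_int N f (map h xs))"
      using assms(2) that(1) unfolding isomorphism_def by blast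
    also have "fun_int N f (map h xs) = h (fun_int M f xs)"
      using assms(1) that unfolding isomorphism_def by blast
    finally show ?thesis
      by simp
  qed
  show "rel_int K R (map (k \<circ> h) xs) = rel_int M R xs"
    if "R \<in> Rels L" "xs \<in> tuples M (rarity L R)" for R
  proof -
    have "map h xs \<in> tuples N (rarity L R)"
      using isomorphism_in[OF assms(1)] that(2) by (rule map_tuples)
    then have "rel_int K R (map k (map h xs)) = rel_int N R (map h xs)"
      using assms(2) that(1) unfolding isomorphism_def by blast
    also have "rel_int N R (map h xs) = rel_int M R xs"
      using assms(1) that unfolding isomorphism_def by blast
    finally show ?thesis
      by simp
  qed
qed

text \<open>That \<open>M\<close> is a structure ensures that the values of its functions lie in its
  universe, the only place where \<open>h\<close> can be inverted.\<close>

lemma isomorphism_inv: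
  assumes iso: "isomorphism L M N h" and "is_structure L M"
  shows "isomorphism L N M (inv_into (univ M) h)"
proof -
  let ?k = "inv_into (univ M) h"
  have bij: "bij_betw h (univ M) (univ N)"
    using iso by (simp add: isomorphism_def)
  have bij': "bij_betw ?k (univ N) (univ M)"
    using bij by (rule bij_betw_inv_into)
  then have in_M: "?k x \<in> univ M" if "x \<in> univ N" for x
    using that by (auto simp: bij_betw_def)
  have right: "h (?k x) = x" if "x \<in> univ N" for x
    using bij that by (simp add: bij_betw_inv_into_right)
  have left: "?k (h x) = x" if "x \<in> univ M" for x
    using bij that by (simp add: bij_betw_inv_into_left)
  have map: "map h (map ?k xs) = xs" if "xs \<in> tuples N n" for xs n
    using that right by (auto simp: tuples_def intro!: map_idI)
  show ?thesis
    unfolding isomorphism_def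
  proof (intro conjI ballI bij')
    show "mdist M (?k x) (?k y) = mdist N x y" if "x \<in> univ N" "y \<in> univ N" for x y
    proof -
      have "mdist N (h (?k x)) (h (?k y)) = mdist M (?k x) (?k y)"
        using iso in_M that unfolding isomorphism_def by blast
      then show ?thesis
        using right that by simp
    qed
    fix xs
    show "fun_int M f (map ?k xs) = ?k (fun_int N f xs)"
      if "f \<in> Funs L" "xs \<in> tuples N (farity L f)" for f
    proof -
      have ys: "map ?k xs \<in> tuples M (farity L f)"
        using in_M that(2) by (rule map_tuples)
      then have "fun_int N f (map h (map ?k xs)) = h (fun_int M f (map ?k xs))"
        using iso that(1) unfolding isomorphism_def by blast
      moreover have "fun_int M f (map ?k xs) \<in> univ M"
        using assms(2) ys that(1) unfolding is_structure_def by blast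
      ultimately show ?thesis
        unfolding map[OF that(2)] using left by simp
    qed
    show "rel_int M R (map ?k xs) = rel_int N R xs"
      if "R \<in> Rels L" "xs \<in> tuples N (rarity L R)" for R
    proof -
      have "map ?k xs \<in> tuples M (rarity L R)"
        using in_M that(2) by (rule map_tuples)
      then have "rel_int N R (map h (map ?k xs)) = rel_int M R (map ?k xs)"
        using iso that(1) unfolding isomorphism_def by blast
      then show ?thesis
        unfolding map[OF that(2)] by (rule sym)
    qed
  qed
qed

section \<open>Definable functions and automorphisms\<close>

context language_structure
begin

text \<open>
  The arguments of a definable function are named by the elements of an arbitrary type; naming
  parameters by themselves avoids all bookkeeping of parameter lists.
\<close>

definition dfn :: "'x set \<Rightarrow> (('x \<Rightarrow> 'u) \<Rightarrow> real) \<Rightarrow> bool" where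
  "dfn W F \<longleftrightarrow> (\<exists>\<phi> \<rho>. wf_fm L \<phi> \<and> \<rho> ` fv \<phi> \<subseteq> W \<and> F = (\<lambda>s. fm_val U (s \<circ> \<rho>) \<phi>))"

lemma dfnI: "wf_fm L \<phi> \<Longrightarrow> \<rho> ` fv \<phi> \<subseteq> W \<Longrightarrow> (\<And>s. F s = fm_val U (s \<circ> \<rho>) \<phi>) \<Longrightarrow> dfn W F"
  unfolding dfn_def by blast

lemma dfnE:
  assumes "dfn W F"
  obtains \<phi> \<rho> where "wf_fm L \<phi>" "\<rho> ` fv \<phi> \<subseteq> W" "\<And>s. F s = fm_val U (s \<circ> \<rho>) \<phi>"
  using assms unfolding dfn_def by blast

lemma dfn_mono: "dfn W F \<Longrightarrow> W \<subseteq> W' \<Longrightarrow> dfn W' F"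
  unfolding dfn_def by blast

lemma dfn_finite:
  assumes "dfn W F"
  obtains W' where "W' \<subseteq> W" "finite W'" "dfn W' F"
proof -
  obtain \<phi> \<rho> where "wf_fm L \<phi>" "\<rho> ` fv \<phi> \<subseteq> W" "\<And>s. F s = fm_val U (s \<circ> \<rho>) \<phi>"
    using dfnE[OF assms] by blast
  then show thesis
    using that[of "\<rho> ` fv \<phi>"] dfnI[of \<phi> \<rho> "\<rho> ` fv \<phi>" F] by simp
qed

lemma dfn_cong:
  assumes "dfn W F" "\<And>x. x \<in> W \<Longrightarrow> s x = t x"
  shows "F s = F t"
proof -
  obtain \<phi> \<rho> where *: "wf_fm L \<phi>" "\<rho> ` fv \<phi> \<subseteq> W" "\<And>s. F s = fm_val U (s \<circ> \<rho>) \<phi>"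
    using dfnE[OF assms(1)] by blast
  have "fm_val U (s \<circ> \<rho>) \<phi> = fm_val U (t \<circ> \<rho>) \<phi>"
    using *(2) assms(2) by (intro fm_val_cong) auto
  then show ?thesis
    using * by simp
qed

lemma dfn_rename:
  assumes "dfn W F"
  shows "dfn (\<sigma> ` W) (\<lambda>s. F (s \<circ> \<sigma>))"
proof -
  obtain \<phi> \<rho> where *: "wf_fm L \<phi>" "\<rho> ` fv \<phi> \<subseteq> W" "\<And>s. F s = fm_val U (s \<circ> \<rho>) \<phi>"
    using dfnE[OF assms(1)] by blast
  then show ?thesis
    by (intro dfnI[of \<phi> "\<sigma> \<circ> \<rho>"]) (auto simp: comp_assoc)
qed

text \<open>To quantify over an argument \<open>y\<close>, exactly one variable must carry it.
  Variables naming the same element are merged first, by renaming along an injection \<sigma> of the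
  finite set of names into the natural numbers.\<close>

lemma dfn_injE:
  assumes "dfn W F"
  obtains \<phi> \<rho> where "wf_fm L \<phi>" "inj_on \<rho> (fv \<phi>)" "\<rho> ` fv \<phi> \<subseteq> W" "\<And>s. F s = fm_val U (s \<circ> \<rho>) \<phi>"
proof -
  obtain \<phi> \<rho> where *: "wf_fm L \<phi>" "\<rho> ` fv \<phi> \<subseteq> W" "\<And>s. F s = fm_val U (s \<circ> \<rho>) \<phi>"
    using dfnE[OF assms(1)] by blast
  define I where "I = \<rho> ` fv \<phi>"
  obtain \<sigma> :: "_ \<Rightarrow> nat" where \<sigma>: "inj_on \<sigma> I"
    using finite_imp_inj_to_nat_seg[of I] by (auto simp: I_def)
  let ?\<phi> = "ren_fm (\<sigma> \<circ> \<rho>) \<phi>"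
  have fv: "fv ?\<phi> \<subseteq> \<sigma> ` I"
    using fv_ren[of "\<sigma> \<circ> \<rho>" \<phi>] by (simp add: I_def image_comp)
  show thesis
  proof
    show "wf_fm L ?\<phi>"
      using * by simp
    show "inj_on (inv_into I \<sigma>) (fv ?\<phi>)"
      using fv by (rule inj_on_inv_into)
    show "inv_into I \<sigma> ` fv ?\<phi> \<subseteq> W"
      using fv \<sigma> *(2) by (auto simp: I_def dest!: subsetD)
    fix s
    have "fm_val U (s \<circ> inv_into I \<sigma>) ?\<phi> = fm_val U ((s \<circ> inv_into I \<sigma>) \<circ> (\<sigma> \<circ> \<rho>)) \<phi>"
      by (rule fm_val_ren)
    also have "\<dots> = fm_val U (s \<circ> \<rho>) \<phi>"
      using \<sigma> by (intro fm_val_cong) (simp add: I_def)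
    finally show "F s = fm_val U (s \<circ> inv_into I \<sigma>) ?\<phi>"
      using *(3) by simp
  qed
qed

lemma dfn_connective:
  fixes u :: "(nat \<Rightarrow> real) \<Rightarrow> real"
  assumes "dfn W F" "dfn W G" "continuous_on UNIV u"
  shows "dfn W (\<lambda>s. u (\<lambda>i. if i = 0 then F s else if i = 1 then G s else 0))"
proof -
  obtain \<phi> \<rho> where \<phi>: "wf_fm L \<phi>" "\<rho> ` fv \<phi> \<subseteq> W" "\<And>s. F s = fm_val U (s \<circ> \<rho>) \<phi>"
    using dfnE[OF assms(1)] by blast
  obtain \<psi> \<sigma> where \<psi>: "wf_fm L \<psi>" "\<sigma> ` fv \<psi> \<subseteq> W" "\<And>s. G s = fm_val U (s \<circ> \<sigma>) \<psi>"
    using dfnE[OF assms(2)] by blast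
  \<comment> \<open>The variables of the two formulas are moved to even and odd numbers, so that one
    naming serves both.\<close>
  define \<tau> where "\<tau> n = (if even n then \<rho> (n div 2) else \<sigma> (n div 2))" for n
  let ?\<phi> = "ren_fm (\<lambda>n. 2 * n) \<phi>" and ?\<psi> = "ren_fm (\<lambda>n. 2 * n + 1) \<psi>"
  have \<tau>: "\<tau> \<circ> (\<lambda>n. 2 * n) = \<rho>" "\<tau> \<circ> (\<lambda>n. 2 * n + 1) = \<sigma>"
    by (auto simp: \<tau>_def fun_eq_iff)
  show ?thesis
  proof (rule dfnI[of "Conn u [?\<phi>, ?\<psi>]" \<tau>])
    show "wf_fm L (Conn u [?\<phi>, ?\<psi>])"
      using \<phi> \<psi> assms(3) by simp
    have "\<tau> ` fv ?\<phi> \<subseteq> (\<tau> \<circ> (\<lambda>n. 2 * n)) ` fv \<phi>" "\<tau> ` fv ?\<psi> \<subseteq> (\<tau> \<circ> (\<lambda>n. 2 * n + 1)) ` fv \<psi>"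
      unfolding image_comp[symmetric] by (intro image_mono fv_ren)+
    then show "\<tau> ` fv (Conn u [?\<phi>, ?\<psi>]) \<subseteq> W"
      using \<phi>(2) \<psi>(2) unfolding \<tau> by (auto dest!: subsetD simp: image_subset_iff)
    fix s
    have v: "fm_val U (s \<circ> \<tau>) ?\<phi> = F s" "fm_val U (s \<circ> \<tau>) ?\<psi> = G s"
      unfolding fm_val_ren comp_assoc \<tau> using \<phi>(3) \<psi>(3) by simp_all
    have "(\<lambda>i. if i < length [?\<phi>, ?\<psi>] then map (fm_val U (s \<circ> \<tau>)) [?\<phi>, ?\<psi>] ! i else 0)
        = (\<lambda>i. if i = 0 then F s else if i = 1 then G s else 0)"
      using v by (auto simp: fun_eq_iff nth_Cons')
    then show "u (\<lambda>i. if i = 0 then F s else if i = 1 then G s else 0) = fm_val U (s \<circ> \<tau>) (Conn u [?\<phi>, ?\<psi>])"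
      by (simp only: fm_val.simps)
  qed
qed

lemma dfn_max:
  assumes "dfn W F" "dfn W G"
  shows "dfn W (\<lambda>s. max (F s) (G s))"
  using dfn_connective[OF assms, of "\<lambda>v. max (v 0) (v 1)"]
  by (simp add: continuous_on_max)

lemma dfn_affine:
  assumes "dfn W F"
  shows "dfn W (\<lambda>s. a * F s + b)"
  using dfn_connective[OF assms assms, of "\<lambda>v. a * v 0 + b"]
  by (simp add: continuous_on_add continuous_on_mult)

lemma dfn_const: "dfn W (\<lambda>s. c)"
  by (rule dfnI[of "Conn (\<lambda>_. c) []"]) auto

lemma dfn_dist:
  assumes "x \<in> W" "y \<in> W"
  shows "dfn W (\<lambda>s. d (s x) (s y))"
  using assms
  by (intro dfnI[of "Dist (Var 0) (Var 1)" "\<lambda>n. if n = 0 then x else y"]) auto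

text \<open>Finite conjunctions of conditions "below 1" are again of this form: \<open>G\<close> is
  a maximum, and the constant 0 for the empty conjunction.\<close>

lemma dfn_finite_max:
  assumes "finite I" "\<And>i. i \<in> I \<Longrightarrow> dfn W (F i)"
  shows "\<exists>G. dfn W G \<and> (\<forall>s. G s < 1 \<longleftrightarrow> (\<forall>i\<in>I. F i s < 1))"
  using assms
proof (induction I rule: finite_induct)
  case empty
  show ?case
    by (intro exI[of _ "\<lambda>_. 0"]) (simp add: dfn_const)
next
  case (insert i I)
  then obtain G where "dfn W G" "\<forall>s. G s < 1 \<longleftrightarrow> (\<forall>i\<in>I. F i s < 1)"
    by auto
  then show ?case
    using insert by (intro exI[of _ "\<lambda>s. max (F i s) (G s)"]) (simp add: dfn_max)
qed

text \<open>\<open>F'\<close> is the infimum of \<open>F\<close> over the argument \<open>y\<close>.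
  It is described through strict inequalities because an infimum is below \<open>c\<close> exactly
  when some value is, whether or not it is attained.\<close>

lemma dfn_inf:
  assumes "dfn W F"
  shows "\<exists>F'. dfn (W - {y}) F' \<and>
    (\<forall>s c. s ` (W - {y}) \<subseteq> univ U \<longrightarrow> (F' s < c \<longleftrightarrow> (\<exists>a\<in>univ U. F (s(y := a)) < c)))"
proof -
  obtain \<phi> \<rho> where \<phi>: "wf_fm L \<phi>" "inj_on \<rho> (fv \<phi>)" "\<rho> ` fv \<phi> \<subseteq> W" "\<And>s. F s = fm_val U (s \<circ> \<rho>) \<phi>"
    using dfn_injE[OF assms] by blast
  show ?thesis
  proof (cases "y \<in> \<rho> ` fv \<phi>")
    case False
    then have "dfn (W - {y}) F"
      using \<phi> by (intro dfnI[of \<phi> \<rho>]) auto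
    moreover have "F (s(y := a)) = F s" for s a
      by (rule dfn_cong[OF \<open>dfn (W - {y}) F\<close>]) simp
    ultimately show ?thesis
      using univ_nonempty by (intro exI[of _ F]) auto
  next
    case True
    then obtain k where k: "k \<in> fv \<phi>" "\<rho> k = y"
      by auto
    have sub: "\<rho> ` (fv \<phi> - {k}) \<subseteq> W - {y}"
      using \<phi> k by (auto dest: inj_onD)
    have upd: "fm_val U ((s \<circ> \<rho>)(k := a)) \<phi> = F (s(y := a))" for s a
      unfolding \<phi>(4) using \<phi>(2) k by (intro fm_val_cong) (auto dest: inj_onD)
    have "fm_val U (s \<circ> \<rho>) (Inf_fm k \<phi>) < c \<longleftrightarrow> (\<exists>a\<in>univ U. F (s(y := a)) < c)"
      if "s ` (W - {y}) \<subseteq> univ U" for s c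
    proof -
      have "(s \<circ> \<rho>) ` (fv \<phi> - {k}) \<subseteq> univ U"
        using that sub by (auto simp: image_comp[symmetric])
      then show ?thesis
        using cINF_less_iff[OF univ_nonempty fm_bdd(1)[OF \<phi>(1), of "s \<circ> \<rho>" k], of c]
        by (simp add: upd)
    qed
    moreover have "dfn (W - {y}) (\<lambda>s. fm_val U (s \<circ> \<rho>) (Inf_fm k \<phi>))"
      using \<phi>(1) sub by (intro dfnI[of "Inf_fm k \<phi>" \<rho>]) auto
    ultimately show ?thesis
      by (intro exI[of _ "\<lambda>s. fm_val U (s \<circ> \<rho>) (Inf_fm k \<phi>)"]) blast
  qed
qed

lemma dfn_infs:
  assumes "finite Y" "dfn W F"
  shows "\<exists>F'. dfn (W - Y) F' \<and> (\<forall>s c. s ` (W - Y) \<subseteq> univ U \<longrightarrow>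
    (F' s < c \<longleftrightarrow> (\<exists>t. (\<forall>x. x \<notin> Y \<longrightarrow> t x = s x) \<and> t ` Y \<subseteq> univ U \<and> F t < c)))"
  using assms
proof (induction Y arbitrary: W F rule: finite_induct)
  case empty
  have "(\<forall>x. t x = s x) \<longleftrightarrow> t = s" for t s :: "'a \<Rightarrow> 'u"
    by auto
  then show ?case
    using empty by (intro exI[of _ F]) simp
next
  case (insert y Y)
  obtain G where G: "dfn (W - Y) G" "\<And>s c. s ` (W - Y) \<subseteq> univ U \<Longrightarrow>
    G s < c \<longleftrightarrow> (\<exists>t. (\<forall>x. x \<notin> Y \<longrightarrow> t x = s x) \<and> t ` Y \<subseteq> univ U \<and> F t < c)"
    using insert.IH[OF insert.prems] by blast
  obtain F' where F': "dfn (W - Y - {y}) F'" "\<And>s c. s ` (W - Y - {y}) \<subseteq> univ U \<Longrightarrow>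
    F' s < c \<longleftrightarrow> (\<exists>a\<in>univ U. G (s(y := a)) < c)"
    using dfn_inf[OF G(1), of y] by blast
  have "F' s < c \<longleftrightarrow> (\<exists>t. (\<forall>x. x \<notin> insert y Y \<longrightarrow> t x = s x) \<and> t ` insert y Y \<subseteq> univ U \<and> F t < c)"
    if s: "s ` (W - insert y Y) \<subseteq> univ U" for s c
  proof -
    have 1: "F' s < c \<longleftrightarrow> (\<exists>a\<in>univ U. G (s(y := a)) < c)"
      using s by (intro F'(2)) auto
    have 2: "G (s(y := a)) < c \<longleftrightarrow> (\<exists>t. (\<forall>x. x \<notin> Y \<longrightarrow> t x = (s(y := a)) x) \<and> t ` Y \<subseteq> univ U \<and> F t < c)"
      if "a \<in> univ U" for a
      using s that by (intro G(2)) auto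
    show ?thesis
    proof
      assume "F' s < c"
      then obtain a t where "a \<in> univ U" "\<forall>x. x \<notin> Y \<longrightarrow> t x = (s(y := a)) x" "t ` Y \<subseteq> univ U" "F t < c"
        using 1 2 by blast
      then show "\<exists>t. (\<forall>x. x \<notin> insert y Y \<longrightarrow> t x = s x) \<and> t ` insert y Y \<subseteq> univ U \<and> F t < c"
        using insert.hyps by (intro exI[of _ t]) auto
    next
      assume "\<exists>t. (\<forall>x. x \<notin> insert y Y \<longrightarrow> t x = s x) \<and> t ` insert y Y \<subseteq> univ U \<and> F t < c"
      then obtain t where t: "\<forall>x. x \<notin> insert y Y \<longrightarrow> t x = s x" "t ` insert y Y \<subseteq> univ U" "F t < c"
        by blast
      then have "G (s(y := t y)) < c"
        by (subst 2) (auto intro!: exI[of _ t])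
      then show "F' s < c"
        using 1 t(2) by auto
    qed
  qed
  moreover have "W - Y - {y} = W - insert y Y"
    by auto
  ultimately show ?case
    using F'(1) by (intro exI[of _ F']) auto
qed

lemma dfn_unif_cont:
  assumes "dfn W F" "\<epsilon> > 0"
  obtains \<delta> where "\<delta> > 0"
    "\<And>s t. s ` W \<subseteq> univ U \<Longrightarrow> t ` W \<subseteq> univ U \<Longrightarrow> (\<And>x. x \<in> W \<Longrightarrow> d (s x) (t x) < \<delta>) \<Longrightarrow> \<bar>F s - F t\<bar> < \<epsilon>"
proof -
  obtain \<phi> \<rho> where *: "wf_fm L \<phi>" "\<rho> ` fv \<phi> \<subseteq> W" "\<And>s. F s = fm_val U (s \<circ> \<rho>) \<phi>"
    using dfnE[OF assms(1)] by blast
  have "\<forall>\<^sub>F \<delta> in at_right 0. 0 < \<delta> \<and> (\<forall>s s'. close (fv \<phi>) \<delta> s s' \<longrightarrow> \<bar>fm_val U s \<phi> - fm_val U s' \<phi>\<bar> < \<epsilon>)"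
    by (intro eventually_conj eventually_at_right_less fm_unif_cont *(1) assms(2))
  then obtain \<delta> where \<delta>: "0 < \<delta>" "\<And>s s'. close (fv \<phi>) \<delta> s s' \<Longrightarrow> \<bar>fm_val U s \<phi> - fm_val U s' \<phi>\<bar> < \<epsilon>"
    using eventually_happens'[OF trivial_limit_at_right_real] by blast
  show thesis
  proof (rule that[OF \<delta>(1)])
    fix s t :: "_ \<Rightarrow> 'u"
    assume "s ` W \<subseteq> univ U" "t ` W \<subseteq> univ U" "\<And>x. x \<in> W \<Longrightarrow> d (s x) (t x) < \<delta>"
    then have "close (fv \<phi>) \<delta> (s \<circ> \<rho>) (t \<circ> \<rho>)"
      using *(2) unfolding close_def by (simp add: image_subset_iff)
    then show "\<bar>F s - F t\<bar> < \<epsilon>"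
      using \<delta>(2) *(3) by simp
  qed
qed

section \<open>Automorphisms and invariance of formulas\<close>

definition Aut :: "('u \<Rightarrow> 'u) set" where
  "Aut = {g. isomorphism L U U g}"

definition Aut_over :: "'u set \<Rightarrow> ('u \<Rightarrow> 'u) set" where
  "Aut_over A = {g \<in> Aut. \<forall>a\<in>A. g a = a}"

lemma Aut_in: "g \<in> Aut \<Longrightarrow> x \<in> univ U \<Longrightarrow> g x \<in> univ U"
  by (auto simp: Aut_def isomorphism_def bij_betw_def)

lemma Aut_dist: "g \<in> Aut \<Longrightarrow> x \<in> univ U \<Longrightarrow> y \<in> univ U \<Longrightarrow> d (g x) (g y) = d x y"
  by (auto simp: Aut_def isomorphism_def)

lemma Aut_bij: "g \<in> Aut \<Longrightarrow> bij_betw g (univ U) (univ U)"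
  by (auto simp: Aut_def isomorphism_def)

lemma Aut_fun:
  "g \<in> Aut \<Longrightarrow> f \<in> Funs L \<Longrightarrow> xs \<in> tuples U (farity L f) \<Longrightarrow> fun_int U f (map g xs) = g (fun_int U f xs)"
  by (auto simp: Aut_def isomorphism_def)

lemma Aut_rel:
  "g \<in> Aut \<Longrightarrow> R \<in> Rels L \<Longrightarrow> xs \<in> tuples U (rarity L R) \<Longrightarrow> rel_int U R (map g xs) = rel_int U R xs"
  by (auto simp: Aut_def isomorphism_def)

lemma id_Aut: "id \<in> Aut"
  by (simp add: Aut_def isomorphism_def)

lemma comp_Aut: "g \<in> Aut \<Longrightarrow> h \<in> Aut \<Longrightarrow> g \<circ> h \<in> Aut"
  unfolding Aut_def mem_Collect_eq by (rule isomorphism_comp)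

text \<open>An automorphism is a function on the whole type, with no control outside the universe;
  hence the inverse relative to \<open>univ U\<close>, with cancellation laws restricted to
  it.\<close>

definition aut_inv :: "('u \<Rightarrow> 'u) \<Rightarrow> 'u \<Rightarrow> 'u" where
  "aut_inv g = inv_into (univ U) g"

lemma aut_inv_left [simp]: "g \<in> Aut \<Longrightarrow> x \<in> univ U \<Longrightarrow> aut_inv g (g x) = x"
  using Aut_bij[of g] by (simp add: aut_inv_def bij_betw_inv_into_left)

lemma aut_inv_right [simp]: "g \<in> Aut \<Longrightarrow> x \<in> univ U \<Longrightarrow> g (aut_inv g x) = x"
  using Aut_bij[of g] by (simp add: aut_inv_def bij_betw_inv_into_right)

lemma aut_inv_Aut: "g \<in> Aut \<Longrightarrow> aut_inv g \<in> Aut"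
  unfolding Aut_def mem_Collect_eq aut_inv_def using struct_U by (intro isomorphism_inv)

lemma Aut_over_comp: "g \<in> Aut_over A \<Longrightarrow> h \<in> Aut_over A \<Longrightarrow> g \<circ> h \<in> Aut_over A"
  by (auto simp: Aut_over_def comp_Aut)

lemma Aut_over_mono: "g \<in> Aut_over B \<Longrightarrow> A \<subseteq> B \<Longrightarrow> g \<in> Aut_over A"
  by (auto simp: Aut_over_def)

lemma Aut_tm_val:
  assumes "g \<in> Aut"
  shows "wf_tm L t \<Longrightarrow> s ` fv_tm t \<subseteq> univ U \<Longrightarrow> tm_val U (g \<circ> s) t = g (tm_val U s t)"
proof (induction t)
  case (Fn f ts)
  have "tm_val U (g \<circ> s) t = g (tm_val U s t)" if "t \<in> set ts" for t
    using Fn.prems that by (intro Fn.IH) auto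
  then have "map (tm_val U (g \<circ> s)) ts = map g (map (tm_val U s) ts)"
    by simp
  moreover have "map (tm_val U s) ts \<in> tuples U (farity L f)" "f \<in> Funs L"
    using Fn.prems tm_vals_in[of ts s] by auto
  ultimately show ?case
    unfolding tm_val.simps using Aut_fun[OF assms] by metis
qed simp

lemma Aut_fm_val:
  assumes "g \<in> Aut"
  shows "wf_fm L \<phi> \<Longrightarrow> s ` fv \<phi> \<subseteq> univ U \<Longrightarrow> fm_val U (g \<circ> s) \<phi> = fm_val U s \<phi>"
proof (induction \<phi> arbitrary: s)
  case (Dist t t')
  then have "tm_val U (g \<circ> s) t = g (tm_val U s t)" "tm_val U (g \<circ> s) t' = g (tm_val U s t')"
    "tm_val U s t \<in> univ U" "tm_val U s t' \<in> univ U"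
    by (auto intro!: Aut_tm_val[OF assms] tm_val_in)
  then show ?case
    unfolding fm_val.simps by (simp only: Aut_dist[OF assms])
next
  case (Rel R ts)
  have "tm_val U (g \<circ> s) t = g (tm_val U s t)" if "t \<in> set ts" for t
    using Rel that by (intro Aut_tm_val[OF assms]) auto
  then have "map (tm_val U (g \<circ> s)) ts = map g (map (tm_val U s) ts)"
    by simp
  moreover have "map (tm_val U s) ts \<in> tuples U (rarity L R)" "R \<in> Rels L"
    using Rel tm_vals_in[of ts s] by auto
  ultimately show ?case
    unfolding fm_val.simps using Aut_rel[OF assms] by metis
next
  case (Conn u \<phi>s)
  have "map (fm_val U (g \<circ> s)) \<phi>s = map (fm_val U s) \<phi>s"
  proof (rule map_cong[OF refl])
    fix \<phi> assume \<phi>: "\<phi> \<in> set \<phi>s"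
    have "wf_fm L \<phi>" "s ` fv \<phi> \<subseteq> univ U"
      using Conn.prems \<phi> by auto
    then show "fm_val U (g \<circ> s) \<phi> = fm_val U s \<phi>"
      by (rule Conn.IH[OF \<phi>])
  qed
  then show ?case
    by (simp only: fm_val.simps)
next
  case (Sup_fm x \<phi>)
  have "fm_val U ((g \<circ> s)(x := g a)) \<phi> = fm_val U (s(x := a)) \<phi>" if "a \<in> univ U" for a
  proof -
    have "fm_val U (g \<circ> (s(x := a))) \<phi> = fm_val U (s(x := a)) \<phi>"
      using Sup_fm.prems that by (intro Sup_fm.IH) (auto simp: image_subset_iff)
    moreover have "g \<circ> (s(x := a)) = (g \<circ> s)(x := g a)"
      by auto
    ultimately show ?thesis
      by (simp only:)
  qed
  \<comment> \<open>Since \<open>g\<close> permutes the universe, the supremum may be taken over the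
    points \<open>g a\<close>.\<close>
  then have "(\<lambda>a. fm_val U ((g \<circ> s)(x := a)) \<phi>) ` (g ` univ U) = (\<lambda>a. fm_val U (s(x := a)) \<phi>) ` univ U"
    unfolding image_image by (intro image_cong) auto
  moreover have "g ` univ U = univ U"
    using Aut_bij[OF assms] by (simp add: bij_betw_def)
  ultimately show ?case
    by (simp only: fm_val.simps)
next
  case (Inf_fm x \<phi>)
  have "fm_val U ((g \<circ> s)(x := g a)) \<phi> = fm_val U (s(x := a)) \<phi>" if "a \<in> univ U" for a
  proof -
    have "fm_val U (g \<circ> (s(x := a))) \<phi> = fm_val U (s(x := a)) \<phi>"
      using Inf_fm.prems that by (intro Inf_fm.IH) (auto simp: image_subset_iff)
    moreover have "g \<circ> (s(x := a)) = (g \<circ> s)(x := g a)"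
      by auto
    ultimately show ?thesis
      by (simp only:)
  qed
  then have "(\<lambda>a. fm_val U ((g \<circ> s)(x := a)) \<phi>) ` (g ` univ U) = (\<lambda>a. fm_val U (s(x := a)) \<phi>) ` univ U"
    unfolding image_image by (intro image_cong) auto
  moreover have "g ` univ U = univ U"
    using Aut_bij[OF assms] by (simp add: bij_betw_def)
  ultimately show ?case
    by (simp only: fm_val.simps)
qed

lemma dfn_Aut:
  assumes "dfn W F" "g \<in> Aut" "s ` W \<subseteq> univ U"
  shows "F (g \<circ> s) = F s"
proof -
  obtain \<phi> \<rho> where *: "wf_fm L \<phi>" "\<rho> ` fv \<phi> \<subseteq> W" "\<And>s. F s = fm_val U (s \<circ> \<rho>) \<phi>"
    using dfnE[OF assms(1)] by blast
  have "fm_val U (g \<circ> (s \<circ> \<rho>)) \<phi> = fm_val U (s \<circ> \<rho>) \<phi>"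
    using * assms by (intro Aut_fm_val) auto
  then show ?thesis
    using * by (simp add: comp_assoc)
qed

subsection \<open>Elementary substructures\<close>

text \<open>The Tarski-Vaught condition in its continuous form, for a bare subset: only approximate
  witnesses are required, since infima need not be attained.\<close>

definition elementary :: "'u set \<Rightarrow> bool" where
  "elementary N \<longleftrightarrow> N \<subseteq> univ U \<and> N \<noteq> {} \<and>
     (\<forall>\<phi> s x c. wf_fm L \<phi> \<and> s ` (fv \<phi> - {x}) \<subseteq> N \<and> (\<exists>a\<in>univ U. fm_val U (s(x := a)) \<phi> < c) \<longrightarrow>
        (\<exists>a\<in>N. fm_val U (s(x := a)) \<phi> < c))"

lemma elementary_univ:
  assumes "elementary_substructure L M U"
  shows "elementary (univ M)"
proof -
  have M: "univ M \<subseteq> univ U" "univ M \<noteq> {}"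
    using assms by (auto simp: elementary_substructure_def is_structure_def)
  have val: "fm_val M s \<phi> = fm_val U s \<phi>" if "wf_fm L \<phi>" "s ` fv \<phi> \<subseteq> univ M" for s \<phi>
  proof -
    obtain e where e: "e \<in> univ M"
      using M by blast
    obtain n where n: "fv \<phi> \<subseteq> {..<n}"
      using finite_nat_iff_bounded finite_fv by blast
    define xs where "xs = map (\<lambda>i. if i \<in> fv \<phi> then s i else e) [0..<n]"
    have "set xs \<subseteq> univ M" "fv \<phi> \<subseteq> {..<length xs}"
      using that e n by (auto simp: xs_def)
    then have "val M \<phi> xs = val U \<phi> xs"
      using assms that(1) unfolding elementary_substructure_def by blast
    moreover have "xs ! i = s i" if "i \<in> fv \<phi>" for i
      using n that by (auto simp: xs_def)
    ultimately show ?thesis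
      unfolding val_def using fm_val_cong[of \<phi> "\<lambda>i. xs ! i" s M] fm_val_cong[of \<phi> "\<lambda>i. xs ! i" s U]
      by simp
  qed
  have "\<exists>a\<in>univ M. fm_val U (s(x := a)) \<phi> < c"
    if \<phi>: "wf_fm L \<phi>" "s ` (fv \<phi> - {x}) \<subseteq> univ M" and a: "a \<in> univ U" "fm_val U (s(x := a)) \<phi> < c" for \<phi> s x c a
  proof -
    have "s ` (fv \<phi> - {x}) \<subseteq> univ U"
      using \<phi> M by auto
    then have "fm_val U s (Inf_fm x \<phi>) < c"
      using cINF_less_iff[OF univ_nonempty fm_bdd(1)[OF \<phi>(1), of s x]] a by auto
    moreover have "fm_val M s (Inf_fm x \<phi>) = fm_val U s (Inf_fm x \<phi>)"
      using \<phi> by (intro val) auto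
    ultimately have "(INF a\<in>univ M. fm_val M (s(x := a)) \<phi>) < c"
      by simp
    then obtain b where b: "b \<in> univ M" "fm_val M (s(x := b)) \<phi> < c"
      using cInf_lessD[of "(\<lambda>a. fm_val M (s(x := a)) \<phi>) ` univ M" c] M(2) by blast
    moreover have "fm_val M (s(x := b)) \<phi> = fm_val U (s(x := b)) \<phi>"
      using \<phi> b by (intro val) auto
    ultimately show ?thesis
      by auto
  qed
  then show ?thesis
    unfolding elementary_def using M by blast
qed

lemma elementary_witness1:
  assumes "elementary N" "dfn W F" "s ` (W - {y}) \<subseteq> N" "a \<in> univ U" "F (s(y := a)) < c"
  shows "\<exists>a\<in>N. F (s(y := a)) < c"
proof -
  obtain \<phi> \<rho> where \<phi>: "wf_fm L \<phi>" "inj_on \<rho> (fv \<phi>)" "\<rho> ` fv \<phi> \<subseteq> W" "\<And>s. F s = fm_val U (s \<circ> \<rho>) \<phi>"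
    using dfn_injE[OF assms(2)] by blast
  show ?thesis
  proof (cases "y \<in> \<rho> ` fv \<phi>")
    case False
    obtain b where "b \<in> N"
      using assms(1) by (auto simp: elementary_def)
    moreover have "F (s(y := a)) = F (s(y := b))"
      unfolding \<phi>(4) using False by (intro fm_val_cong) auto
    ultimately show ?thesis
      using assms(5) by auto
  next
    case True
    then obtain k where k: "k \<in> fv \<phi>" "\<rho> k = y"
      by auto
    have upd: "fm_val U ((s \<circ> \<rho>)(k := a)) \<phi> = F (s(y := a))" for a
      unfolding \<phi>(4) using \<phi>(2) k by (intro fm_val_cong) (auto dest: inj_onD)
    have "\<rho> ` (fv \<phi> - {k}) \<subseteq> W - {y}"
      using \<phi>(2,3) k by (auto dest: inj_onD)
    then have "(s \<circ> \<rho>) ` (fv \<phi> - {k}) \<subseteq> N"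
      using assms(3) by (auto simp: image_subset_iff)
    moreover have "\<exists>a\<in>univ U. fm_val U ((s \<circ> \<rho>)(k := a)) \<phi> < c"
      using assms upd by auto
    ultimately have "\<exists>a\<in>N. fm_val U ((s \<circ> \<rho>)(k := a)) \<phi> < c"
      using assms(1) \<phi>(1) unfolding elementary_def by blast
    then show ?thesis
      using upd by simp
  qed
qed

text \<open>The arguments in \<open>V\<close> are moved into \<open>N\<close> one at a time:
  \<open>y\<close> is quantified away, the others are moved by induction, and only then is a value
  for \<open>y\<close> chosen in \<open>N\<close>, relative to the points already moved.\<close>

lemma elementary_witness:
  assumes "elementary N" "finite V" "dfn W F" "s ` W \<subseteq> univ U" "s ` (W - V) \<subseteq> N" "F s < c"
  shows "\<exists>t. (\<forall>x. x \<notin> V \<longrightarrow> t x = s x) \<and> t ` W \<subseteq> N \<and> F t < c"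
  using assms(2-)
proof (induction V arbitrary: W F rule: finite_induct)
  case empty
  then show ?case by auto
next
  case (insert y V)
  show ?case
  proof (cases "y \<in> W")
    case False
    then have "W - V = W - insert y V"
      by auto
    then obtain t where "\<forall>x. x \<notin> V \<longrightarrow> t x = s x" "t ` W \<subseteq> N" "F t < c"
      using insert.IH[OF insert.prems(1,2)] insert.prems(3,4) by auto
    then show ?thesis
      by (intro exI[of _ t]) auto
  next
    case True
    obtain G where G: "dfn (W - {y}) G" "\<And>s c. s ` (W - {y}) \<subseteq> univ U \<Longrightarrow>
        G s < c \<longleftrightarrow> (\<exists>a\<in>univ U. F (s(y := a)) < c)"
      using dfn_inf[OF insert.prems(1), of y] by blast
    have "G s < c"
    proof (subst G(2))
      show "\<exists>a\<in>univ U. F (s(y := a)) < c"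
        using insert.prems True by (intro bexI[of _ "s y"]) auto
    qed (use insert.prems in auto)
    moreover have "s ` (W - {y} - V) \<subseteq> N" "s ` (W - {y}) \<subseteq> univ U"
      using insert.prems by auto
    ultimately obtain t where t: "\<And>x. x \<notin> V \<Longrightarrow> t x = s x" "t ` (W - {y}) \<subseteq> N" "G t < c"
      using insert.IH[OF G(1)] by blast
    have "t ` (W - {y}) \<subseteq> univ U"
      using t(2) assms(1) by (auto simp: elementary_def)
    then obtain a where "a \<in> univ U" "F (t(y := a)) < c"
      using G(2)[of t c] t(3) by blast
    then obtain b where "b \<in> N" "F (t(y := b)) < c"
      using elementary_witness1[OF assms(1) insert.prems(1) t(2)] by blast
    then show ?thesis
      using t by (intro exI[of _ "t(y := b)"] conjI) (auto simp del: fun_upd_apply, auto)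
  qed
qed

section \<open>Metric closures\<close>

definition cl :: "'u set \<Rightarrow> 'u set" where
  "cl X = {y \<in> univ U. \<forall>\<epsilon>>0. \<exists>x\<in>X. d x y < \<epsilon>}"

lemma cl_subset: "X \<subseteq> univ U \<Longrightarrow> X \<subseteq> cl X"
  by (force simp: cl_def)

lemma cl_in_univ: "cl X \<subseteq> univ U"
  by (auto simp: cl_def)

lemma cl_mono: "X \<subseteq> Y \<Longrightarrow> cl X \<subseteq> cl Y"
  by (fastforce simp: cl_def)

lemma cl_approx: "y \<in> cl X \<Longrightarrow> \<epsilon> > 0 \<Longrightarrow> \<exists>x\<in>X. d x y < \<epsilon>"
  by (auto simp: cl_def)

lemma cl_cl: "X \<subseteq> univ U \<Longrightarrow> cl (cl X) = cl X"
proof (rule subset_antisym)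
  assume X: "X \<subseteq> univ U"
  show "cl (cl X) \<subseteq> cl X"
  proof
    fix y assume y: "y \<in> cl (cl X)"
    have "\<exists>x\<in>X. d x y < \<epsilon>" if "\<epsilon> > 0" for \<epsilon>
    proof -
      obtain z where z: "z \<in> cl X" "d z y < \<epsilon> / 2"
        using cl_approx[OF y, of "\<epsilon> / 2"] \<open>\<epsilon> > 0\<close> by auto
      obtain x where x: "x \<in> X" "d x z < \<epsilon> / 2"
        using cl_approx[OF z(1), of "\<epsilon> / 2"] \<open>\<epsilon> > 0\<close> by auto
      have "x \<in> univ U" "y \<in> univ U" "z \<in> univ U"
        using x z y X cl_in_univ by auto
      then have "d x y \<le> d x z + d z y"
        using triangle by blast
      then show ?thesis
        using x z by (intro bexI[of _ x]) auto
    qed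
    then show "y \<in> cl X"
      using y by (auto simp: cl_def)
  qed
  show "cl X \<subseteq> cl (cl X)"
    using cl_in_univ by (rule cl_subset)
qed

text \<open>A point of the closure is the limit in \<open>U\<close> of a sequence in
  \<open>M\<close>. This sequence is Cauchy, so by completeness of \<open>M\<close> it also has a
  limit in \<open>M\<close>, and the two limits coincide.\<close>

lemma cl_univ_eq:
  assumes "elementary_substructure L M U"
  shows "cl (univ M) = univ M"
proof -
  interpret M: Metric_space "univ M" "mdist M"
    using assms by (simp add: elementary_substructure_def is_structure_def)
  have sub: "univ M \<subseteq> univ U" and eq: "\<And>x y. x \<in> univ M \<Longrightarrow> y \<in> univ M \<Longrightarrow> mdist M x y = d x y"
    and complete: "M.mcomplete"
    using assms by (auto simp: elementary_substructure_def is_structure_def)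
  have "y \<in> univ M" if y: "y \<in> cl (univ M)" for y
  proof -
    have yU: "y \<in> univ U"
      using y cl_in_univ by auto
    have "\<exists>x\<in>univ M. d x y < inverse (real (Suc n))" for n
      using y by (intro cl_approx) auto
    then obtain \<sigma> where \<sigma>: "\<And>n. \<sigma> n \<in> univ M" "\<And>n. d (\<sigma> n) y < inverse (real (Suc n))"
      by metis
    have small: "\<exists>k. \<forall>n\<ge>k. d (\<sigma> n) y < \<epsilon>" if \<epsilon>: "\<epsilon> > 0" for \<epsilon>
    proof -
      obtain k where k: "inverse (real (Suc k)) < \<epsilon>"
        using reals_Archimedean[OF \<epsilon>] by blast
      have "d (\<sigma> n) y < \<epsilon>" if "n \<ge> k" for n
      proof -
        have "inverse (real (Suc n)) \<le> inverse (real (Suc k))"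
          using that by (intro le_imp_inverse_le) auto
        then show ?thesis
          using \<sigma>(2)[of n] k by linarith
      qed
      then show ?thesis by blast
    qed
    have "M.MCauchy \<sigma>"
      unfolding M.MCauchy_def
    proof (intro conjI allI impI)
      show "range \<sigma> \<subseteq> univ M"
        using \<sigma> by auto
      fix \<epsilon> :: real assume "\<epsilon> > 0"
      then obtain k where k: "\<forall>n\<ge>k. d (\<sigma> n) y < \<epsilon> / 2"
        using small[of "\<epsilon> / 2"] by auto
      have "mdist M (\<sigma> n) (\<sigma> n') < \<epsilon>" if "k \<le> n" "k \<le> n'" for n n'
      proof -
        have "d (\<sigma> n) (\<sigma> n') \<le> d (\<sigma> n) y + d y (\<sigma> n')"
          using \<sigma>(1) sub yU by (intro triangle) auto
        moreover have "d (\<sigma> n) y < \<epsilon> / 2" "d (\<sigma> n') y < \<epsilon> / 2"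
          using k that by auto
        ultimately show ?thesis
          using eq[OF \<sigma>(1) \<sigma>(1)] commute[of y "\<sigma> n'"] by simp
      qed
      then show "\<exists>N. \<forall>n n'. N \<le> n \<longrightarrow> N \<le> n' \<longrightarrow> mdist M (\<sigma> n) (\<sigma> n') < \<epsilon>"
        by blast
    qed
    then obtain x where "limitin M.mtopology \<sigma> x sequentially"
      using complete unfolding M.mcomplete_def by blast
    then have x: "x \<in> univ M" "\<And>\<epsilon>. \<epsilon> > 0 \<Longrightarrow> \<exists>k. \<forall>n\<ge>k. \<sigma> n \<in> univ M \<and> mdist M (\<sigma> n) x < \<epsilon>"
      unfolding M.limit_metric_sequentially by auto
    have "d x y < \<epsilon>" if "\<epsilon> > 0" for \<epsilon>
    proof -
      obtain k where k: "\<forall>n\<ge>k. mdist M (\<sigma> n) x < \<epsilon> / 2"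
        using x(2)[of "\<epsilon> / 2"] \<open>\<epsilon> > 0\<close> by auto
      obtain l where l: "\<forall>n\<ge>l. d (\<sigma> n) y < \<epsilon> / 2"
        using small[of "\<epsilon> / 2"] \<open>\<epsilon> > 0\<close> by auto
      have "d x y \<le> d x (\<sigma> (max k l)) + d (\<sigma> (max k l)) y"
        using x(1) \<sigma>(1) sub yU by (intro triangle) auto
      moreover have "d x (\<sigma> (max k l)) < \<epsilon> / 2"
        using k eq[OF \<sigma>(1) x(1)] commute[of x "\<sigma> (max k l)"] by (metis max.cobounded1)
      moreover have "d (\<sigma> (max k l)) y < \<epsilon> / 2"
        using l by simp
      ultimately show ?thesis by simp
    qed
    then have "d x y = 0"
      using nonneg[of x y] by (meson less_irrefl not_less order_le_less)
    then show ?thesis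
      using x(1) sub yU zero[of x y] by auto
  qed
  then show ?thesis
    using cl_subset[OF sub] by blast
qed

lemma Aut_cl:
  assumes "g \<in> Aut" "X \<subseteq> univ U"
  shows "g ` cl X = cl (g ` X)"
proof -
  have sub: "g ` cl X \<subseteq> cl (g ` X)" if "g \<in> Aut" "X \<subseteq> univ U" for g X
  proof
    fix y assume "y \<in> g ` cl X"
    then obtain x where x: "x \<in> cl X" "y = g x"
      by auto
    have "\<exists>z\<in>g ` X. d z y < \<epsilon>" if \<epsilon>: "\<epsilon> > 0" for \<epsilon>
    proof -
      obtain z where "z \<in> X" "d z x < \<epsilon>"
        using cl_approx[OF x(1) \<epsilon>] by blast
      moreover from this have "d (g z) (g x) = d z x"
        using x \<open>X \<subseteq> univ U\<close> cl_in_univ[of X] by (intro Aut_dist[OF \<open>g \<in> Aut\<close>]) auto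
      ultimately show ?thesis
        unfolding x(2) by (intro bexI[of _ "g z"]) auto
    qed
    moreover have "y \<in> univ U"
      using x Aut_in[OF \<open>g \<in> Aut\<close>] cl_in_univ by blast
    ultimately show "y \<in> cl (g ` X)"
      by (simp add: cl_def)
  qed
  have "cl (g ` X) \<subseteq> g ` cl X"
  proof
    fix y assume y: "y \<in> cl (g ` X)"
    have gX: "g ` X \<subseteq> univ U"
      using assms Aut_in by auto
    have "aut_inv g ` g ` X = X"
      using assms by (force simp: image_image subset_iff)
    then have "aut_inv g y \<in> cl X"
      using sub[OF aut_inv_Aut[OF assms(1)] gX] y by auto
    moreover have "g (aut_inv g y) = y"
      using assms y cl_in_univ by (intro aut_inv_right) auto
    ultimately show "y \<in> g ` cl X"
      by force
  qed
  then show ?thesis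
    using sub[OF assms] by blast
qed

end

section \<open>Isolated types in a homogeneous structure\<close>

locale homogeneous_structure = language_structure L U
  for L :: "('f, 'r) language" and U :: "('u, 'f, 'r) metric_structure" +
  fixes \<kappa> :: "'k rel"
  assumes homogeneous: "strongly_homogeneous L \<kappa> U"
begin

definition small :: "'u set \<Rightarrow> bool" where
  "small A \<longleftrightarrow> A \<subseteq> univ U \<and> |A| <o \<kappa>"

lemma eq_if_close:
  assumes "x \<in> univ U" "y \<in> univ U" "\<And>\<epsilon>. \<epsilon> > 0 \<Longrightarrow> d x y < \<epsilon>"
  shows "x = y"
proof (rule ccontr)
  assume "x \<noteq> y"
  then have "d x y > 0"
    using assms(1,2) by (rule mdist_pos_less)
  then show False
    using assms(3) by blast
qed

lemma small_subset: "small A \<Longrightarrow> B \<subseteq> A \<Longrightarrow> small B"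
  unfolding small_def using card_of_mono1[of B A] ordLeq_ordLess_trans by blast

text \<open>A formula sees finitely many parameters, is uniformly continuous and is preserved by
  automorphisms. So \<open>f\<close> changes its value by less than any \<epsilon>, hence not at
  all, and strong homogeneity extends \<open>f\<close>.\<close>

lemma homogeneous_approx:
  assumes "small A" "f ` A \<subseteq> univ U"
    and approx: "\<And>W \<epsilon>. finite W \<Longrightarrow> W \<subseteq> A \<Longrightarrow> \<epsilon> > 0 \<Longrightarrow> \<exists>h\<in>Aut. \<forall>x\<in>W. d (h x) (f x) < \<epsilon>"
  shows "\<exists>h\<in>Aut. \<forall>x\<in>A. h x = f x"
proof -
  have "val U \<phi> (map f as) = val U \<phi> as" if "param_fm L A 0 \<phi> as" for \<phi> as
  proof -
    have \<phi>: "wf_fm L \<phi>" "set as \<subseteq> A" "fv \<phi> \<subseteq> {..<length as}"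
      using that by (auto simp: param_fm_def)
    have asU: "set as \<subseteq> univ U"
      using \<phi>(2) assms(1) by (auto simp: small_def)
    have "\<bar>val U \<phi> (map f as) - val U \<phi> as\<bar> < \<epsilon>" if "\<epsilon> > 0" for \<epsilon>
    proof -
      have "\<forall>\<^sub>F \<delta> in at_right 0. 0 < \<delta> \<and> (\<forall>s s'. close (fv \<phi>) \<delta> s s' \<longrightarrow> \<bar>fm_val U s \<phi> - fm_val U s' \<phi>\<bar> < \<epsilon>)"
        by (intro eventually_conj eventually_at_right_less fm_unif_cont \<phi>(1) that)
      then obtain \<delta> where \<delta>: "0 < \<delta>" "\<And>s s'. close (fv \<phi>) \<delta> s s' \<Longrightarrow> \<bar>fm_val U s \<phi> - fm_val U s' \<phi>\<bar> < \<epsilon>"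
        using eventually_happens'[OF trivial_limit_at_right_real] by blast
      obtain h where h: "h \<in> Aut" "\<forall>x\<in>set as. d (h x) (f x) < \<delta>"
        using approx[of "set as" \<delta>] \<phi>(2) \<delta>(1) by blast
      let ?s = "\<lambda>i. as ! i" and ?s' = "\<lambda>i. map f as ! i"
      have sU: "?s ` fv \<phi> \<subseteq> univ U"
        using \<phi>(3) asU by (auto simp: image_subset_iff subset_iff)
      have "close (fv \<phi>) \<delta> ?s' (h \<circ> ?s)"
        unfolding close_def
      proof (intro conjI ballI)
        show "?s' ` fv \<phi> \<subseteq> univ U"
          using \<phi>(2,3) assms(2) by (auto simp: image_subset_iff subset_iff)
        show "(h \<circ> ?s) ` fv \<phi> \<subseteq> univ U"
          using sU Aut_in[OF h(1)] by (auto simp: image_subset_iff)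
        fix i assume "i \<in> fv \<phi>"
        then have "i < length as"
          using \<phi>(3) by auto
        then show "d (?s' i) ((h \<circ> ?s) i) < \<delta>"
          using h(2) commute by auto
      qed
      then have "\<bar>fm_val U ?s' \<phi> - fm_val U (h \<circ> ?s) \<phi>\<bar> < \<epsilon>"
        by (rule \<delta>(2))
      then show ?thesis
        unfolding val_def Aut_fm_val[OF h(1) \<phi>(1) sU] .
    qed
    then show ?thesis
      by (meson less_irrefl zero_less_abs_iff right_minus_eq)
  qed
  then show ?thesis
    using homogeneous assms(1,2) unfolding strongly_homogeneous_def small_def Aut_def mem_Collect_eq Bex_def
    by blast
qed

lemma homogeneous_exact:
  assumes "small A" "f ` A \<subseteq> univ U"
    and "\<And>W. finite W \<Longrightarrow> W \<subseteq> A \<Longrightarrow> \<exists>h\<in>Aut. \<forall>x\<in>W. h x = f x"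
  shows "\<exists>h\<in>Aut. \<forall>x\<in>A. h x = f x"
proof (rule homogeneous_approx[OF assms(1,2)])
  fix W and \<epsilon> :: real
  assume W: "finite W" "W \<subseteq> A" "\<epsilon> > 0"
  then obtain h where "h \<in> Aut" "\<forall>x\<in>W. h x = f x"
    using assms(3) by blast
  then show "\<exists>h\<in>Aut. \<forall>x\<in>W. d (h x) (f x) < \<epsilon>"
    using W assms(2) by (intro bexI[of _ h]) (auto simp: image_subset_iff subset_iff)
qed

text \<open>
  The parameters of the isolating formulas come from \<open>B\<close>; the type they isolate is the
  one over \<open>A\<close>, and its realizations are the conjugates under \<open>Aut_over A\<close>.
\<close>

definition isolated_within :: "real \<Rightarrow> 'u set \<Rightarrow> 'u set \<Rightarrow> 'u set \<Rightarrow> bool" where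
  "isolated_within \<epsilon> B A V \<longleftrightarrow> (\<exists>F. dfn (B \<union> V) F \<and> F id \<le> 0 \<and>
     (\<forall>s. s ` V \<subseteq> univ U \<longrightarrow> (\<forall>a\<in>A. s a = a) \<longrightarrow> F s < 1 \<longrightarrow> (\<exists>g\<in>Aut_over A. \<forall>v\<in>V. d (s v) (g v) < \<epsilon>)))"

definition isolated :: "'u set \<Rightarrow> 'u set \<Rightarrow> 'u set \<Rightarrow> bool" where
  "isolated B A V \<longleftrightarrow> (\<forall>\<epsilon>>0. isolated_within \<epsilon> B A V)"

lemma isolated_withinI:
  assumes "dfn (B \<union> V) F" "F id \<le> 0"
    and "\<And>s. s ` V \<subseteq> univ U \<Longrightarrow> (\<And>a. a \<in> A \<Longrightarrow> s a = a) \<Longrightarrow> F s < 1 \<Longrightarrow> \<exists>g\<in>Aut_over A. \<forall>v\<in>V. d (s v) (g v) < \<epsilon>"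
  shows "isolated_within \<epsilon> B A V"
  unfolding isolated_within_def
proof (intro exI[of _ F] conjI allI impI)
  fix s assume "s ` V \<subseteq> univ U" "\<forall>a\<in>A. s a = a" "F s < 1"
  then show "\<exists>g\<in>Aut_over A. \<forall>v\<in>V. d (s v) (g v) < \<epsilon>"
    by (intro assms(3)) auto
qed (fact assms)+

lemma isolated_withinE:
  assumes "isolated_within \<epsilon> B A V"
  obtains F where "dfn (B \<union> V) F" "F id \<le> 0"
    "\<And>s. s ` V \<subseteq> univ U \<Longrightarrow> (\<And>a. a \<in> A \<Longrightarrow> s a = a) \<Longrightarrow> F s < 1 \<Longrightarrow> \<exists>g\<in>Aut_over A. \<forall>v\<in>V. d (s v) (g v) < \<epsilon>"
proof -
  obtain F where F: "dfn (B \<union> V) F" "F id \<le> 0"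
     "\<forall>s. s ` V \<subseteq> univ U \<longrightarrow> (\<forall>a\<in>A. s a = a) \<longrightarrow> F s < 1 \<longrightarrow> (\<exists>g\<in>Aut_over A. \<forall>v\<in>V. d (s v) (g v) < \<epsilon>)"
    using assms unfolding isolated_within_def by (elim exE conjE)
  show thesis
  proof (rule that[OF F(1,2)])
    fix s assume "s ` V \<subseteq> univ U" "\<And>a. a \<in> A \<Longrightarrow> s a = a" "F s < 1"
    then show "\<exists>g\<in>Aut_over A. \<forall>v\<in>V. d (s v) (g v) < \<epsilon>"
      using F(3)[rule_format, of s] by simp
  qed
qed

lemma isolatedD: "isolated B A V \<Longrightarrow> \<epsilon> > 0 \<Longrightarrow> isolated_within \<epsilon> B A V"
  by (simp add: isolated_def)

lemma isolated_trivial: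
  assumes "V \<subseteq> A" "A \<subseteq> univ U"
  shows "isolated B A V"
  unfolding isolated_def
proof (intro allI impI)
  fix \<epsilon> :: real assume "\<epsilon> > 0"
  show "isolated_within \<epsilon> B A V"
  proof (rule isolated_withinI[of _ _ "\<lambda>_. 0"])
    fix s assume s: "s ` V \<subseteq> univ U" "\<And>a. a \<in> A \<Longrightarrow> s a = a"
    have "id \<in> Aut_over A"
      by (simp add: Aut_over_def id_Aut)
    moreover have "d (s v) (id v) < \<epsilon>" if "v \<in> V" for v
      using assms that s(2) \<open>\<epsilon> > 0\<close> by (auto simp: subset_iff)
    ultimately show "\<exists>g\<in>Aut_over A. \<forall>v\<in>V. d (s v) (g v) < \<epsilon>"
      by blast
  qed (auto simp: dfn_const)
qed

text \<open>Over the larger set \<open>A'\<close> there are fewer automorphisms, so an isolating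
  function could fail. The last hypothesis, that conjugates of \<open>V\<close> over
  \<open>A\<close> are already conjugates over \<open>A'\<close>, is the form in which orthogonality
  is used.\<close>

lemma isolated_transfer:
  assumes "isolated B A V" "A \<subseteq> A'" "B \<subseteq> B'"
    and "\<And>g. g \<in> Aut_over A \<Longrightarrow> \<exists>g'\<in>Aut_over A'. \<forall>v\<in>V. g' v = g v"
  shows "isolated B' A' V"
  unfolding isolated_def
proof (intro allI impI)
  fix \<epsilon> :: real assume "\<epsilon> > 0"
  obtain F where F: "dfn (B \<union> V) F" "F id \<le> 0"
    "\<And>s. s ` V \<subseteq> univ U \<Longrightarrow> (\<And>a. a \<in> A \<Longrightarrow> s a = a) \<Longrightarrow> F s < 1 \<Longrightarrow> \<exists>g\<in>Aut_over A. \<forall>v\<in>V. d (s v) (g v) < \<epsilon>"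
    using isolated_withinE[OF isolatedD[OF assms(1) \<open>\<epsilon> > 0\<close>]] by blast
  show "isolated_within \<epsilon> B' A' V"
  proof (rule isolated_withinI[where F = F])
    show "dfn (B' \<union> V) F"
      using F(1) by (rule dfn_mono) (use assms(3) in auto)
    show "F id \<le> 0"
      by (rule F(2))
    fix s assume "s ` V \<subseteq> univ U" "\<And>a. a \<in> A' \<Longrightarrow> s a = a" "F s < 1"
    then obtain g where "g \<in> Aut_over A" "\<forall>v\<in>V. d (s v) (g v) < \<epsilon>"
      using F(3)[of s] assms(2) by blast
    then show "\<exists>g\<in>Aut_over A'. \<forall>v\<in>V. d (s v) (g v) < \<epsilon>"
      using assms(4)[of g] by metis
  qed
qed

lemma Aut_over_cl:
  assumes "A \<subseteq> univ U" "g \<in> Aut_over A"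
  shows "g \<in> Aut_over (cl A)"
proof -
  have "g y = y" if y: "y \<in> cl A" for y
  proof -
    have g: "g \<in> Aut" "\<And>a. a \<in> A \<Longrightarrow> g a = a"
      using assms by (auto simp: Aut_over_def)
    have yU: "y \<in> univ U" "g y \<in> univ U"
      using y cl_in_univ Aut_in[OF g(1)] by auto
    have "d (g y) y < \<epsilon>" if "\<epsilon> > 0" for \<epsilon>
    proof -
      obtain x where x: "x \<in> A" "d x y < \<epsilon> / 2"
        using cl_approx[OF y, of "\<epsilon> / 2"] \<open>\<epsilon> > 0\<close> by auto
      then have xU: "x \<in> univ U"
        using assms by auto
      have "d (g y) y \<le> d (g y) x + d x y"
        using triangle[OF yU(2) xU yU(1)] .
      moreover have "d (g y) x = d x y"
        using Aut_dist[OF g(1) yU(1) xU] g(2)[OF x(1)] commute by simp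
      ultimately show ?thesis
        using x by simp
    qed
    then show ?thesis
      using yU by (intro eq_if_close)
  qed
  then show ?thesis
    using assms by (simp add: Aut_over_def)
qed

lemma isolated_cl:
  assumes "isolated A A V" "A \<subseteq> univ U"
  shows "isolated (cl A) (cl A) V"
  using assms(1) cl_subset[OF assms(2)] cl_subset[OF assms(2)]
  by (rule isolated_transfer) (use Aut_over_cl[OF assms(2)] in blast)

lemma isolated_within_subset:
  assumes "isolated_within \<epsilon> A A V'" "V \<subseteq> V'" "finite V'" "V' \<subseteq> univ U" "A \<subseteq> univ U"
  shows "isolated_within \<epsilon> A A V"
proof -
  obtain F where F: "dfn (A \<union> V') F" "F id \<le> 0"
    "\<And>s. s ` V' \<subseteq> univ U \<Longrightarrow> (\<And>a. a \<in> A \<Longrightarrow> s a = a) \<Longrightarrow> F s < 1 \<Longrightarrow> \<exists>g\<in>Aut_over A. \<forall>v\<in>V'. d (s v) (g v) < \<epsilon>"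
    using isolated_withinE[OF assms(1)] by blast
  \<comment> \<open>Points of \<open>V'\<close> lying in \<open>A\<close> are parameters and must
    keep their values, so they are not quantified.\<close>
  define Y where "Y = V' - V - A"
  have "finite Y"
    using assms(3) by (simp add: Y_def)
  obtain G where G: "dfn (A \<union> V' - Y) G" "\<And>s c. s ` (A \<union> V' - Y) \<subseteq> univ U \<Longrightarrow>
    (G s < c \<longleftrightarrow> (\<exists>t. (\<forall>x. x \<notin> Y \<longrightarrow> t x = s x) \<and> t ` Y \<subseteq> univ U \<and> F t < c))"
    using dfn_infs[OF \<open>finite Y\<close> F(1)] by blast
  have eq: "A \<union> V' - Y = A \<union> V"
    using assms(2) by (auto simp: Y_def)
  show ?thesis
  proof (rule isolated_withinI)
    show "dfn (A \<union> V) G"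
      using G(1) eq by simp
    have "G id < c" if "c > 0" for c
      using that F(2) assms(2,4,5) by (subst G(2)) (auto simp: eq Y_def intro!: exI[of _ id])
    then show "G id \<le> 0"
      by (meson less_irrefl not_le)
    fix s assume s: "s ` V \<subseteq> univ U" "\<And>a. a \<in> A \<Longrightarrow> s a = a" "G s < 1"
    have "s ` (A \<union> V' - Y) \<subseteq> univ U"
      unfolding eq using s(1,2) assms(5) by auto
    then obtain t where t: "\<And>x. x \<notin> Y \<Longrightarrow> t x = s x" "t ` Y \<subseteq> univ U" "F t < 1"
      using G(2) s(3) by blast
    have "t ` V' \<subseteq> univ U"
    proof
      fix z assume "z \<in> t ` V'"
      then obtain v where v: "v \<in> V'" "z = t v"
        by auto
      then show "z \<in> univ U"
        using t(1)[of v] t(2) s(1) s(2)[of v] assms(5) by (cases "v \<in> Y") (auto simp: Y_def)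
    qed
    moreover have "t a = a" if "a \<in> A" for a
      using t(1)[of a] s(2) that by (auto simp: Y_def)
    ultimately obtain g where g: "g \<in> Aut_over A" "\<And>v. v \<in> V' \<Longrightarrow> d (t v) (g v) < \<epsilon>"
      using F(3)[of t] t(3) by blast
    have "d (s v) (g v) < \<epsilon>" if "v \<in> V" for v
    proof -
      have "v \<in> V'" "v \<notin> Y"
        using that assms(2) by (auto simp: Y_def)
      then show ?thesis
        using g(2)[of v] t(1)[of v] by simp
    qed
    then show "\<exists>g\<in>Aut_over A. \<forall>v\<in>V. d (s v) (g v) < \<epsilon>"
      using g(1) by blast
  qed
qed

text \<open>Isolation is transitive up to errors. A function \<open>F\<close> isolating
  \<open>b\<close> over \<open>A \<union> B\<close> mentions finitely many points of
  \<open>B\<close>; these are added to \<open>V\<close>, and the result \<open>V'\<close> is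
  isolated by \<open>H\<close> with error also below a modulus of \<open>F\<close>. If
  \<open>s\<close> satisfies both conditions, some \<open>g\<close> over \<open>A\<close> is near
  \<open>s\<close> on \<open>V'\<close>. Pulling back by \<open>g\<close> returns the parameters to
  their places, so a \<open>k\<close> over \<open>A \<union> B\<close> brings \<open>b\<close> close
  to the pulled-back point, and \<open>g \<circ> k\<close> is the required automorphism.\<close>

lemma isolated_insert:
  assumes AU: "A \<subseteq> univ U" and BU: "B \<subseteq> univ U" and bU: "b \<in> univ U"
    and iso: "\<And>V. finite V \<Longrightarrow> V \<subseteq> B \<Longrightarrow> isolated A A V"
    and iso_b: "isolated (A \<union> B) (A \<union> B) {b}"
    and V: "finite V" "V \<subseteq> B"
  shows "isolated A A (insert b V)"
  unfolding isolated_def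
proof (intro allI impI)
  fix \<epsilon> :: real assume \<epsilon>: "\<epsilon> > 0"
  \<comment> \<open>In the main case \<open>b\<close> alone is moved while all of
    \<open>A \<union> B\<close> stays fixed, which is possible only if \<open>b\<close> is not in
    that set.\<close>
  consider "b \<in> B" | "b \<in> A" | "b \<notin> A \<union> B"
    by auto
  then show "isolated_within \<epsilon> A A (insert b V)"
  proof cases
    case 1
    then show ?thesis
      using V by (intro isolatedD iso \<epsilon>) auto
  next
    case 2
    obtain F where F: "dfn (A \<union> V) F" "F id \<le> 0"
      "\<And>s. s ` V \<subseteq> univ U \<Longrightarrow> (\<And>a. a \<in> A \<Longrightarrow> s a = a) \<Longrightarrow> F s < 1 \<Longrightarrow> \<exists>g\<in>Aut_over A. \<forall>v\<in>V. d (s v) (g v) < \<epsilon>"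
      using isolated_withinE[OF isolatedD[OF iso[OF V] \<epsilon>]] by blast
    show ?thesis
    proof (rule isolated_withinI[where F = F])
      show "dfn (A \<union> insert b V) F"
        using F(1) by (rule dfn_mono) auto
      show "F id \<le> 0"
        by (rule F(2))
      fix s assume s: "s ` insert b V \<subseteq> univ U" "\<And>a. a \<in> A \<Longrightarrow> s a = a" "F s < 1"
      then obtain g where g: "g \<in> Aut_over A" "\<forall>v\<in>V. d (s v) (g v) < \<epsilon>"
        using F(3)[of s] by auto
      moreover have "s b = b" "g b = b"
        using s(2) g(1) 2 by (auto simp: Aut_over_def)
      ultimately show "\<exists>g\<in>Aut_over A. \<forall>v\<in>insert b V. d (s v) (g v) < \<epsilon>"
        using \<epsilon> bU by (intro bexI[of _ g]) auto
    qed
  next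
    case 3
    obtain F where F: "dfn (A \<union> B \<union> {b}) F" "F id \<le> 0"
      "\<And>s. s ` {b} \<subseteq> univ U \<Longrightarrow> (\<And>a. a \<in> A \<union> B \<Longrightarrow> s a = a) \<Longrightarrow> F s < 1 \<Longrightarrow>
        \<exists>g\<in>Aut_over (A \<union> B). \<forall>v\<in>{b}. d (s v) (g v) < \<epsilon>"
      using isolated_withinE[OF isolatedD[OF iso_b \<epsilon>]] by blast
    obtain W where W: "W \<subseteq> A \<union> B \<union> {b}" "finite W" "dfn W F"
      using dfn_finite[OF F(1)] by blast
    have "(1 / 2 :: real) > 0"
      by simp
    then obtain \<delta> where \<delta>: "\<delta> > 0"
      "\<And>s t. s ` W \<subseteq> univ U \<Longrightarrow> t ` W \<subseteq> univ U \<Longrightarrow> (\<And>x. x \<in> W \<Longrightarrow> d (s x) (t x) < \<delta>) \<Longrightarrow> \<bar>F s - F t\<bar> < 1 / 2"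
      using dfn_unif_cont[OF W(3)] by blast
    define V' where "V' = V \<union> (W \<inter> B)"
    have V': "finite V'" "V' \<subseteq> B"
      using V W(1,2) by (auto simp: V'_def)
    have "min \<epsilon> \<delta> > 0"
      using \<epsilon> \<delta>(1) by simp
    then obtain H where H: "dfn (A \<union> V') H" "H id \<le> 0"
      "\<And>s. s ` V' \<subseteq> univ U \<Longrightarrow> (\<And>a. a \<in> A \<Longrightarrow> s a = a) \<Longrightarrow> H s < 1 \<Longrightarrow>
        \<exists>g\<in>Aut_over A. \<forall>v\<in>V'. d (s v) (g v) < min \<epsilon> \<delta>"
      using isolated_withinE[OF isolatedD[OF iso[OF V']]] by blast
    \<comment> \<open>Doubling forces \<open>F s < 1/2\<close>, which leaves 1/2 for the change of
      \<open>F\<close> when \<open>s\<close> is replaced by \<open>g\<close> on \<open>V'\<close>.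
      The added 0 only matches the shape of \<open>dfn_affine\<close>.\<close>
    have "isolated_within \<epsilon> A A (insert b V')"
    proof (rule isolated_withinI[of _ _ "\<lambda>s. max (H s) (2 * F s + 0)"])
      show "dfn (A \<union> insert b V') (\<lambda>s. max (H s) (2 * F s + 0))"
      proof (intro dfn_max dfn_affine)
        show "dfn (A \<union> insert b V') H"
          using H(1) by (rule dfn_mono) auto
        show "dfn (A \<union> insert b V') F"
          using W(3) by (rule dfn_mono) (use W(1) in \<open>auto simp: V'_def\<close>)
      qed
      show "max (H id) (2 * F id + 0) \<le> 0"
        using F(2) H(2) by simp
      fix s assume s: "s ` insert b V' \<subseteq> univ U" "\<And>a. a \<in> A \<Longrightarrow> s a = a" "max (H s) (2 * F s + 0) < 1"
      obtain g where g: "g \<in> Aut_over A" "\<And>v. v \<in> V' \<Longrightarrow> d (s v) (g v) < min \<epsilon> \<delta>"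
      proof -
        have "s ` V' \<subseteq> univ U" "H s < 1"
          using s(1,3) by auto
        then show thesis
          using H(3)[of s] s(2) that by blast
      qed
      then have gAut: "g \<in> Aut" and gA: "\<And>a. a \<in> A \<Longrightarrow> g a = a"
        by (auto simp: Aut_over_def)
      define s' where "s' = g(b := s b)"
      have sb: "s b \<in> univ U"
        using s(1) by auto
      have WU: "W \<subseteq> univ U"
        using W(1) AU BU bU by auto
      have "W \<subseteq> insert b (A \<union> V')"
        using W(1) by (auto simp: V'_def)
      then have sW: "s ` W \<subseteq> univ U"
        using s(1,2) AU by (auto simp: image_subset_iff subset_iff)
      have s'W: "s' ` W \<subseteq> univ U"
        using WU sb Aut_in[OF gAut] by (auto simp: s'_def)
      have "d (s x) (s' x) < \<delta>" if "x \<in> W" for x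
      proof -
        consider "x = b" | "x \<noteq> b" "x \<in> A" | "x \<noteq> b" "x \<in> V'"
          using \<open>x \<in> W\<close> \<open>W \<subseteq> insert b (A \<union> V')\<close> by blast
        then show ?thesis
        proof cases
          case 1
          then show ?thesis
            using sb \<delta>(1) by (simp add: s'_def)
        next
          case 2
          then have "s x = x" "g x = x" "x \<in> univ U"
            using s(2) gA AU by auto
          then show ?thesis
            using \<open>x \<noteq> b\<close> \<delta>(1) by (simp add: s'_def)
        next
          case 3
          then show ?thesis
            using g(2)[of x] by (simp add: s'_def)
        qed
      qed
      then have "\<bar>F s - F s'\<bar> < 1 / 2"
        using sW s'W by (intro \<delta>(2)) auto
      moreover have "2 * F s < 1"
        using s(3) by simp
      ultimately have "F s' < 1"
        by (auto simp only: abs_less_iff)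
      \<comment> \<open>This is \<open>s'\<close> pulled back by \<open>g\<close>: on the parameters
        it is the identity, and \<open>F\<close> has the same value by invariance.\<close>
      define t where "t = id(b := aut_inv g (s b))"
      have "F t = F (aut_inv g \<circ> s')"
        using W(3)
      proof (rule dfn_cong)
        fix x assume "x \<in> W"
        then have "x \<in> univ U"
          using WU by blast
        then show "t x = (aut_inv g \<circ> s') x"
          using gAut by (simp add: t_def s'_def)
      qed
      also have "\<dots> = F s'"
        using W(3) aut_inv_Aut[OF gAut] s'W by (rule dfn_Aut)
      finally have "F t < 1"
        using \<open>F s' < 1\<close> by simp
      have tb: "t b \<in> univ U"
        using Aut_in[OF aut_inv_Aut[OF gAut] sb] by (simp add: t_def)
      have "\<exists>k\<in>Aut_over (A \<union> B). \<forall>v\<in>{b}. d (t v) (k v) < \<epsilon>"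
      proof (rule F(3))
        show "t ` {b} \<subseteq> univ U"
          using tb by simp
        show "t a = a" if "a \<in> A \<union> B" for a
          using that 3 by (auto simp: t_def)
      qed fact
      then obtain k where k: "k \<in> Aut_over (A \<union> B)" "d (t b) (k b) < \<epsilon>"
        by blast
      have kAut: "k \<in> Aut"
        using k(1) by (simp add: Aut_over_def)
      have "d (g (t b)) (g (k b)) = d (t b) (k b)"
        using tb bU by (intro Aut_dist[OF gAut] Aut_in[OF kAut])
      moreover have "g (t b) = s b"
        using gAut sb by (simp add: t_def)
      ultimately have "d (s b) ((g \<circ> k) b) < \<epsilon>"
        using k(2) by simp
      moreover have "d (s v) ((g \<circ> k) v) < \<epsilon>" if "v \<in> V'" for v
        using g(2)[OF that] k(1) V'(2) that by (auto simp: Aut_over_def)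
      moreover have "g \<circ> k \<in> Aut_over A"
        using g(1) Aut_over_mono[OF k(1)] by (intro Aut_over_comp) auto
      ultimately show "\<exists>g\<in>Aut_over A. \<forall>v\<in>insert b V'. d (s v) (g v) < \<epsilon>"
        by (intro bexI[of _ "g \<circ> k"]) auto
    qed
    then show ?thesis
      by (rule isolated_within_subset) (use V' AU BU bU in \<open>auto simp: V'_def\<close>)
  qed
qed

subsection \<open>Atomic types are isolated\<close>

text \<open>Equality of types makes the map sending \<open>b\<close> to \<open>c\<close> and fixing
  \<open>A\<close> elementary, and strong homogeneity extends it. If \<open>b\<close> belongs to
  \<open>A\<close>, the formula \<open>d x b\<close> shows \<open>c = b\<close>.\<close>

lemma realization_conjugate:
  assumes small: "small (insert b A)" and real: "[c] \<in> realizations L U A [b]"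
  shows "\<exists>g\<in>Aut_over A. g b = c"
proof -
  have cU: "c \<in> univ U" and tp: "tp L U A [c] = tp L U A [b]"
    using real by (auto simp: realizations_def tuples_def)
  have bU: "b \<in> univ U" and AU: "A \<subseteq> univ U"
    using small by (auto simp: small_def)
  have val: "val U \<phi> (c # as) = val U \<phi> (b # as)" if "param_fm L A 1 \<phi> as" for \<phi> as
  proof -
    \<comment> \<open>A type records only which formulas vanish; subtracting the value at
      \<open>b\<close> with a connective recovers equality of all values.\<close>
    let ?\<psi> = "Conn (\<lambda>v. v 0 - val U \<phi> (b # as)) [\<phi>]"
    have \<psi>: "val U ?\<psi> xs = val U \<phi> xs - val U \<phi> (b # as)" for xs
      by (simp add: val_def)
    have "param_fm L A 1 ?\<psi> as"
      using that by (auto simp: param_fm_def intro!: continuous_intros)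
    then have "(?\<psi>, as) \<in> tp L U A [b]"
      by (simp add: tp_def \<psi>)
    then have "(?\<psi>, as) \<in> tp L U A [c]"
      using tp by simp
    then have "val U ?\<psi> (c # as) = 0"
      by (simp add: tp_def)
    then show ?thesis
      by (simp add: \<psi>)
  qed
  show ?thesis
  proof (cases "b \<in> A")
    case True
    have "param_fm L A 1 (Dist (Var 0) (Var 1)) [b]"
      using True by (auto simp: param_fm_def)
    from val[OF this] have "d c b = d b b"
      by (simp add: val_def)
    then have "c = b"
      using bU cU by simp
    then show ?thesis
      by (intro bexI[of _ id]) (auto simp: Aut_over_def id_Aut)
  next
    case False
    define f where "f = id(b := c)"
    have eq: "val U \<phi> (map f as) = val U \<phi> as" if "param_fm L (insert b A) 0 \<phi> as" for \<phi> as
    proof -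
      have \<phi>: "wf_fm L \<phi>" "set as \<subseteq> insert b A" "fv \<phi> \<subseteq> {..<length as}"
        using that by (auto simp: param_fm_def)
      define as' where "as' = filter (\<lambda>x. x \<noteq> b) as"
      \<comment> \<open>The parameter list may contain \<open>b\<close>, even repeatedly. All its
        occurrences are sent to variable 0, the others to a position in the list with
        \<open>b\<close> removed, to give a formula in one variable over \<open>A\<close>.\<close>
      define \<rho> where "\<rho> i = (if as ! i = b then 0 else Suc (SOME j. j < length as' \<and> as' ! j = as ! i))" for i
      have \<rho>: "\<rho> i < Suc (length as') \<and> (x # as') ! \<rho> i = (if as ! i = b then x else as ! i)"
        if "i < length as" for i x
      proof (cases "as ! i = b")
        case False
        then have "as ! i \<in> set as'"
          using that by (simp add: as'_def)
        then have "\<exists>j. j < length as' \<and> as' ! j = as ! i"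
          by (simp add: in_set_conv_nth)
        from someI_ex[OF this] show ?thesis
          using False by (simp add: \<rho>_def)
      qed (simp add: \<rho>_def)
      have param: "param_fm L A 1 (ren_fm \<rho> \<phi>) as'"
        unfolding param_fm_def
      proof (intro conjI)
        show "wf_fm L (ren_fm \<rho> \<phi>)"
          using \<phi>(1) by simp
        show "set as' \<subseteq> A"
          using \<phi>(2) by (auto simp: as'_def)
        have "\<rho> ` fv \<phi> \<subseteq> {..<1 + length as'}"
          using \<rho> \<phi>(3) by (auto simp: image_subset_iff subset_iff)
        then show "fv (ren_fm \<rho> \<phi>) \<subseteq> {..<1 + length as'}"
          using fv_ren[of \<rho> \<phi>] by blast
      qed
      have *: "val U (ren_fm \<rho> \<phi>) (x # as') = val U \<phi> (map (\<lambda>y. if y = b then x else y) as)" for x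
        unfolding val_def fm_val_ren
      proof (rule fm_val_cong)
        fix i assume "i \<in> fv \<phi>"
        then have "i < length as"
          using \<phi>(3) by auto
        then show "((!) (x # as') \<circ> \<rho>) i = map (\<lambda>y. if y = b then x else y) as ! i"
          using \<rho>[of i x] by simp
      qed
      have "map (\<lambda>y. if y = b then b else y) as = as"
        by (intro map_idI) auto
      moreover have "map (\<lambda>y. if y = b then c else y) as = map f as"
        by (intro map_cong) (auto simp: f_def)
      ultimately show ?thesis
        using val[OF param] by (simp only: *)
    qed
    moreover have "f ` insert b A \<subseteq> univ U"
      using cU AU by (auto simp: f_def)
    ultimately obtain g where "isomorphism L U U g" "\<forall>a\<in>insert b A. g a = f a"
      using homogeneous small unfolding strongly_homogeneous_def small_def by metis
    then show ?thesis
      using False by (intro bexI[of _ g]) (auto simp: Aut_over_def Aut_def f_def)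
  qed
qed

text \<open>The distance to the realizations is a uniform limit of a sequence of formulas, each with
  finitely many parameters. Their union is the countable set \<open>B\<close>, which serves every
  \<epsilon> at once.\<close>

lemma atomic_isolated:
  assumes small: "small (insert b A)" and atomic: "atomic_type L U A [b]"
  shows "\<exists>B\<subseteq>A. countable B \<and> isolated B A {b}"
proof -
  have bU: "b \<in> univ U" and AU: "A \<subseteq> univ U"
    using small by (auto simp: small_def)
  obtain D where "definable_predicate L U A 1 D"
    and D: "\<And>c. c \<in> tuples U 1 \<Longrightarrow> D c = (INF b'\<in>realizations L U A [b]. tuple_dist U c b')"
    using atomic by (auto simp: atomic_type_def)
  then obtain \<phi> as where \<phi>: "\<And>k. param_fm L A 1 (\<phi> k) (as k)"
    and lim: "uniform_limit (tuples U 1) (\<lambda>k c. val U (\<phi> k) (c @ as k)) D sequentially"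
    unfolding definable_predicate_def by blast
  have dist1: "tuple_dist U [x] [y] = d x y" for x y
    by (simp add: tuple_dist_def lessThan_Suc max_def)
  have singleton: "\<exists>c\<in>univ U. ys = [c]" if "ys \<in> realizations L U A [b]" for ys
    using that by (auto simp: realizations_def tuples_def length_Suc_conv)
  have b_real: "[b] \<in> realizations L U A [b]"
    using bU by (simp add: realizations_def tuples_def)
  have tuples1: "[x] \<in> tuples U 1" if "x \<in> univ U" for x
    using that by (simp add: tuples_def)
  have "D [b] = 0"
  proof (rule antisym)
    have "bdd_below (tuple_dist U [b] ` realizations L U A [b])"
    proof (rule bdd_belowI2)
      fix ys assume "ys \<in> realizations L U A [b]"
      then obtain c where "ys = [c]"
        using singleton by blast
      then show "0 \<le> tuple_dist U [b] ys"
        by (simp add: dist1)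
    qed
    then have "D [b] \<le> tuple_dist U [b] [b]"
      unfolding D[OF tuples1[OF bU]] using b_real by (rule cINF_lower)
    then show "D [b] \<le> 0"
      using bU by (simp add: dist1)
    show "0 \<le> D [b]"
      unfolding D[OF tuples1[OF bU]]
    proof (rule cINF_greatest)
      show "realizations L U A [b] \<noteq> {}"
        using b_real by blast
      fix ys assume "ys \<in> realizations L U A [b]"
      then obtain c where "ys = [c]"
        using singleton by blast
      then show "0 \<le> tuple_dist U [b] ys"
        by (simp add: dist1)
    qed
  qed
  define B where "B = (\<Union>k. set (as k))"
  have "B \<subseteq> A"
    using \<phi> unfolding B_def param_fm_def by blast
  moreover have "countable B"
    by (simp add: B_def countable_finite)
  moreover have "isolated B A {b}"
    unfolding isolated_def
  proof (intro allI impI)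
    fix \<epsilon> :: real assume \<epsilon>: "\<epsilon> > 0"
    have "\<forall>\<^sub>F k in sequentially. \<forall>c\<in>tuples U 1. dist (val U (\<phi> k) (c @ as k)) (D c) < \<epsilon> / 3"
      using uniform_limitD[OF lim, of "\<epsilon> / 3"] \<epsilon> by simp
    then obtain k where k: "\<And>c. c \<in> tuples U 1 \<Longrightarrow> dist (val U (\<phi> k) (c @ as k)) (D c) < \<epsilon> / 3"
      using eventually_happens'[OF sequentially_bot] by blast
    define \<rho> where "\<rho> i = (b # as k) ! i" for i
    \<comment> \<open>\<open>\<phi> k\<close> is within \<open>\<epsilon> / 3\<close> of the
      distance predicate \<open>D\<close>, and is rescaled so that \<open>\<epsilon> / 3\<close>
      becomes 0 and \<open>2 * \<epsilon> / 3\<close> becomes 1. At \<open>b\<close>, where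
      \<open>D\<close> vanishes, \<open>F\<close> is then at most 0, and \<open>F s < 1\<close>
      gives \<open>D [s b] < \<epsilon>\<close>.\<close>
    define F where "F s = 3 / \<epsilon> * fm_val U (s \<circ> \<rho>) (\<phi> k) + (-1)" for s
    have fv: "fv (\<phi> k) \<subseteq> {..<Suc (length (as k))}" and asA: "set (as k) \<subseteq> A"
      using \<phi>[of k] by (auto simp: param_fm_def)
    have val: "fm_val U (s \<circ> \<rho>) (\<phi> k) = val U (\<phi> k) (s b # as k)" if "\<And>a. a \<in> A \<Longrightarrow> s a = a" for s
      unfolding val_def
    proof (rule fm_val_cong)
      fix i assume "i \<in> fv (\<phi> k)"
      then have "i < Suc (length (as k))"
        using fv by auto
      then show "(s \<circ> \<rho>) i = (s b # as k) ! i"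
        using that subsetD[OF asA nth_mem] by (cases i) (auto simp: \<rho>_def)
    qed
    show "isolated_within \<epsilon> B A {b}"
    proof (rule isolated_withinI[of _ _ F])
      have "\<rho> ` fv (\<phi> k) \<subseteq> set (b # as k)"
      proof
        fix z assume "z \<in> \<rho> ` fv (\<phi> k)"
        then obtain i where "i < length (b # as k)" "z = (b # as k) ! i"
          using fv by (auto simp: \<rho>_def)
        then show "z \<in> set (b # as k)"
          by (simp only: nth_mem)
      qed
      also have "\<dots> \<subseteq> B \<union> {b}"
        by (auto simp: B_def)
      finally have "dfn (B \<union> {b}) (\<lambda>s. fm_val U (s \<circ> \<rho>) (\<phi> k))"
        using \<phi>[of k] by (intro dfnI[of "\<phi> k" \<rho>]) (auto simp: param_fm_def)
      then show "dfn (B \<union> {b}) F"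
        unfolding F_def by (rule dfn_affine)
      have "val U (\<phi> k) (b # as k) < \<epsilon> / 3"
        using k[OF tuples1[OF bU]] \<open>D [b] = 0\<close> by (simp add: dist_real_def)
      then show "F id \<le> 0"
        using val[of id] \<epsilon> by (simp add: F_def field_simps)
      fix s assume s: "s ` {b} \<subseteq> univ U" "\<And>a. a \<in> A \<Longrightarrow> s a = a" "F s < 1"
      have sb: "s b \<in> univ U"
        using s(1) by simp
      have "val U (\<phi> k) (s b # as k) < 2 * \<epsilon> / 3"
        using s(3) val[of s] s(2) \<epsilon> by (simp add: F_def field_simps)
      moreover have "\<bar>val U (\<phi> k) (s b # as k) - D [s b]\<bar> < \<epsilon> / 3"
        using k[OF tuples1[OF sb]] by (simp only: dist_real_def append_Cons append_Nil)
      ultimately have "D [s b] < \<epsilon>"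
        by linarith
      then have "(INF b'\<in>realizations L U A [b]. tuple_dist U [s b] b') < \<epsilon>"
        unfolding D[OF tuples1[OF sb]] .
      then obtain ys where "ys \<in> realizations L U A [b]" "tuple_dist U [s b] ys < \<epsilon>"
        using cInf_lessD[of "tuple_dist U [s b] ` realizations L U A [b]" \<epsilon>] b_real by blast
      moreover from this obtain c where "ys = [c]"
        using singleton by blast
      ultimately obtain g where "g \<in> Aut_over A" "g b = c" "d (s b) c < \<epsilon>"
        using realization_conjugate[OF small] by (auto simp: dist1)
      then show "\<exists>g\<in>Aut_over A. \<forall>v\<in>{b}. d (s v) (g v) < \<epsilon>"
        by auto
    qed
  qed
  ultimately show ?thesis
    by blast
qed

end

section \<open>Closed sets of constructed models\<close>

locale constructed = homogeneous_structure L U \<kappa>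
  for L :: "('f, 'r) language" and U :: "('u, 'f, 'r) metric_structure" and \<kappa> :: "'k rel" +
  fixes N :: "'u set" and lt :: "'u rel" and supp :: "'u \<Rightarrow> 'u set"
  assumes small_N: "small N" and wf_lt: "wf lt" and trans_lt: "trans lt"
    and total_lt: "x \<in> N \<Longrightarrow> y \<in> N \<Longrightarrow> x = y \<or> (x, y) \<in> lt \<or> (y, x) \<in> lt"
    and countable_supp: "x \<in> N \<Longrightarrow> countable (supp x)"
    and supp_less: "x \<in> N \<Longrightarrow> supp x \<subseteq> {y \<in> N. (y, x) \<in> lt}"
    and isolated_supp: "x \<in> N \<Longrightarrow> isolated (supp x) {y \<in> N. (y, x) \<in> lt} {x}"
begin

definition pred :: "'u \<Rightarrow> 'u set" where
  "pred x = {y \<in> N. (y, x) \<in> lt}"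

text \<open>Closed in the combinatorial sense, under supports; the metric closure is
  \<open>cl\<close>.\<close>

definition closed :: "'u set \<Rightarrow> bool" where
  "closed C \<longleftrightarrow> C \<subseteq> N \<and> (\<forall>x\<in>C. supp x \<subseteq> C)"

lemma N_univ: "N \<subseteq> univ U"
  using small_N by (simp add: small_def)

lemma pred_N: "pred x \<subseteq> N"
  by (auto simp: pred_def)

lemma notin_pred: "x \<notin> pred x"
  using wf_not_refl[OF wf_lt] by (auto simp: pred_def)

lemma finite_max:
  assumes "finite W" "W \<noteq> {}" "W \<subseteq> N"
  shows "\<exists>m\<in>W. W \<subseteq> insert m (pred m)"
  using assms
proof (induction W rule: finite_ne_induct)
  case (insert x W)
  then obtain m where m: "m \<in> W" "W \<subseteq> insert m (pred m)"
    by auto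
  consider "x = m" | "(x, m) \<in> lt" | "(m, x) \<in> lt"
    using total_lt[of x m] insert m by auto
  then show ?case
  proof cases
    case 3
    then have "insert x W \<subseteq> insert x (pred x)"
      using m insert.prems transD[OF trans_lt] by (auto simp: pred_def)
    then show ?thesis by blast
  qed (use m insert.prems in \<open>auto simp: pred_def intro!: bexI[of _ m]\<close>)
qed auto

text \<open>The isolating functions of \<open>x\<close> have parameters in \<open>supp x\<close>
  only, so a point \<open>w\<close> with the same type as \<open>x\<close> over
  \<open>supp x\<close> is within every \<epsilon> of a conjugate of \<open>x\<close> over
  \<open>pred x\<close>; \<open>homogeneous_approx\<close> removes the error.\<close>

lemma realize_over_pred:
  assumes x: "x \<in> N" and w: "w \<in> univ U"
    and eq: "\<And>F. dfn (supp x \<union> {x}) F \<Longrightarrow> F (id(x := w)) = F id"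
  shows "\<exists>k\<in>Aut_over (pred x). k x = w"
proof -
  have "\<exists>h\<in>Aut. \<forall>y\<in>insert x (pred x). h y = (id(x := w)) y"
  proof (rule homogeneous_approx)
    show "small (insert x (pred x))"
      using small_N by (rule small_subset) (use x pred_N in auto)
    show "(id(x := w)) ` insert x (pred x) \<subseteq> univ U"
      using w pred_N N_univ by auto
    fix W and \<epsilon> :: real
    assume W: "W \<subseteq> insert x (pred x)" and \<epsilon>: "\<epsilon> > 0"
    obtain F where F: "dfn (supp x \<union> {x}) F" "F id \<le> 0"
      "\<And>s. s ` {x} \<subseteq> univ U \<Longrightarrow> (\<And>a. a \<in> pred x \<Longrightarrow> s a = a) \<Longrightarrow> F s < 1 \<Longrightarrow>
        \<exists>g\<in>Aut_over (pred x). \<forall>v\<in>{x}. d (s v) (g v) < \<epsilon>"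
      using isolated_withinE[OF isolatedD[OF isolated_supp[OF x] \<epsilon>]] unfolding pred_def by blast
    have "F (id(x := w)) < 1"
      using eq[OF F(1)] F(2) by simp
    then obtain g where g: "g \<in> Aut_over (pred x)" "d w (g x) < \<epsilon>"
    proof -
      have "(id(x := w)) a = a" if "a \<in> pred x" for a
        using that notin_pred[of x] by auto
      then show thesis
        using F(3)[of "id(x := w)"] w \<open>F (id(x := w)) < 1\<close> that by auto
    qed
    have "d (g y) ((id(x := w)) y) < \<epsilon>" if "y \<in> W" for y
    proof (cases "y = x")
      case True
      then show ?thesis
        using g(2) commute by simp
    next
      case False
      then have "y \<in> pred x"
        using that W by auto
      then have "g y = y" "y \<in> univ U"
        using g(1) pred_N N_univ by (auto simp: Aut_over_def)
      then show ?thesis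
        using False \<epsilon> by simp
    qed
    moreover have "g \<in> Aut"
      using g(1) by (simp add: Aut_over_def)
    ultimately show "\<exists>h\<in>Aut. \<forall>y\<in>W. d (h y) ((id(x := w)) y) < \<epsilon>"
      by blast
  qed
  then obtain h where h: "h \<in> Aut" "\<And>y. y \<in> insert x (pred x) \<Longrightarrow> h y = (id(x := w)) y"
    by blast
  have "h y = y" if "y \<in> pred x" for y
    using h(2)[of y] that notin_pred[of x] by auto
  then show ?thesis
    using h(1) h(2)[of x] by (intro bexI[of _ h]) (auto simp: Aut_over_def)
qed

text \<open>
  The types of \<open>x\<close> and of the elements of \<open>C\<close> above \<open>x\<close> over the predecessors of
  \<open>x\<close> are orthogonal: adding the latter one by one, each of them is isolated over a set that
  does not contain \<open>x\<close>.
\<close>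

lemma extend_over_closed:
  assumes C: "closed C" and x: "x \<in> N" "x \<notin> C" and g: "g \<in> Aut_over (pred x)"
  shows "\<exists>g'\<in>Aut_over (pred x \<union> C). g' x = g x"
proof -
  define P where "P S \<longleftrightarrow> (\<exists>g'\<in>Aut_over (pred x \<union> S). g' x = g x)" for S
  have CN: "C \<subseteq> N"
    using C by (simp add: closed_def)
  have mono: "P S" if "P T" "S \<subseteq> T" for S T
    using that Aut_over_mono[of _ "pred x \<union> T" "pred x \<union> S"] unfolding P_def by blast
  have P_empty: "P {}"
    using g by (auto simp: P_def)
  \<comment> \<open>Whether a map is elementary depends on finite sets only, so \<open>P\<close>
    passes from the finite subsets of a small set to the set itself.\<close>
  have limit: "P S" if fin: "\<And>W. finite W \<Longrightarrow> W \<subseteq> S \<Longrightarrow> P W" and S: "S \<subseteq> C" for S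
  proof -
    have "\<exists>h\<in>Aut. \<forall>y\<in>insert x (pred x \<union> S). h y = (id(x := g x)) y"
    proof (rule homogeneous_exact)
      show "small (insert x (pred x \<union> S))"
        using small_N by (rule small_subset) (use x S CN pred_N in auto)
      have "g x \<in> univ U"
        using g x N_univ Aut_in by (auto simp: Aut_over_def)
      then show "(id(x := g x)) ` insert x (pred x \<union> S) \<subseteq> univ U"
        using pred_N N_univ S CN by auto
      fix W assume W: "finite W" "W \<subseteq> insert x (pred x \<union> S)"
      then have "P (W \<inter> S)"
        by (intro fin) auto
      then obtain g' where "g' \<in> Aut_over (pred x \<union> (W \<inter> S))" "g' x = g x"
        unfolding P_def by blast
      then show "\<exists>h\<in>Aut. \<forall>y\<in>W. h y = (id(x := g x)) y"
        using W(2) by (intro bexI[of _ g']) (auto simp: Aut_over_def)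
    qed
    then obtain h where h: "h \<in> Aut" "\<And>y. y \<in> insert x (pred x \<union> S) \<Longrightarrow> h y = (id(x := g x)) y"
      by blast
    have "h y = y" if "y \<in> pred x \<union> S" for y
      using h(2)[of y] that notin_pred[of x] x(2) S by auto
    then show ?thesis
      unfolding P_def using h(1) h(2)[of x] by (intro bexI[of _ h]) (auto simp: Aut_over_def)
  qed
  \<comment> \<open>A finite set of predecessors has a largest element and so lies in an earlier
    initial segment. Together with \<open>limit\<close> this treats successor and limit stages
    alike, leaving only the point \<open>y\<close> to be fixed.\<close>
  have below: "P (C \<inter> insert y (pred y))" if "y \<in> N" for y
    using wf_lt that
  proof (induction y rule: wf_induct_rule)
    case (less y)
    have "P (C \<inter> pred y)"
    proof (rule limit)
      fix W assume W: "finite W" "W \<subseteq> C \<inter> pred y"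
      show "P W"
      proof (cases "W = {}")
        case True
        then show ?thesis using P_empty by simp
      next
        case False
        then obtain m where m: "m \<in> W" "W \<subseteq> insert m (pred m)"
          using finite_max[OF W(1)] W(2) CN by blast
        then have "P (C \<inter> insert m (pred m))"
          using W(2) by (intro less.IH) (auto simp: pred_def)
        then show ?thesis
          by (rule mono) (use m W in auto)
      qed
    qed auto
    show ?case
    proof (cases "y \<in> C \<and> y \<notin> pred x")
      case False
      have "Aut_over (pred x \<union> (C \<inter> pred y)) \<subseteq> Aut_over (pred x \<union> (C \<inter> insert y (pred y)))"
        using False by (auto simp: Aut_over_def)
      then show ?thesis
        using \<open>P (C \<inter> pred y)\<close> unfolding P_def by blast
    next
      case True
      then have xy: "(x, y) \<in> lt"
        using total_lt[of x y] x less.prems by (auto simp: pred_def)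
      then have sub: "pred x \<subseteq> pred y" "x \<in> pred y"
        using transD[OF trans_lt] x(1) by (auto simp: pred_def)
      obtain g' where g': "g' \<in> Aut_over (pred x \<union> (C \<inter> pred y))" "g' x = g x"
        using \<open>P (C \<inter> pred y)\<close> unfolding P_def by blast
      then have g'Aut: "g' \<in> Aut" and fix_g': "\<And>z. z \<in> pred x \<union> (C \<inter> pred y) \<Longrightarrow> g' z = z"
        by (auto simp: Aut_over_def)
      have yU: "y \<in> univ U"
        using less.prems N_univ by auto
      have supp_y: "supp y \<subseteq> C \<inter> pred y"
        using C True supp_less[OF less.prems] by (auto simp: closed_def pred_def)
      \<comment> \<open>As \<open>C\<close> is closed, \<open>supp y\<close> lies in the part that
        \<open>g'\<close> already fixes, so \<open>aut_inv g' y\<close> has the same type as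
        \<open>y\<close> over \<open>supp y\<close>, hence over \<open>pred y\<close>. Composing
        \<open>g'\<close> with a \<open>k\<close> over \<open>pred y\<close> that takes
        \<open>y\<close> there makes \<open>y\<close> fixed and changes nothing on
        \<open>pred y\<close>, which contains \<open>x\<close>.\<close>
      have "\<exists>k\<in>Aut_over (pred y). k y = aut_inv g' y"
      proof (rule realize_over_pred[OF less.prems])
        show "aut_inv g' y \<in> univ U"
          using Aut_in[OF aut_inv_Aut[OF g'Aut] yU] .
        fix F assume F: "dfn (supp y \<union> {y}) F"
        have suppU: "supp y \<union> {y} \<subseteq> univ U"
          using supp_y CN N_univ yU by auto
        have "F (id(y := aut_inv g' y)) = F (aut_inv g' \<circ> id)"
          using F
        proof (rule dfn_cong)
          fix z assume "z \<in> supp y \<union> {y}"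
          moreover have "aut_inv g' z = z" if "z \<in> supp y"
            using aut_inv_left[OF g'Aut, of z] fix_g'[of z] that supp_y suppU
            by (metis IntI UnCI le_infE subsetD)
          ultimately show "(id(y := aut_inv g' y)) z = (aut_inv g' \<circ> id) z"
            by auto
        qed
        also have "\<dots> = F id"
          using suppU by (intro dfn_Aut[OF F aut_inv_Aut[OF g'Aut]]) auto
        finally show "F (id(y := aut_inv g' y)) = F id" .
      qed
      then obtain k where k: "k \<in> Aut" "\<And>z. z \<in> pred y \<Longrightarrow> k z = z" "k y = aut_inv g' y"
        by (auto simp: Aut_over_def)
      have "(g' \<circ> k) z = z" if "z \<in> pred x \<union> (C \<inter> insert y (pred y))" for z
      proof (cases "z = y")
        case True
        then show ?thesis
          using k(3) g'Aut yU by simp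
      next
        case False
        then have "z \<in> pred y" "z \<in> pred x \<union> (C \<inter> pred y)"
          using that sub by auto
        then show ?thesis
          using k(2) fix_g' by simp
      qed
      moreover have "(g' \<circ> k) x = g x"
        using k(2) sub g'(2) by simp
      ultimately show ?thesis
        unfolding P_def using comp_Aut[OF g'Aut k(1)]
        by (intro bexI[of _ "g' \<circ> k"]) (auto simp: Aut_over_def)
    qed
  qed
  have "P C"
  proof (rule limit)
    fix W assume W: "finite W" "W \<subseteq> C"
    show "P W"
    proof (cases "W = {}")
      case True
      then show ?thesis using P_empty by simp
    next
      case False
      then obtain m where m: "m \<in> W" "W \<subseteq> insert m (pred m)"
        using finite_max[OF W(1)] W(2) CN by blast
      then have "P (C \<inter> insert m (pred m))"
        using W(2) CN by (intro below) auto
      then show ?thesis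
        by (rule mono) (use m W in auto)
    qed
  qed auto
  then show ?thesis
    by (simp add: P_def)
qed

text \<open>Induction along the well-order on the largest element \<open>x\<close> of
  \<open>V\<close>. The type of \<open>x\<close> over \<open>pred x\<close> stays isolated over
  \<open>C \<union> pred x\<close> by orthogonality, and \<open>isolated_insert\<close> combines
  this with the tuples from \<open>pred x\<close>, which are isolated over \<open>C\<close> by
  induction.\<close>

lemma isolated_over_closed:
  assumes C: "closed C" and V: "finite V" "V \<subseteq> N"
  shows "isolated C C V"
proof -
  have CU: "C \<subseteq> univ U"
    using C N_univ by (auto simp: closed_def)
  have below: "isolated C C V" if "x \<in> N" "finite V" "V \<subseteq> insert x (pred x)" for x V
    using wf_lt that
  proof (induction x arbitrary: V rule: wf_induct_rule)
    case (less x)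
    have pred: "isolated C C V" if V: "finite V" "V \<subseteq> pred x" for V
    proof (cases "V = {}")
      case True
      then show ?thesis
        using CU by (intro isolated_trivial) auto
    next
      case False
      then obtain m where "m \<in> V" "V \<subseteq> insert m (pred m)"
        using finite_max[OF V(1)] V(2) pred_N by blast
      then show ?thesis
        using V by (intro less.IH[of m]) (auto simp: pred_def)
    qed
    have predU: "pred x \<subseteq> univ U"
      using pred_N N_univ by blast
    have "isolated (C \<union> pred x) (C \<union> pred x) {x}"
    proof (cases "x \<in> C")
      case True
      then show ?thesis
        using CU predU by (intro isolated_trivial) auto
    next
      case False
      show ?thesis
      proof (rule isolated_transfer)
        show "isolated (supp x) (pred x) {x}"
          using isolated_supp[OF less.prems(1)] by (simp add: pred_def)
        show "supp x \<subseteq> C \<union> pred x"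
          using supp_less[OF less.prems(1)] by (auto simp: pred_def)
        fix g assume "g \<in> Aut_over (pred x)"
        then show "\<exists>g'\<in>Aut_over (C \<union> pred x). \<forall>v\<in>{x}. g' v = g v"
          using extend_over_closed[OF C less.prems(1) False] by (simp add: Un_commute)
      qed auto
    qed
    then have "isolated C C (insert x (V - {x}))"
      using less.prems N_univ by (intro isolated_insert[OF CU predU _ pred]) auto
    then show ?case
      using pred[of V] less.prems by (cases "x \<in> V") (auto simp: insert_absorb)
  qed
  show ?thesis
  proof (cases "V = {}")
    case True
    then show ?thesis
      using CU by (intro isolated_trivial) auto
  next
    case False
    then show ?thesis
      using finite_max[OF V(1)] V below by blast
  qed
qed

end

text \<open>A construction sequence may repeat entries. Ordering the elements by their first index
  \<iota> removes repetitions without changing the sets over which the types are taken: an entry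
  listed before the first index of \<open>x\<close> has its own first index there as well.\<close>

lemma (in homogeneous_structure) constructible_constructed:
  assumes "constructible_over (I :: 'i itself) L U {} M" and small: "small (univ M)"
  shows "\<exists>lt supp. constructed L U \<kappa> (univ M) lt supp"
proof -
  let ?N = "univ M"
  obtain r :: "'i rel" and b where constr: "construction_sequence L U {} r b" and N: "b ` Field r = ?N"
    using assms(1) by (auto simp: constructible_over_def)
  have wo: "Well_order r" and atomic: "\<And>i. i \<in> Field r \<Longrightarrow> atomic_type L U (b ` underS r i) [b i]"
    using constr by (auto simp: construction_sequence_def)
  have wf: "wf (r - Id)" and trans: "trans r" and antisym: "antisym r" and total: "Total r"
    using wo by (auto simp: order_on_defs)
  define \<iota> where "\<iota> x = (SOME i. i \<in> Field r \<and> b i = x \<and> (\<forall>j. (j, i) \<in> r - Id \<longrightarrow> \<not> (j \<in> Field r \<and> b j = x)))" for x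
  have \<iota>: "\<iota> x \<in> Field r \<and> b (\<iota> x) = x \<and> (\<forall>j. (j, \<iota> x) \<in> r - Id \<longrightarrow> \<not> (j \<in> Field r \<and> b j = x))"
    if "x \<in> ?N" for x
    unfolding \<iota>_def
  proof (rule someI_ex)
    have "x \<in> b ` Field r"
      using that N by simp
    then obtain i where "i \<in> {i \<in> Field r. b i = x}"
      by auto
    from wfE_min[OF wf this] obtain z where "z \<in> {i \<in> Field r. b i = x}"
      "\<And>y. (y, z) \<in> r - Id \<Longrightarrow> y \<notin> {i \<in> Field r. b i = x}"
      by metis
    then show "\<exists>i. i \<in> Field r \<and> b i = x \<and> (\<forall>j. (j, i) \<in> r - Id \<longrightarrow> \<not> (j \<in> Field r \<and> b j = x))"
      by (intro exI[of _ z]) simp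
  qed
  define lt where "lt = inv_image (r - Id) \<iota> \<inter> ?N \<times> ?N"
  have lt_iff: "(x, y) \<in> lt \<longleftrightarrow> x \<in> ?N \<and> y \<in> ?N \<and> (\<iota> x, \<iota> y) \<in> r \<and> \<iota> x \<noteq> \<iota> y" for x y
    by (auto simp: lt_def)
  have pred: "{y \<in> ?N. (y, x) \<in> lt} = b ` underS r (\<iota> x)" if x: "x \<in> ?N" for x
  proof
    show "{y \<in> ?N. (y, x) \<in> lt} \<subseteq> b ` underS r (\<iota> x)"
    proof
      fix y assume "y \<in> {y \<in> ?N. (y, x) \<in> lt}"
      then have "y = b (\<iota> y)" "\<iota> y \<in> underS r (\<iota> x)"
        using \<iota>[of y] by (auto simp: lt_iff underS_def)
      then show "y \<in> b ` underS r (\<iota> x)"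
        by blast
    qed
    show "b ` underS r (\<iota> x) \<subseteq> {y \<in> ?N. (y, x) \<in> lt}"
    proof
      fix y assume "y \<in> b ` underS r (\<iota> x)"
      then obtain j where j: "(j, \<iota> x) \<in> r" "j \<noteq> \<iota> x" "y = b j"
        by (auto simp: underS_def)
      have jF: "j \<in> Field r"
        using j(1) by (auto simp: Field_def)
      then have yN: "y \<in> ?N"
        using j(3) N by auto
      have "(\<iota> y, j) \<in> r"
      proof -
        have "(j, \<iota> y) \<notin> r - Id"
          using \<iota>[OF yN] jF j(3) by auto
        then have "j = \<iota> y \<or> (\<iota> y, j) \<in> r"
          using total jF \<iota>[OF yN] by (auto simp: total_on_def)
        moreover have "(j, j) \<in> r"
          using wo jF by (auto simp: order_on_defs refl_on_def)
        ultimately show ?thesis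
          by auto
      qed
      then have "(\<iota> y, \<iota> x) \<in> r" "\<iota> y \<noteq> \<iota> x"
        using j trans antisym by (auto dest: transD antisymD)
      then show "y \<in> {y \<in> ?N. (y, x) \<in> lt}"
        using yN x by (simp add: lt_iff)
    qed
  qed
  have "\<forall>x\<in>?N. \<exists>B. B \<subseteq> {y \<in> ?N. (y, x) \<in> lt} \<and> countable B \<and> isolated B {y \<in> ?N. (y, x) \<in> lt} {x}"
  proof
    fix x assume x: "x \<in> ?N"
    have "small (insert x {y \<in> ?N. (y, x) \<in> lt})"
      using small by (rule small_subset) (use x in auto)
    moreover have "atomic_type L U {y \<in> ?N. (y, x) \<in> lt} [x]"
      using atomic[of "\<iota> x"] \<iota>[OF x] pred[OF x] by auto
    ultimately show "\<exists>B. B \<subseteq> {y \<in> ?N. (y, x) \<in> lt} \<and> countable B \<and> isolated B {y \<in> ?N. (y, x) \<in> lt} {x}"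
      using atomic_isolated by blast
  qed
  from bchoice[OF this] obtain supp where supp: "\<forall>x\<in>?N. supp x \<subseteq> {y \<in> ?N. (y, x) \<in> lt} \<and> countable (supp x) \<and>
      isolated (supp x) {y \<in> ?N. (y, x) \<in> lt} {x}"
    ..
  have "constructed L U \<kappa> ?N lt supp"
  proof
    show "small ?N"
      by (rule small)
    show "wf lt"
      unfolding lt_def using wf by (intro wf_Int1 wf_inv_image)
    show "trans lt"
    proof (rule transI)
      fix x y z assume xyz: "(x, y) \<in> lt" "(y, z) \<in> lt"
      then have "(\<iota> x, \<iota> z) \<in> r"
        using transD[OF trans] by (auto simp: lt_iff)
      moreover have "\<iota> x \<noteq> \<iota> z"
        using xyz antisymD[OF antisym] by (auto simp: lt_iff)
      ultimately show "(x, z) \<in> lt"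
        using xyz by (simp add: lt_iff)
    qed
    fix x assume x: "x \<in> ?N"
    show "countable (supp x)" "supp x \<subseteq> {y \<in> ?N. (y, x) \<in> lt}" "isolated (supp x) {y \<in> ?N. (y, x) \<in> lt} {x}"
      using bspec[OF supp x] by auto
    fix y assume y: "y \<in> ?N"
    show "x = y \<or> (x, y) \<in> lt \<or> (y, x) \<in> lt"
    proof (cases "\<iota> x = \<iota> y")
      case True
      then show ?thesis
        using \<iota>[OF x] \<iota>[OF y] by metis
    next
      case False
      then show ?thesis
        using total \<iota>[OF x] \<iota>[OF y] x y by (auto simp: total_on_def lt_iff)
    qed
  qed
  then show ?thesis
    by blast
qed

section \<open>Approximate back-and-forth\<close>

text \<open>A countable set has countably many finite subsets, so adding all \<open>H S\<close>
  countably often keeps it countable, and each finite subset of the union appears at some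
  stage.\<close>

lemma countable_closure:
  assumes "countable X" "X \<subseteq> T"
    and countable: "\<And>S. finite S \<Longrightarrow> S \<subseteq> T \<Longrightarrow> countable (H S)"
    and stable: "\<And>S. finite S \<Longrightarrow> S \<subseteq> T \<Longrightarrow> H S \<subseteq> T"
  shows "\<exists>Y. X \<subseteq> Y \<and> Y \<subseteq> T \<and> countable Y \<and> (\<forall>S. finite S \<and> S \<subseteq> Y \<longrightarrow> H S \<subseteq> Y)"
proof -
  define step where "step Y = Y \<union> (\<Union>S\<in>{S. finite S \<and> S \<subseteq> Y}. H S)" for Y
  define Y where "Y n = (step ^^ n) X" for n
  have Y_Suc: "Y (Suc n) = step (Y n)" for n
    by (simp add: Y_def)
  have Y: "countable (Y n) \<and> Y n \<subseteq> T" for n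
  proof (induction n)
    case 0
    then show ?case
      using assms(1,2) by (simp add: Y_def)
  next
    case (Suc n)
    have "countable {S. finite S \<and> S \<subseteq> Y n}"
      using Suc by (intro countable_Collect_finite_subset) simp
    then have "countable (\<Union>S\<in>{S. finite S \<and> S \<subseteq> Y n}. H S)"
      using Suc countable by (intro countable_UN) auto
    moreover have "(\<Union>S\<in>{S. finite S \<and> S \<subseteq> Y n}. H S) \<subseteq> T"
      using Suc stable by (intro UN_least) auto
    ultimately show ?case
      using Suc unfolding Y_Suc step_def by simp
  qed
  have mono: "Y m \<subseteq> Y n" if "m \<le> n" for m n
    using that by (rule lift_Suc_mono_le[rotated]) (auto simp: Y_Suc step_def)
  have "H S \<subseteq> (\<Union>n. Y n)" if S: "finite S" "S \<subseteq> (\<Union>n. Y n)" for S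
  proof -
    have "\<exists>n. S \<subseteq> Y n"
      using S
    proof (induction S rule: finite_induct)
      case (insert x S)
      then obtain m n where "x \<in> Y m" "S \<subseteq> Y n"
        by auto
      then show ?case
        using mono[of m "max m n"] mono[of n "max m n"] by (intro exI[of _ "max m n"]) auto
    qed simp
    then obtain n where "S \<subseteq> Y n" ..
    then have "H S \<subseteq> Y (Suc n)"
      using S(1) unfolding Y_Suc step_def by blast
    then show ?thesis
      by blast
  qed
  moreover have "X \<subseteq> Y 0"
    by (simp add: Y_def)
  ultimately show ?thesis
    using Y by (intro exI[of _ "\<Union>n. Y n"] conjI countable_UN) blast+
qed

text \<open>Infinite repetition makes every point be treated again at stages with arbitrarily small
  error; in the limit argument a single treatment would not be enough.\<close>

lemma surjection_infinitely_often:
  assumes "countable E" "E \<noteq> {}"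
  shows "\<exists>e. (\<forall>n. e n \<in> E) \<and> (\<forall>x\<in>E. \<forall>m. \<exists>n\<ge>m. e (n :: nat) = x)"
proof (rule exI[of _ "\<lambda>n. from_nat_into E (fst (prod_decode n))"], intro conjI allI ballI)
  show "from_nat_into E (fst (prod_decode n)) \<in> E" for n
    using assms(2) by (rule from_nat_into)
  fix x m assume "x \<in> E"
  then obtain i where "from_nat_into E i = x"
    using from_nat_into_surj[OF assms(1)] by blast
  then show "\<exists>n\<ge>m. from_nat_into E (fst (prod_decode n)) = x"
    by (intro exI[of _ "prod_encode (i, m)"]) (simp add: le_prod_encode_2)
qed

lemma half_power_small:
  fixes \<epsilon> c :: real
  assumes "\<epsilon> > 0" "c > 0"
  shows "\<exists>i. \<forall>m\<ge>i. c * (1 / 2) ^ m < \<epsilon>"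
proof -
  have "0 < \<epsilon> / c" "(1 / 2 :: real) < 1"
    using assms by simp_all
  then obtain i where i: "(1 / 2 :: real) ^ i < \<epsilon> / c"
    using real_arch_pow_inv by blast
  have "c * (1 / 2) ^ m < \<epsilon>" if "m \<ge> i" for m
  proof -
    have "(1 / 2 :: real) ^ m \<le> (1 / 2) ^ i"
      using that by (intro power_decreasing) auto
    then have "(1 / 2 :: real) ^ m < \<epsilon> / c"
      using i by linarith
    then show ?thesis
      using assms(2) by (simp only: pos_less_divide_eq mult.commute)
  qed
  then show ?thesis
    by blast
qed

context language_structure
begin

lemma geometric_limit:
  assumes u: "\<And>m. u m \<in> univ U" and close: "\<And>m. d (u m) (u (Suc m)) < (1 / 2) ^ (n + m)"
  obtains l where "l \<in> univ U" "\<And>m. d (u m) l \<le> 2 * (1 / 2) ^ (n + m)"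
proof -
  have dist: "d (u m) (u (m + k)) \<le> 2 * (1 / 2) ^ (n + m)" for m k
  proof -
    \<comment> \<open>The exact partial sum of the geometric series, so that the induction
      closes.\<close>
    have "d (u m) (u (m + k)) \<le> 2 * ((1 / 2) ^ (n + m) - (1 / 2) ^ (n + (m + k)))"
    proof (induction k)
      case (Suc k)
      have "d (u m) (u (m + Suc k)) \<le> d (u m) (u (m + k)) + d (u (m + k)) (u (Suc (m + k)))"
        using triangle[OF u u u] by simp
      also have "\<dots> \<le> 2 * ((1 / 2) ^ (n + m) - (1 / 2) ^ (n + (m + k))) + (1 / 2) ^ (n + (m + k))"
        using Suc close[of "m + k"] by simp
      finally show ?case
        by simp
    qed (use u in simp)
    then show ?thesis
      by (rule order_trans) simp
  qed
  have small: "\<exists>k. \<forall>m\<ge>k. 2 * (1 / 2) ^ (n + m) < \<epsilon>" if \<epsilon>: "\<epsilon> > 0" for \<epsilon> :: real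
  proof -
    obtain k where "\<forall>m\<ge>k. 2 * (1 / 2) ^ m < \<epsilon>"
      using half_power_small[OF \<epsilon>, of 2] by auto
    then show ?thesis
      by (intro exI[of _ k]) simp
  qed
  have "MCauchy u"
    unfolding MCauchy_def
  proof (intro conjI allI impI)
    fix \<epsilon> :: real assume "\<epsilon> > 0"
    from small[OF this] obtain k where k: "\<forall>m\<ge>k. 2 * (1 / 2) ^ (n + m) < \<epsilon>" ..
    have *: "d (u i) (u j) < \<epsilon>" if "k \<le> i" "i \<le> j" for i j
      using dist[of i "j - i"] k[rule_format, of i] that by simp
    have "d (u i) (u j) < \<epsilon>" if "k \<le> i" "k \<le> j" for i j
      using *[of i j] *[of j i] that commute[of "u i" "u j"] by (cases "i \<le> j") auto
    then show "\<exists>N. \<forall>i j. N \<le> i \<longrightarrow> N \<le> j \<longrightarrow> d (u i) (u j) < \<epsilon>"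
      by blast
  qed (use u in auto)
  then obtain l where "limitin mtopology u l sequentially"
    using mcomplete_U unfolding mcomplete_def by blast
  then have l: "l \<in> univ U" "\<And>\<epsilon>. \<epsilon> > 0 \<Longrightarrow> \<exists>k. \<forall>m\<ge>k. u m \<in> univ U \<and> d (u m) l < \<epsilon>"
    unfolding limit_metric_sequentially by auto
  have "d (u m) l \<le> 2 * (1 / 2) ^ (n + m)" for m
  proof (rule field_le_epsilon)
    fix \<epsilon> :: real assume "\<epsilon> > 0"
    then obtain k where k: "\<forall>m\<ge>k. u m \<in> univ U \<and> d (u m) l < \<epsilon>"
      using l(2) by blast
    have "d (u m) l \<le> d (u m) (u (m + k)) + d (u (m + k)) l"
      using triangle[OF u u l(1)] .
    moreover have "d (u (m + k)) l < \<epsilon>"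
      using k by simp
    ultimately show "d (u m) l \<le> 2 * (1 / 2) ^ (n + m) + \<epsilon>"
      using dist[of m k] by linarith
  qed
  then show thesis
    using that l(1) by blast
qed

lemma cl_eqI:
  assumes "X \<subseteq> cl Y" "Y \<subseteq> cl X" "X \<subseteq> univ U" "Y \<subseteq> univ U"
  shows "cl X = cl Y"
  using cl_mono[OF assms(1)] cl_mono[OF assms(2)] unfolding cl_cl[OF assms(3)] cl_cl[OF assms(4)]
  by (rule subset_antisym)

end

context homogeneous_structure
begin

text \<open>
  The automorphisms that agree with \<open>g\<close> on \<open>A\<close> play the role of partial isomorphisms;
  \<open>R\<close> is a finite approximation to one of them.
\<close>

definition approximates :: "'u set \<Rightarrow> ('u \<Rightarrow> 'u) \<Rightarrow> nat \<Rightarrow> ('u \<times> 'u) set \<Rightarrow> ('u \<Rightarrow> 'u) \<Rightarrow> bool" where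
  "approximates A g n R h \<longleftrightarrow> finite R \<and> R \<subseteq> univ U \<times> univ U \<and> h \<in> Aut \<and> (\<forall>a\<in>A. h a = g a) \<and>
     (\<forall>(x, y)\<in>R. d (h x) y < (1 / 2) ^ n)"

text \<open>Instead of adding one pair for \<open>x\<close>, all old partners are replaced: each may
  move by less than the old tolerance, and in return one automorphism matches all new pairs with
  half of it. The automorphism attached to \<open>R\<close> does not occur, so there are only
  countably many extension problems over countable sets.\<close>

definition extends :: "'u set \<Rightarrow> ('u \<Rightarrow> 'u) \<Rightarrow> nat \<Rightarrow> ('u \<times> 'u) set \<Rightarrow> 'u \<Rightarrow> ('u \<Rightarrow> 'u) \<Rightarrow> bool" where
  "extends A g n R x s \<longleftrightarrow> (\<forall>(x, y)\<in>R. d (s x) y < (1 / 2) ^ n) \<and>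
     (\<exists>k. approximates A g (Suc n) ((\<lambda>v. (v, s v)) ` insert x (fst ` R)) k)"

text \<open>Stated for arbitrary sets \<open>E\<close> and \<open>E'\<close>, so that the extension
  property of two models can be inherited by countable subsets.\<close>

definition forth_closed :: "'u set \<Rightarrow> ('u \<Rightarrow> 'u) \<Rightarrow> 'u set \<Rightarrow> 'u set \<Rightarrow> bool" where
  "forth_closed A g E E' \<longleftrightarrow> (\<forall>R x n h. approximates A g n R h \<longrightarrow> R \<subseteq> E \<times> E' \<longrightarrow> x \<in> E \<longrightarrow>
     (\<exists>s. s ` insert x (fst ` R) \<subseteq> E' \<and> extends A g n R x s))"

text \<open>The conditions "the isolating function is below 1" and "within \<epsilon> of the old
  partners" are solved in \<open>U\<close> by \<open>g\<close> itself, with parameters in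
  \<open>N\<close>, so they have a solution \<open>r\<close> in \<open>N\<close> because
  \<open>N\<close> is elementary. Pulled back by \<open>g\<close>, the solution is near a conjugate
  of \<open>V\<close> over \<open>A\<close> by isolation, and \<open>g\<close> composed with that
  conjugation is near \<open>r\<close>.\<close>

lemma forth:
  assumes iso: "isolated A A V" and V: "finite V" "V \<subseteq> univ U" and A: "A \<subseteq> univ U"
    and g: "g \<in> Aut" and N: "elementary N" "g ` A \<subseteq> N"
    and R: "finite R" "fst ` R \<subseteq> V" "snd ` R \<subseteq> N" "\<And>x y. (x, y) \<in> R \<Longrightarrow> d (g x) y < \<epsilon>"
    and \<epsilon>: "\<epsilon> > 0" "\<epsilon>' > 0"
  shows "\<exists>s k. s ` V \<subseteq> N \<and> k \<in> Aut \<and> (\<forall>a\<in>A. k a = g a) \<and>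
    (\<forall>(x, y)\<in>R. d (s x) y < \<epsilon>) \<and> (\<forall>v\<in>V. d (k v) (s v) < \<epsilon>')"
proof -
  obtain F where F: "dfn (A \<union> V) F" "F id \<le> 0"
    "\<And>s. s ` V \<subseteq> univ U \<Longrightarrow> (\<And>a. a \<in> A \<Longrightarrow> s a = a) \<Longrightarrow> F s < 1 \<Longrightarrow> \<exists>g\<in>Aut_over A. \<forall>v\<in>V. d (s v) (g v) < \<epsilon>'"
    using isolated_withinE[OF isolatedD[OF iso \<epsilon>(2)]] by blast
  have NU: "N \<subseteq> univ U"
    using N(1) by (simp add: elementary_def)
  \<comment> \<open>The same element may occur as an argument to be sent along \<open>g\<close> and
    as a partner kept in place; the sum type separates the two roles.\<close>
  define W :: "('u + 'u) set" where "W = Inl ` (A \<union> V) \<union> Inr ` (snd ` R)"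
  have "dfn W (\<lambda>s. 1 / \<epsilon> * d (s (Inl (fst p))) (s (Inr (snd p))) + 0)" if "p \<in> R" for p
    using that R(2) by (intro dfn_affine dfn_dist) (auto simp: W_def)
  then obtain G where G: "dfn W G"
    "\<And>s. G s < 1 \<longleftrightarrow> (\<forall>p\<in>R. 1 / \<epsilon> * d (s (Inl (fst p))) (s (Inr (snd p))) + 0 < 1)"
    using dfn_finite_max[OF R(1), of W "\<lambda>p s. 1 / \<epsilon> * d (s (Inl (fst p))) (s (Inr (snd p))) + 0"] by blast
  have G_iff: "G s < 1 \<longleftrightarrow> (\<forall>(x, y)\<in>R. d (s (Inl x)) (s (Inr y)) < \<epsilon>)" for s
    unfolding G(2) using \<epsilon>(1) by (auto simp: field_simps)
  define H where "H s = max (F (s \<circ> Inl)) (G s)" for s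
  have "dfn W (\<lambda>s. F (s \<circ> Inl))"
    using dfn_rename[OF F(1), of Inl] by (rule dfn_mono) (auto simp: W_def)
  then have H: "dfn W H"
    unfolding H_def using G(1) by (rule dfn_max)
  define s where "s = case_sum g (\<lambda>y. y)"
  have "F g = F id"
    using dfn_Aut[OF F(1) g, of id] A V(2) by simp
  moreover have "s \<circ> Inl = g"
    by (auto simp: s_def)
  moreover have "G s < 1"
    unfolding G_iff using R(4) by (auto simp: s_def)
  ultimately have Hs: "H s < 1"
    using F(2) by (simp add: H_def)
  have sU: "s ` W \<subseteq> univ U"
  proof (rule image_subsetI)
    fix w assume "w \<in> W"
    then consider v where "w = Inl v" "v \<in> univ U" | y where "w = Inr y" "y \<in> snd ` R"
      using A V(2) unfolding W_def by blast
    then show "s w \<in> univ U"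
      using R(3) NU Aut_in[OF g] by cases (auto simp: s_def)
  qed
  \<comment> \<open>Only the points of \<open>V - A\<close> have to be moved into \<open>N\<close>;
    the images of \<open>A\<close> and the old partners are there already.\<close>
  have sN: "s ` (W - Inl ` (V - A)) \<subseteq> N"
  proof (rule image_subsetI)
    fix w assume "w \<in> W - Inl ` (V - A)"
    then consider a where "w = Inl a" "a \<in> A" | y where "w = Inr y" "y \<in> snd ` R"
      unfolding W_def by blast
    then show "s w \<in> N"
      using N(2) R(3) by cases (auto simp: s_def)
  qed
  have "finite (Inl ` (V - A) :: ('u + 'u) set)"
    using V(1) by simp
  from elementary_witness[OF N(1) this H sU sN Hs] obtain t where
    t: "\<forall>x. x \<notin> Inl ` (V - A) \<longrightarrow> t x = s x" "t ` W \<subseteq> N" "H t < 1"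
    by (elim exE conjE)
  define r where "r = t \<circ> Inl"
  have rV: "r ` V \<subseteq> N"
    using t(2) by (auto simp: r_def W_def)
  have rA: "r a = g a" if "a \<in> A" for a
    using t(1)[rule_format, of "Inl a"] that by (auto simp: r_def s_def)
  have tR: "t (Inr y) = y" for y
    using t(1)[rule_format, of "Inr y"] by (auto simp: s_def)
  have rR: "\<forall>(x, y)\<in>R. d (r x) y < \<epsilon>"
    using t(3) G_iff[of t] tR by (simp add: r_def H_def)
  have rU: "r ` (A \<union> V) \<subseteq> univ U"
    using rV rA NU A Aut_in[OF g] by auto
  define q where "q = aut_inv g \<circ> r"
  have gr: "g (q v) = r v" if "v \<in> A \<union> V" for v
    using rU that g by (auto simp: q_def)
  have qU: "q ` (A \<union> V) \<subseteq> univ U"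
    using rU Aut_in[OF aut_inv_Aut[OF g]] by (auto simp: q_def)
  have "\<exists>k\<in>Aut_over A. \<forall>v\<in>V. d (q v) (k v) < \<epsilon>'"
  proof (rule F(3))
    show "q ` V \<subseteq> univ U"
      using qU by auto
    show "q a = a" if "a \<in> A" for a
      using that A g rA by (auto simp: q_def)
    have "F q = F r"
      unfolding q_def using F(1) aut_inv_Aut[OF g] rU by (rule dfn_Aut)
    then show "F q < 1"
      using t(3) by (simp add: r_def H_def)
  qed
  then obtain k where k: "k \<in> Aut" "\<And>a. a \<in> A \<Longrightarrow> k a = a" "\<And>v. v \<in> V \<Longrightarrow> d (q v) (k v) < \<epsilon>'"
    by (auto simp: Aut_over_def)
  have "d ((g \<circ> k) v) (r v) < \<epsilon>'" if "v \<in> V" for v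
  proof -
    have "v \<in> univ U" "q v \<in> univ U"
      using that V(2) qU by auto
    then have "d (g (k v)) (g (q v)) = d (k v) (q v)"
      using Aut_in[OF k(1)] by (intro Aut_dist[OF g])
    then show ?thesis
      using k(3)[OF that] gr[of v] that commute[of "k v" "q v"] by simp
  qed
  then show ?thesis
    using rV rR k(2) comp_Aut[OF g k(1)] by (intro exI[of _ r] exI[of _ "g \<circ> k"]) simp
qed

lemma forth_closed_elementary:
  assumes iso: "\<And>V. finite V \<Longrightarrow> V \<subseteq> N \<Longrightarrow> isolated A A V"
    and "A \<subseteq> N" "N \<subseteq> univ U" "elementary N'" "g ` A \<subseteq> N'"
  shows "forth_closed A g N N'"
  unfolding forth_closed_def
proof (intro allI impI)
  fix R x n h
  assume h: "approximates A g n R h" and R: "R \<subseteq> N \<times> N'" and x: "x \<in> N"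
  let ?V = "insert x (fst ` R)"
  have V: "finite ?V" "?V \<subseteq> N"
    using h R x by (auto simp: approximates_def)
  have hA: "h ` A \<subseteq> N'"
    using h assms(5) by (auto simp: approximates_def)
  have "\<exists>s k. s ` ?V \<subseteq> N' \<and> k \<in> Aut \<and> (\<forall>a\<in>A. k a = h a) \<and>
    (\<forall>(x, y)\<in>R. d (s x) y < (1 / 2) ^ n) \<and> (\<forall>v\<in>?V. d (k v) (s v) < (1 / 2) ^ Suc n)"
  proof (rule forth[OF iso[OF V] V(1) _ _ _ assms(4) hA])
    show "?V \<subseteq> univ U" "A \<subseteq> univ U"
      using V(2) assms(2,3) by auto
    show "h \<in> Aut" "finite R" "\<And>x y. (x, y) \<in> R \<Longrightarrow> d (h x) y < (1 / 2) ^ n"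
      using h by (auto simp: approximates_def)
    show "snd ` R \<subseteq> N'"
      using R by auto
  qed auto
  then obtain s k where s: "s ` ?V \<subseteq> N'" "k \<in> Aut" "\<forall>a\<in>A. k a = h a"
    "\<forall>(x, y)\<in>R. d (s x) y < (1 / 2) ^ n" "\<forall>v\<in>?V. d (k v) (s v) < (1 / 2) ^ Suc n"
    by blast
  have "N' \<subseteq> univ U"
    using assms(4) by (simp add: elementary_def)
  then have "(\<lambda>v. (v, s v)) ` ?V \<subseteq> univ U \<times> univ U"
    using s(1) V(2) assms(3) by blast
  then have "approximates A g (Suc n) ((\<lambda>v. (v, s v)) ` ?V) k"
    using s(2,3,5) V(1) h by (auto simp: approximates_def)
  then have "extends A g n R x s"
    unfolding extends_def using s(4) by blast
  then show "\<exists>s. s ` ?V \<subseteq> N' \<and> extends A g n R x s"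
    using s(1) by blast
qed

text \<open>A Loewenheim-Skolem argument: one answer is fixed for each finite \<open>R\<close>,
  point \<open>x\<close> and tolerance \<open>n\<close>, and both sides are closed simultaneously
  under these answers and under supports.\<close>

lemma countable_forth_closed:
  assumes forth: "forth_closed A g N N'" "forth_closed A' g' N' N"
    and supp: "\<And>x. x \<in> N \<Longrightarrow> countable (supp x) \<and> supp x \<subseteq> N"
      "\<And>x. x \<in> N' \<Longrightarrow> countable (supp' x) \<and> supp' x \<subseteq> N'"
    and "x \<in> N" "y \<in> N'"
  shows "\<exists>E E'. x \<in> E \<and> y \<in> E' \<and> E \<subseteq> N \<and> E' \<subseteq> N' \<and> countable E \<and> countable E' \<and>
    (\<forall>x\<in>E. supp x \<subseteq> E) \<and> (\<forall>x\<in>E'. supp' x \<subseteq> E') \<and> forth_closed A g E E' \<and> forth_closed A' g' E' E"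
proof -
  \<comment> \<open>All points used by the chosen answer, or nothing if the problem has no
    answer.\<close>
  define new where "new A g N R x n = (if \<exists>s. s ` insert x (fst ` R) \<subseteq> N \<and> extends A g n R x s
      then (SOME s. s ` insert x (fst ` R) \<subseteq> N \<and> extends A g n R x s) ` insert x (fst ` R) else {})"
    for A g N R n and x :: 'u
  have new: "new A g N R x n \<subseteq> N \<and> (finite R \<longrightarrow> finite (new A g N R x n))" for A g N R n x
    unfolding new_def
    using someI_ex[of "\<lambda>s. s ` insert x (fst ` R) \<subseteq> N \<and> extends A g n R x s"] by auto
  have forth_new: "forth_closed A g E E'"
    if forth: "forth_closed A g N N'" and E: "E \<subseteq> N" "E' \<subseteq> N'"
      and new: "\<And>R x n. finite R \<Longrightarrow> R \<subseteq> E \<times> E' \<Longrightarrow> x \<in> E \<Longrightarrow> new A g N' R x n \<subseteq> E'" for A g E E' N N'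
    unfolding forth_closed_def
  proof (intro allI impI)
    fix R x n h
    assume h: "approximates A g n R h" and R: "R \<subseteq> E \<times> E'" and x: "x \<in> E"
    have "R \<subseteq> N \<times> N'"
      using R E by blast
    then have ex: "\<exists>s. s ` insert x (fst ` R) \<subseteq> N' \<and> extends A g n R x s"
      using forth h x E(1) unfolding forth_closed_def by blast
    define s where "s = (SOME s. s ` insert x (fst ` R) \<subseteq> N' \<and> extends A g n R x s)"
    have "extends A g n R x s"
      using someI_ex[OF ex] by (simp add: s_def)
    moreover have "finite R"
      using h by (simp add: approximates_def)
    then have "s ` insert x (fst ` R) \<subseteq> E'"
      using new[OF _ R x, of n] ex by (simp add: new_def s_def)
    ultimately show "\<exists>s. s ` insert x (fst ` R) \<subseteq> E' \<and> extends A g n R x s"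
      by blast
  qed
  \<comment> \<open>The disjoint sum codes both sides in one set: \<open>Inl\<close> holds points of
    \<open>N\<close>, \<open>Inr\<close> points of \<open>N'\<close>, so a single closure treats the
    two directions together.\<close>
  define H :: "('u + 'u) set \<Rightarrow> ('u + 'u) set" where
    "H S = Inl ` ((\<Union>x\<in>Inl -` S. supp x) \<union>
              (\<Union>R\<in>Pow (Inr -` S \<times> Inl -` S). \<Union>x\<in>Inr -` S. \<Union>n. new A' g' N R x n)) \<union>
           Inr ` ((\<Union>x\<in>Inr -` S. supp' x) \<union>
              (\<Union>R\<in>Pow (Inl -` S \<times> Inr -` S). \<Union>x\<in>Inl -` S. \<Union>n. new A g N' R x n))" for S
  have "\<exists>Y. {Inl x, Inr y} \<subseteq> Y \<and> Y \<subseteq> N <+> N' \<and> countable Y \<and> (\<forall>S. finite S \<and> S \<subseteq> Y \<longrightarrow> H S \<subseteq> Y)"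
  proof (rule countable_closure)
    show "{Inl x, Inr y} \<subseteq> N <+> N'"
      using assms(5,6) by auto
    fix S :: "('u + 'u) set" assume S: "finite S" "S \<subseteq> N <+> N'"
    have fin: "finite (Inl -` S)" "finite (Inr -` S)"
      using S(1) by (auto intro: finite_vimageI)
    have sub: "Inl -` S \<subseteq> N" "Inr -` S \<subseteq> N'"
      using S(2) by auto
    have countable_new: "countable (\<Union>R\<in>Pow (P \<times> Q). \<Union>x\<in>P. \<Union>n. new A g N R x n)"
      if "finite P" "finite Q" for A g N P Q
    proof (rule countable_UN)
      show "countable (Pow (P \<times> Q))"
        using that by (intro countable_finite) simp
      fix R assume "R \<in> Pow (P \<times> Q)"
      then have "finite R"
        using that finite_subset[of R "P \<times> Q"] by simp
      then have fin: "finite (new A g N R x n)" for x n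
        using new by blast
      show "countable (\<Union>x\<in>P. \<Union>n. new A g N R x n)"
        by (intro countable_UN[OF countable_finite[OF that(1)]] countable_UN[OF countableI_type]
            countable_finite[OF fin])
    qed
    have "countable (\<Union>z\<in>Inl -` S. supp z)"
      using countable_finite[OF fin(1)] by (rule countable_UN) (use supp(1) sub(1) in blast)
    moreover have "countable (\<Union>z\<in>Inr -` S. supp' z)"
      using countable_finite[OF fin(2)] by (rule countable_UN) (use supp(2) sub(2) in blast)
    ultimately show "countable (H S)"
      unfolding H_def by (simp only: countable_Un_iff countable_image countable_new[OF fin] countable_new[OF fin(2,1)] simp_thms)
    show "H S \<subseteq> N <+> N'"
    proof -
      have "supp z \<subseteq> N" if "z \<in> Inl -` S" for z
        using supp(1) sub(1) that by blast
      moreover have "supp' z \<subseteq> N'" if "z \<in> Inr -` S" for z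
        using supp(2) sub(2) that by blast
      ultimately show ?thesis
        unfolding H_def Plus_def
        by (intro Un_mono image_mono Un_least UN_least new[THEN conjunct1])
    qed
  qed simp
  then obtain Y where xy: "{Inl x, Inr y} \<subseteq> Y" and YN: "Y \<subseteq> N <+> N'" and "countable Y"
    and closed: "\<forall>S. finite S \<and> S \<subseteq> Y \<longrightarrow> H S \<subseteq> Y"
    by (elim exE conjE)
  have Y: "H S \<subseteq> Y" if "finite S" "S \<subseteq> Y" for S
    using closed that by blast
  define E where "E = Inl -` Y"
  define E' where "E' = Inr -` Y"
  have E: "E \<subseteq> N" "E' \<subseteq> N'"
    using YN by (auto simp: E_def E'_def)
  have countable: "countable E" "countable E'"
  proof -
    have "Inl ` E \<subseteq> Y" "Inr ` E' \<subseteq> Y"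
      by (auto simp: E_def E'_def)
    then have "countable (Inl ` E :: ('u + 'u) set)" "countable (Inr ` E' :: ('u + 'u) set)"
      using \<open>countable Y\<close> countable_subset by blast+
    then show "countable E" "countable E'"
      by (simp_all add: countable_image_inj_eq)
  qed
  have supp_closed: "supp z \<subseteq> E" if "z \<in> E" for z
  proof -
    have "H {Inl z} \<subseteq> Y"
      using that by (intro Y) (auto simp: E_def)
    moreover have "Inl ` supp z \<subseteq> H {Inl z}"
      unfolding H_def by auto
    ultimately show ?thesis
      by (auto simp: E_def)
  qed
  have supp'_closed: "supp' z \<subseteq> E'" if "z \<in> E'" for z
  proof -
    have "H {Inr z} \<subseteq> Y"
      using that by (intro Y) (auto simp: E'_def)
    moreover have "Inr ` supp' z \<subseteq> H {Inr z}"
      unfolding H_def by auto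
    ultimately show ?thesis
      by (auto simp: E'_def)
  qed
  have 1: "forth_closed A g E E'"
  proof (rule forth_new[OF forth(1) E])
    fix R z n assume R: "finite R" "R \<subseteq> E \<times> E'" and z: "z \<in> E"
    define S where "S = Inl ` insert z (fst ` R) \<union> Inr ` snd ` R"
    have "H S \<subseteq> Y"
      using R z by (intro Y) (auto simp: S_def E_def E'_def)
    moreover have RS: "R \<in> Pow (Inl -` S \<times> Inr -` S)" and zS: "z \<in> Inl -` S"
      by (force simp: S_def)+
    have "Inr w \<in> H S" if "w \<in> new A g N' R z n" for w
      unfolding H_def using that by (intro UnI2 imageI UnI2 UN_I[OF RS] UN_I[OF zS] UN_I[OF UNIV_I])
    ultimately show "new A g N' R z n \<subseteq> E'"
      unfolding E'_def by blast
  qed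
  have 2: "forth_closed A' g' E' E"
  proof (rule forth_new[OF forth(2) E(2,1)])
    fix R z n assume R: "finite R" "R \<subseteq> E' \<times> E" and z: "z \<in> E'"
    define S where "S = Inr ` insert z (fst ` R) \<union> Inl ` snd ` R"
    have "H S \<subseteq> Y"
      using R z by (intro Y) (auto simp: S_def E_def E'_def)
    moreover have RS: "R \<in> Pow (Inr -` S \<times> Inl -` S)" and zS: "z \<in> Inr -` S"
      by (force simp: S_def)+
    have "Inl w \<in> H S" if "w \<in> new A' g' N R z n" for w
      unfolding H_def using that by (intro UnI1 imageI UnI2 UN_I[OF RS] UN_I[OF zS] UN_I[OF UNIV_I])
    ultimately show "new A' g' N R z n \<subseteq> E"
      unfolding E_def by blast
  qed
  show ?thesis
  proof (intro exI conjI)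
    show "x \<in> E" "y \<in> E'"
      using xy by (auto simp: E_def E'_def)
  qed (use E countable supp_closed supp'_closed 1 2 in blast)+
qed

section \<open>Inverting approximations and iterating both directions\<close>

lemma approximates_inverse:
  assumes h: "approximates A g n R h" and A: "A \<subseteq> univ U" and g: "g \<in> Aut"
  shows "approximates (g ` A) (aut_inv g) n (R\<inverse>) (aut_inv h)"
proof -
  have hAut: "h \<in> Aut" and RU: "R \<subseteq> univ U \<times> univ U" and hA: "\<And>a. a \<in> A \<Longrightarrow> h a = g a"
    using h by (auto simp: approximates_def)
  have "aut_inv h b = aut_inv g b" if b: "b \<in> g ` A" for b
  proof -
    obtain a where a: "a \<in> A" "b = g a"
      using b by blast
    then have "h a = g a" "a \<in> univ U"
      using hA A by auto
    then show ?thesis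
      using aut_inv_left[OF hAut, of a] aut_inv_left[OF g, of a] a(2) by simp
  qed
  moreover have "d (aut_inv h y) x < (1 / 2) ^ n" if "(x, y) \<in> R" for x y
  proof -
    have xy: "x \<in> univ U" "y \<in> univ U"
      using that RU by auto
    have "d (h (aut_inv h y)) (h x) = d (aut_inv h y) x"
      using xy Aut_in[OF aut_inv_Aut[OF hAut]] by (intro Aut_dist[OF hAut])
    then show ?thesis
      using h that xy hAut commute[of y "h x"] by (auto simp: approximates_def)
  qed
  ultimately show ?thesis
    using h RU aut_inv_Aut[OF hAut] by (auto simp: approximates_def)
qed

text \<open>Inverting \<open>g\<close> twice gives back \<open>g\<close> only on the universe, so
  the return direction needs its own statement.\<close>

lemma approximates_inverse':
  assumes h: "approximates (g ` A) (aut_inv g) n R h" and A: "A \<subseteq> univ U" and g: "g \<in> Aut"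
  shows "approximates A g n (R\<inverse>) (aut_inv h)"
proof -
  have gA: "g ` A \<subseteq> univ U"
    using A Aut_in[OF g] by auto
  have "aut_inv g (g a) = a" if "a \<in> A" for a
    using that A g by auto
  moreover have "aut_inv (aut_inv g) a = g a" if "a \<in> A" for a
  proof -
    have aU: "a \<in> univ U" "g a \<in> univ U"
      using that A Aut_in[OF g] by auto
    then show ?thesis
      using aut_inv_left[OF aut_inv_Aut[OF g] aU(2)] aut_inv_left[OF g aU(1)] by simp
  qed
  ultimately show ?thesis
    using approximates_inverse[OF h gA aut_inv_Aut[OF g]] by (auto simp: approximates_def)
qed

lemma approximates_mono:
  assumes "approximates A g n R h" "m \<le> n"
  shows "approximates A g m R h"
proof -
  have "(1 / 2 :: real) ^ n \<le> (1 / 2) ^ m"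
    using assms(2) by (intro power_decreasing) auto
  then have "\<forall>(x, y)\<in>R. d (h x) y < (1 / 2) ^ m"
    using assms(1) unfolding approximates_def by (auto intro: less_le_trans)
  then show ?thesis
    using assms(1) by (simp add: approximates_def)
qed

text \<open>A forth step to tolerance level \<open>n + 1\<close> is followed by a back step to level
  \<open>n + 2\<close>, of which only level \<open>n + 1\<close> is kept. The back step moves the
  first coordinates again, so \<open>x\<close> is met only approximately, whereas \<open>y\<close>,
  treated last, is met exactly.\<close>

lemma back_and_forth_step:
  assumes A: "A \<subseteq> univ U" and g: "g \<in> Aut" and E: "E \<subseteq> univ U" "E' \<subseteq> univ U"
    and forth: "forth_closed A g E E'" and backward: "forth_closed (g ` A) (aut_inv g) E' E"
    and h: "approximates A g n R h" and R: "R \<subseteq> E \<times> E'" and x: "x \<in> E" and y: "y \<in> E'"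
  shows "\<exists>R'. (\<exists>h. approximates A g (Suc n) R' h) \<and> R' \<subseteq> E \<times> E' \<and>
    (\<forall>p\<in>R. \<exists>q\<in>R'. d (fst p) (fst q) < (1 / 2) ^ n \<and> d (snd p) (snd q) < (1 / 2) ^ n) \<and>
    (\<exists>q\<in>R'. d x (fst q) < (1 / 2) ^ n) \<and> (\<exists>q\<in>R'. snd q = y)"
proof -
  obtain s where s: "s ` insert x (fst ` R) \<subseteq> E'" "extends A g n R x s"
    using forth h R x unfolding forth_closed_def by blast
  define R1 where "R1 = (\<lambda>v. (v, s v)) ` insert x (fst ` R)"
  obtain k where k: "approximates A g (Suc n) R1 k"
    using s(2) unfolding extends_def R1_def by blast
  have "insert x (fst ` R) \<subseteq> E"
    using R x by auto
  then have R1: "R1 \<subseteq> E \<times> E'"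
    using s(1) unfolding R1_def by blast
  then have "R1\<inverse> \<subseteq> E' \<times> E"
    by auto
  then obtain t where t: "t ` insert y (fst ` R1\<inverse>) \<subseteq> E"
      "extends (g ` A) (aut_inv g) (Suc n) (R1\<inverse>) y t"
    using backward approximates_inverse[OF k A g] y unfolding forth_closed_def by blast
  define R2 where "R2 = (\<lambda>w. (w, t w)) ` insert y (fst ` R1\<inverse>)"
  obtain l where l: "approximates (g ` A) (aut_inv g) (Suc (Suc n)) R2 l"
    using t(2) unfolding extends_def R2_def by blast
  have near: "d v (t (s v)) < (1 / 2) ^ n" "(t (s v), s v) \<in> R2\<inverse>" if "v \<in> insert x (fst ` R)" for v
  proof -
    have 1: "(s v, v) \<in> R1\<inverse>"
      using that by (auto simp: R1_def)
    then have "d (t (s v)) v < (1 / 2) ^ Suc n"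
      using t(2) unfolding extends_def by blast
    also have "(1 / 2 :: real) ^ Suc n \<le> (1 / 2) ^ n"
      by simp
    finally show "d v (t (s v)) < (1 / 2) ^ n"
      using commute by simp
    have "s v \<in> fst ` R1\<inverse>"
      using 1 by force
    then show "(t (s v), s v) \<in> R2\<inverse>"
      by (simp add: R2_def)
  qed
  show ?thesis
  proof (intro exI[of _ "R2\<inverse>"] conjI ballI)
    show "\<exists>h. approximates A g (Suc n) (R2\<inverse>) h"
      using approximates_mono[OF approximates_inverse'[OF l A g], of "Suc n"] by auto
    have "insert y (fst ` R1\<inverse>) \<subseteq> E'"
      using R1 y by auto
    then show "R2\<inverse> \<subseteq> E \<times> E'"
      using t(1) unfolding R2_def by blast
    show "\<exists>q\<in>R2\<inverse>. d x (fst q) < (1 / 2) ^ n"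
      using near[of x] by (intro bexI[of _ "(t (s x), s x)"]) auto
    show "\<exists>q\<in>R2\<inverse>. snd q = y"
      by (intro bexI[of _ "(t y, y)"]) (auto simp: R2_def)
    fix p assume p: "p \<in> R"
    then have v: "fst p \<in> insert x (fst ` R)"
      by auto
    have "d (s (fst p)) (snd p) < (1 / 2) ^ n"
      using s(2) p unfolding extends_def by (auto simp: split_beta)
    then show "\<exists>q\<in>R2\<inverse>. d (fst p) (fst q) < (1 / 2) ^ n \<and> d (snd p) (snd q) < (1 / 2) ^ n"
      using near[OF v] commute[of "snd p" "s (fst p)"] by (intro bexI[of _ "(t (s (fst p)), s (fst p))"]) auto
  qed
qed

text \<open>
  The approximating automorphisms need not converge on \<open>E\<close> itself, but they do on limits of
  sequences from \<open>E\<close>. The pointwise limits form a partial map on \<open>N\<close>, which homogeneity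
  extends to an automorphism.
\<close>

lemma back_and_forth_limit:
  assumes small: "small N" and clN: "cl N \<subseteq> N" and A: "A \<subseteq> N" and g: "g \<in> Aut"
    and E: "E \<subseteq> N" "E' \<subseteq> univ U" "countable E" "countable E'" "E \<noteq> {}" "E' \<noteq> {}"
    and forth: "forth_closed A g E E'" and backward: "forth_closed (g ` A) (aut_inv g) E' E"
  shows "\<exists>h\<in>Aut. (\<forall>a\<in>A. h a = g a) \<and> h ` cl (A \<union> E) = cl (g ` A \<union> E')"
proof -
  have NU: "N \<subseteq> univ U"
    using small by (simp add: small_def)
  have AU: "A \<subseteq> univ U" and EU: "E \<subseteq> univ U"
    using A E(1) NU by auto
  obtain e :: "nat \<Rightarrow> 'u" where e: "\<forall>n. e n \<in> E" "\<forall>x\<in>E. \<forall>m. \<exists>n\<ge>m. e n = x"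
    using surjection_infinitely_often[OF E(3,5)] by (elim exE conjE)
  obtain e' :: "nat \<Rightarrow> 'u" where e': "\<forall>n. e' n \<in> E'" "\<forall>x\<in>E'. \<forall>m. \<exists>n\<ge>m. e' n = x"
    using surjection_infinitely_often[OF E(4,6)] by (elim exE conjE)
  have "\<exists>R. \<forall>n. ((\<exists>h. approximates A g n (R n) h) \<and> R n \<subseteq> E \<times> E') \<and>
    ((\<forall>p\<in>R n. \<exists>q\<in>R (Suc n). d (fst p) (fst q) < (1 / 2) ^ n \<and> d (snd p) (snd q) < (1 / 2) ^ n) \<and>
    (\<exists>q\<in>R (Suc n). d (e n) (fst q) < (1 / 2) ^ n) \<and> (\<exists>q\<in>R (Suc n). snd q = e' n))"
  proof (rule dependent_nat_choice)
    have "approximates A g 0 {} g"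
      using g by (simp add: approximates_def)
    then show "\<exists>R. (\<exists>h. approximates A g 0 R h) \<and> R \<subseteq> E \<times> E'"
      by blast
    fix R n assume R: "(\<exists>h. approximates A g n R h) \<and> R \<subseteq> E \<times> E'"
    then obtain h where "approximates A g n R h"
      by blast
    from back_and_forth_step[OF AU g EU E(2) forth backward this _ e(1)[rule_format] e'(1)[rule_format], of n n] R
    show "\<exists>R'. ((\<exists>h. approximates A g (Suc n) R' h) \<and> R' \<subseteq> E \<times> E') \<and>
      (\<forall>p\<in>R. \<exists>q\<in>R'. d (fst p) (fst q) < (1 / 2) ^ n \<and> d (snd p) (snd q) < (1 / 2) ^ n) \<and>
      (\<exists>q\<in>R'. d (e n) (fst q) < (1 / 2) ^ n) \<and> (\<exists>q\<in>R'. snd q = e' n)"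
      by (simp only: conj_assoc simp_thms)
  qed
  then obtain R where R: "\<forall>n. ((\<exists>h. approximates A g n (R n) h) \<and> R n \<subseteq> E \<times> E') \<and>
    ((\<forall>p\<in>R n. \<exists>q\<in>R (Suc n). d (fst p) (fst q) < (1 / 2) ^ n \<and> d (snd p) (snd q) < (1 / 2) ^ n) \<and>
    (\<exists>q\<in>R (Suc n). d (e n) (fst q) < (1 / 2) ^ n) \<and> (\<exists>q\<in>R (Suc n). snd q = e' n))" ..
  have RE: "R n \<subseteq> E \<times> E'"
    and step: "\<And>p. p \<in> R n \<Longrightarrow> \<exists>q\<in>R (Suc n). d (fst p) (fst q) < (1 / 2) ^ n \<and> d (snd p) (snd q) < (1 / 2) ^ n"
    and Re: "\<exists>q\<in>R (Suc n). d (e n) (fst q) < (1 / 2) ^ n" and Re': "\<exists>q\<in>R (Suc n). snd q = e' n" for n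
    using R[rule_format, of n] by blast+
  have "\<forall>n. \<exists>h. approximates A g n (R n) h"
    using R by blast
  from choice[OF this] obtain h where h: "\<forall>n. approximates A g n (R n) (h n)" ..
  have hAut: "h n \<in> Aut" and hA: "\<And>a. a \<in> A \<Longrightarrow> h n a = g a"
    and hR: "\<And>p. p \<in> R n \<Longrightarrow> d (h n (fst p)) (snd p) < (1 / 2) ^ n" for n
    using h[rule_format, of n] by (auto simp: approximates_def split_beta)
  define Conv where "Conv x y \<longleftrightarrow> y \<in> univ U \<and> (\<forall>\<epsilon>>0. \<forall>\<^sub>F n in sequentially. d (h n x) y < \<epsilon>)" for x y
  have Conv_unique: "y = y'" if "Conv x y" "Conv x y'" "x \<in> univ U" for x y y'
  proof (rule eq_if_close)
    show "y \<in> univ U" "y' \<in> univ U"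
      using that by (auto simp: Conv_def)
    fix \<epsilon> :: real assume "\<epsilon> > 0"
    then have "\<epsilon> / 2 > 0"
      by simp
    then have "\<forall>\<^sub>F n in sequentially. d (h n x) y < \<epsilon> / 2 \<and> d (h n x) y' < \<epsilon> / 2"
      using that(1,2) unfolding Conv_def by (intro eventually_conj) blast+
    then obtain n where n: "d (h n x) y < \<epsilon> / 2" "d (h n x) y' < \<epsilon> / 2"
      using eventually_happens'[OF sequentially_bot] by blast
    have "d y y' \<le> d y (h n x) + d (h n x) y'"
      using that Aut_in[OF hAut] by (intro triangle) (auto simp: Conv_def)
    then show "d y y' < \<epsilon>"
      using n commute[of y "h n x"] by simp
  qed
  have Conv_A: "Conv a (g a)" if "a \<in> A" for a
    using that AU Aut_in[OF g] hA by (auto simp: Conv_def)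
  define D where "D = {x \<in> N. \<exists>y. Conv x y}"
  define f where "f x = (SOME y. Conv x y)" for x
  have f: "Conv x (f x)" if "x \<in> D" for x
    using that someI_ex[of "Conv x"] by (auto simp: D_def f_def)
  have "\<exists>k\<in>Aut. \<forall>x\<in>D. k x = f x"
  proof (rule homogeneous_approx)
    show "small D"
      using small by (rule small_subset) (auto simp: D_def)
    show "f ` D \<subseteq> univ U"
      using f by (auto simp: Conv_def)
    fix W and \<epsilon> :: real assume W: "finite W" "W \<subseteq> D" and "\<epsilon> > 0"
    have "\<forall>\<^sub>F n in sequentially. \<forall>x\<in>W. d (h n x) (f x) < \<epsilon>"
      using W f \<open>\<epsilon> > 0\<close> by (intro eventually_ball_finite) (auto simp: Conv_def)
    then obtain n where "\<forall>x\<in>W. d (h n x) (f x) < \<epsilon>"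
      using eventually_happens'[OF sequentially_bot] by blast
    then show "\<exists>k\<in>Aut. \<forall>x\<in>W. d (k x) (f x) < \<epsilon>"
      using hAut by blast
  qed
  then obtain k where k: "k \<in> Aut" and kD: "\<And>x. x \<in> D \<Longrightarrow> Conv x (k x)"
    using f by metis
  have k_eq: "k x = y" if "x \<in> N" "Conv x y" for x y
  proof (rule Conv_unique)
    show "Conv x (k x)"
      using that by (intro kD) (auto simp: D_def)
  qed (use that NU in auto)
  have kA: "k a = g a" if "a \<in> A" for a
    using that A Conv_A by (intro k_eq) auto
  \<comment> \<open>Every pair starts a chain through the later approximations whose steps are
    dominated by a geometric series. It converges in both coordinates, and the limit pair belongs to
    the graph of \<open>k\<close>.\<close>
  have limit: "\<exists>x\<in>cl E. k x \<in> cl E' \<and> d (fst p) x \<le> 2 * (1 / 2) ^ n \<and> d (snd p) (k x) \<le> 2 * (1 / 2) ^ n"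
    if "p \<in> R n" for p n
  proof -
    have "\<exists>q. \<forall>m. (q m \<in> R (n + m) \<and> (m = 0 \<longrightarrow> q m = p)) \<and>
      d (fst (q m)) (fst (q (Suc m))) < (1 / 2) ^ (n + m) \<and> d (snd (q m)) (snd (q (Suc m))) < (1 / 2) ^ (n + m)"
    proof (rule dependent_nat_choice)
      show "\<exists>q. q \<in> R (n + 0) \<and> (0 = (0::nat) \<longrightarrow> q = p)"
        using that by (intro exI[of _ p]) simp
      fix q m assume "q \<in> R (n + m) \<and> (m = 0 \<longrightarrow> q = p)"
      then obtain q' where "q' \<in> R (Suc (n + m))"
        "d (fst q) (fst q') < (1 / 2) ^ (n + m)" "d (snd q) (snd q') < (1 / 2) ^ (n + m)"
        using step[of q "n + m"] by blast
      then show "\<exists>q'. (q' \<in> R (n + Suc m) \<and> (Suc m = 0 \<longrightarrow> q' = p)) \<and>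
        d (fst q) (fst q') < (1 / 2) ^ (n + m) \<and> d (snd q) (snd q') < (1 / 2) ^ (n + m)"
        by (intro exI[of _ q']) simp
    qed
    then obtain q where qR: "\<And>m. q m \<in> R (n + m)" and q0: "q 0 = p"
      and q1: "\<And>m. d (fst (q m)) (fst (q (Suc m))) < (1 / 2) ^ (n + m)"
      and q2: "\<And>m. d (snd (q m)) (snd (q (Suc m))) < (1 / 2) ^ (n + m)"
      by blast
    have qE: "fst (q m) \<in> E" "snd (q m) \<in> E'" for m
      using qR[of m] RE[of "n + m"] by auto
    have qU: "fst (q m) \<in> univ U" "snd (q m) \<in> univ U" for m
      using qE[of m] EU E(2) by auto
    obtain x where x: "x \<in> univ U" "\<And>m. d (fst (q m)) x \<le> 2 * (1 / 2) ^ (n + m)"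
      using geometric_limit[of "\<lambda>m. fst (q m)" n] qU(1) q1 by blast
    obtain y where y: "y \<in> univ U" "\<And>m. d (snd (q m)) y \<le> 2 * (1 / 2) ^ (n + m)"
      using geometric_limit[of "\<lambda>m. snd (q m)" n] qU(2) q2 by blast
    have small: "\<exists>i. \<forall>m\<ge>i. 5 * (1 / 2) ^ m < \<epsilon>" if "\<epsilon> > 0" for \<epsilon> :: real
      using half_power_small[OF that] by simp
    have near: "\<exists>m. 2 * (1 / 2) ^ (n + m) < \<epsilon>" if \<epsilon>: "\<epsilon> > 0" for \<epsilon> :: real
    proof -
      obtain i where "\<forall>m\<ge>i. 2 * (1 / 2) ^ m < \<epsilon>"
        using half_power_small[OF \<epsilon>, of 2] by auto
      then show ?thesis
        by (intro exI[of _ i]) simp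
    qed
    have xE: "x \<in> cl E"
      unfolding cl_def
    proof (intro CollectI conjI x(1) allI impI)
      fix \<epsilon> :: real assume "\<epsilon> > 0"
      then obtain m where "2 * (1 / 2) ^ (n + m) < \<epsilon>"
        using near by blast
      then have "d (fst (q m)) x < \<epsilon>"
        using x(2)[of m] by linarith
      then show "\<exists>z\<in>E. d z x < \<epsilon>"
        using qE(1) by blast
    qed
    have yE': "y \<in> cl E'"
      unfolding cl_def
    proof (intro CollectI conjI y(1) allI impI)
      fix \<epsilon> :: real assume "\<epsilon> > 0"
      then obtain m where "2 * (1 / 2) ^ (n + m) < \<epsilon>"
        using near by blast
      then have "d (snd (q m)) y < \<epsilon>"
        using y(2)[of m] by linarith
      then show "\<exists>z\<in>E'. d z y < \<epsilon>"
        using qE(2) by blast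
    qed
    \<comment> \<open>The 5 is 2 for the distance of \<open>x\<close> to the chain, 1 for the error
      of the approximation and 2 for the distance of the chain to \<open>y\<close>.\<close>
    have h_near: "d (h (n + m) x) y \<le> 5 * (1 / 2) ^ (n + m)" for m
    proof -
      let ?h = "h (n + m)"
      have hx: "?h x \<in> univ U" "?h (fst (q m)) \<in> univ U"
        using x(1) qU(1) by (auto intro: Aut_in[OF hAut])
      have "d (?h x) y \<le> d (?h x) (?h (fst (q m))) + d (?h (fst (q m))) y"
        using hx y(1) by (intro triangle)
      moreover have "d (?h (fst (q m))) y \<le> d (?h (fst (q m))) (snd (q m)) + d (snd (q m)) y"
        using hx y(1) qU(2) by (intro triangle)
      moreover have "d (?h x) (?h (fst (q m))) = d (fst (q m)) x"
        using Aut_dist[OF hAut x(1) qU(1)] commute by simp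
      moreover have "d (?h (fst (q m))) (snd (q m)) < (1 / 2) ^ (n + m)"
        using hR[OF qR] .
      ultimately show ?thesis
        using x(2)[of m] y(2)[of m] by linarith
    qed
    have "Conv x y"
      unfolding Conv_def
    proof (intro conjI y(1) allI impI)
      fix \<epsilon> :: real assume "\<epsilon> > 0"
      then obtain i where i: "\<forall>m\<ge>i. 5 * (1 / 2) ^ m < \<epsilon>"
        using small by blast
      have "d (h j x) y < \<epsilon>" if "j \<ge> n + i" for j
        using h_near[of "j - n"] i[rule_format, of j] that by simp
      then show "\<forall>\<^sub>F j in sequentially. d (h j x) y < \<epsilon>"
        unfolding eventually_sequentially by blast
    qed
    \<comment> \<open>The domain of convergence was cut down to \<open>N\<close> to keep it small;
      as \<open>N\<close> is closed, limits of points of \<open>E\<close> stay in it.\<close>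
    moreover have "x \<in> N"
      using xE cl_mono[OF E(1)] clN by blast
    ultimately have "k x = y"
      by (intro k_eq)
    then show ?thesis
      using xE yE' x(2)[of 0] y(2)[of 0] q0 by (intro bexI[of _ x]) auto
  qed
  have small: "\<exists>i. \<forall>m\<ge>i. 3 * (1 / 2) ^ m < \<epsilon>" if "\<epsilon> > 0" for \<epsilon> :: real
    using half_power_small[OF that] by simp
  \<comment> \<open>\<open>z\<close> itself need not be a limit of a chain. At each of the
    infinitely many stages treating \<open>z\<close>, some pair has its first coordinate close to
    \<open>z\<close>, and the limit of its chain supplies a nearby point that \<open>k\<close> sends
    into \<open>cl E'\<close>. Each of the three distances is at most \<open>(1/2)^n\<close>. The
    claim \<open>E'k\<close> below is similar.\<close>
  have kE: "k z \<in> cl E'" if z: "z \<in> E" for z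
    unfolding cl_def
  proof (intro CollectI conjI allI impI)
    have zU: "z \<in> univ U"
      using z EU by auto
    then show "k z \<in> univ U"
      by (rule Aut_in[OF k])
    fix \<epsilon> :: real assume "\<epsilon> > 0"
    then obtain i where i: "\<forall>m\<ge>i. 3 * (1 / 2) ^ m < \<epsilon>"
      using small by blast
    obtain n where n: "n \<ge> i" "e n = z"
      using e(2) z by blast
    obtain p where p: "p \<in> R (Suc n)" "d z (fst p) < (1 / 2) ^ n"
      using Re[of n] n(2) by blast
    obtain x where x: "x \<in> cl E" "k x \<in> cl E'" "d (fst p) x \<le> 2 * (1 / 2) ^ Suc n"
      using limit[OF p(1)] by blast
    have xU: "x \<in> univ U" and pU: "fst p \<in> univ U" and kxU: "k x \<in> univ U"
      using x(1,2) cl_in_univ p(1) RE EU by (blast, force, blast)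
    obtain w where w: "w \<in> E'" "d w (k x) < (1 / 2) ^ n"
      using cl_approx[OF x(2), of "(1 / 2) ^ n"] by auto
    have wU: "w \<in> univ U"
      using w(1) E(2) by auto
    have "d w (k z) \<le> d w (k x) + d (k x) (k z)"
      using wU kxU Aut_in[OF k zU] by (intro triangle)
    moreover have "d (k x) (k z) = d z x"
      using Aut_dist[OF k xU zU] commute by simp
    moreover have "d z x \<le> d z (fst p) + d (fst p) x"
      using zU pU xU by (intro triangle)
    ultimately have "d w (k z) < 3 * (1 / 2) ^ n"
      using p(2) x(3) w(2) by simp
    also have "\<dots> < \<epsilon>"
      using i n(1) by blast
    finally show "\<exists>w\<in>E'. d w (k z) < \<epsilon>"
      using w(1) by blast
  qed
  have E'k: "w \<in> cl (k ` E)" if w: "w \<in> E'" for w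
    unfolding cl_def
  proof (intro CollectI conjI allI impI)
    show wU: "w \<in> univ U"
      using w E(2) by auto
    fix \<epsilon> :: real assume "\<epsilon> > 0"
    then obtain i where i: "\<forall>m\<ge>i. 3 * (1 / 2) ^ m < \<epsilon>"
      using small by blast
    obtain n where n: "n \<ge> i" "e' n = w"
      using e'(2) w by blast
    obtain p where p: "p \<in> R (Suc n)" "snd p = w"
      using Re'[of n] n(2) by blast
    obtain x where x: "x \<in> cl E" "k x \<in> cl E'" "d w (k x) \<le> 2 * (1 / 2) ^ Suc n"
      using limit[OF p(1)] p(2) by blast
    obtain z where z: "z \<in> E" "d z x < (1 / 2) ^ n"
      using cl_approx[OF x(1), of "(1 / 2) ^ n"] by auto
    have U: "x \<in> univ U" "z \<in> univ U"
      using x(1) z(1) cl_in_univ EU by auto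
    have "d (k z) w \<le> d (k z) (k x) + d (k x) w"
      using U wU by (intro triangle Aut_in[OF k])
    moreover have "d (k z) (k x) = d z x"
      using Aut_dist[OF k U(2,1)] .
    moreover have "d (k x) w \<le> (1 / 2) ^ n" "0 < (1 / 2 :: real) ^ n"
      using x(3) commute[of w "k x"] by simp_all
    ultimately have "d (k z) w < 3 * (1 / 2) ^ n"
      using z(2) by linarith
    also have "\<dots> < \<epsilon>"
      using i n(1) by blast
    finally show "\<exists>z\<in>k ` E. d z w < \<epsilon>"
      using z(1) by blast
  qed
  have "k ` cl (A \<union> E) = cl (k ` (A \<union> E))"
    using AU EU by (intro Aut_cl[OF k]) auto
  also have "\<dots> = cl (g ` A \<union> E')"
  proof (rule cl_eqI)
    have kA': "k ` A = g ` A"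
      using kA by auto
    show U1: "k ` (A \<union> E) \<subseteq> univ U"
      using AU EU Aut_in[OF k] by auto
    show U2: "g ` A \<union> E' \<subseteq> univ U"
      using AU E(2) Aut_in[OF g] by auto
    show "k ` (A \<union> E) \<subseteq> cl (g ` A \<union> E')"
      unfolding image_Un kA' using cl_subset[OF U2] kE cl_mono[of E' "g ` A \<union> E'"] by auto
    show "g ` A \<union> E' \<subseteq> cl (k ` (A \<union> E))"
      using cl_subset[OF U1] E'k cl_mono[of "k ` E" "k ` (A \<union> E)"] unfolding image_Un kA' by auto
  qed
  finally show ?thesis
    using k kA by blast
qed

end

section \<open>Uniqueness of constructible models\<close>

lemma (in homogeneous_structure) constructed_conjugate:
  assumes "constructed L U \<kappa> N0 lt0 supp0" and "constructed L U \<kappa> N1 lt1 supp1"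
    and el: "elementary N0" "elementary N1" and cl: "cl N0 = N0" "cl N1 = N1"
  shows "\<exists>h\<in>Aut. h ` N0 = N1"
proof -
  interpret C0: constructed L U \<kappa> N0 lt0 supp0 by fact
  interpret C1: constructed L U \<kappa> N1 lt1 supp1 by fact
  note N0U = C0.N_univ and N1U = C1.N_univ
  \<comment> \<open>Only closures correspond: \<open>h\<close> maps the closed set in
    \<open>N0\<close> into \<open>cl C\<close>, not onto \<open>C\<close>, so \<open>C\<close> is
    carried as a separate component. Recording the graph on that set instead of \<open>h\<close>
    forgets the values elsewhere and makes the order plain inclusion.\<close>
  define S :: "(('u \<times> 'u) set \<times> 'u set) set" where
    "S = {(G, C). \<exists>h\<in>Aut. G = (\<lambda>x. (x, h x)) ` Domain G \<and> C0.closed (Domain G) \<and> C1.closed C \<and>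
       h ` cl (Domain G) = cl C}"
  define P :: "('u \<times> 'u) set \<times> 'u set \<Rightarrow> ('u \<times> 'u) set \<times> 'u set \<Rightarrow> bool" where
    "P p q \<longleftrightarrow> fst p \<subseteq> fst q \<and> snd p \<subseteq> snd q" for p q
  have "\<exists>m\<in>S. \<forall>a\<in>S. P m a \<longrightarrow> a = m"
  proof (rule predicate_Zorn)
    show "partial_order_on S (relation_of P S)"
      by (rule partial_order_on_relation_ofI) (auto simp: P_def prod_eq_iff)
    fix \<C> assume chain: "\<C> \<in> Chains (relation_of P S)"
    have CS: "c \<in> S" if "c \<in> \<C>" for c
      using chain that by (auto simp: Chains_def relation_of_def)
    have C_total: "P c c' \<or> P c' c" if "c \<in> \<C>" "c' \<in> \<C>" for c c'
      using chain that by (auto simp: Chains_def relation_of_def)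
    define G where "G = (\<Union>c\<in>\<C>. fst c)"
    define C where "C = (\<Union>c\<in>\<C>. snd c)"
    have DG: "Domain G = (\<Union>c\<in>\<C>. Domain (fst c))"
      by (auto simp: G_def)
    have graph: "\<exists>h\<in>Aut. fst c = (\<lambda>x. (x, h x)) ` Domain (fst c) \<and> h ` cl (Domain (fst c)) = cl (snd c)"
      if "c \<in> \<C>" for c
      using CS[OF that] by (auto simp: S_def split_beta)
    have closed: "C0.closed (Domain (fst c))" "C1.closed (snd c)" if "c \<in> \<C>" for c
      using CS[OF that] by (auto simp: S_def split_beta)
    have closed_G: "C0.closed (Domain G)"
      unfolding C0.closed_def
    proof (intro conjI ballI)
      show "Domain G \<subseteq> N0"
        unfolding DG using closed(1) by (intro UN_least) (simp add: C0.closed_def)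
      fix x assume "x \<in> Domain G"
      then obtain c where c: "c \<in> \<C>" "x \<in> Domain (fst c)"
        unfolding DG by blast
      then show "supp0 x \<subseteq> Domain G"
        using closed(1)[OF c(1)] unfolding DG C0.closed_def by blast
    qed
    have closed_C: "C1.closed C"
      unfolding C1.closed_def
    proof (intro conjI ballI)
      show "C \<subseteq> N1"
        unfolding C_def using closed(2) by (intro UN_least) (simp add: C1.closed_def)
      fix x assume "x \<in> C"
      then obtain c where c: "c \<in> \<C>" "x \<in> snd c"
        unfolding C_def by blast
      then show "supp1 x \<subseteq> C"
        using closed(2)[OF c(1)] unfolding C_def C1.closed_def by blast
    qed
    have DU: "Domain G \<subseteq> univ U" and CU: "C \<subseteq> univ U"
      using closed_G closed_C N0U N1U by (auto simp: C0.closed_def C1.closed_def)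
    have single: "y = y'" if xy: "(x, y) \<in> G" "(x, y') \<in> G" for x y y'
    proof -
      obtain c c' where c: "c \<in> \<C>" "c' \<in> \<C>" "(x, y) \<in> fst c" "(x, y') \<in> fst c'"
        using xy unfolding G_def by blast
      then obtain e where e: "e \<in> \<C>" "(x, y) \<in> fst e" "(x, y') \<in> fst e"
        using C_total[OF c(1,2)] unfolding P_def by blast
      obtain h where h: "fst e = (\<lambda>x. (x, h x)) ` Domain (fst e)"
        using graph[OF e(1)] by blast
      have "(x, y) \<in> (\<lambda>x. (x, h x)) ` Domain (fst e)" "(x, y') \<in> (\<lambda>x. (x, h x)) ` Domain (fst e)"
        using e(2,3) h by simp_all
      then show ?thesis
        by auto
    qed
    define f where "f x = (SOME y. (x, y) \<in> G)" for x
    have f: "(x, f x) \<in> G" if "x \<in> Domain G" for x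
      using that someI_ex[of "\<lambda>y. (x, y) \<in> G"] unfolding f_def by blast
    have graph_f: "h x = f x" if "c \<in> \<C>" "fst c = (\<lambda>x. (x, h x)) ` Domain (fst c)" "x \<in> Domain (fst c)" for c h x
    proof -
      have "(x, h x) \<in> (\<lambda>x. (x, h x)) ` Domain (fst c)"
        using that(3) by blast
      then have "(x, h x) \<in> G"
        using that(1,2) unfolding G_def by blast
      moreover have "(x, f x) \<in> G"
        using that(1,3) by (intro f) (auto simp: DG)
      ultimately show ?thesis
        by (rule single)
    qed
    have "\<exists>h\<in>Aut. \<forall>x\<in>Domain G. h x = f x"
    proof (rule homogeneous_exact)
      show "small (Domain G)"
        using C0.small_N closed_G by (auto simp: C0.closed_def intro: small_subset)
      show "f ` Domain G \<subseteq> univ U"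
      proof (rule image_subsetI)
        fix x assume x: "x \<in> Domain G"
        then obtain c where c: "c \<in> \<C>" "x \<in> Domain (fst c)"
          unfolding DG by blast
        then obtain h where h: "h \<in> Aut" "fst c = (\<lambda>x. (x, h x)) ` Domain (fst c)"
          using graph by blast
        have "h x = f x"
          using graph_f[OF c(1) h(2) c(2)] .
        moreover have "h x \<in> univ U"
          using x DU by (intro Aut_in[OF h(1)]) auto
        ultimately show "f x \<in> univ U"
          by simp
      qed
      fix W assume W: "finite W" "W \<subseteq> Domain G"
      show "\<exists>h\<in>Aut. \<forall>x\<in>W. h x = f x"
      proof (cases "\<C> = {}")
        case True
        then have "W = {}"
          using W(2) by (simp add: DG)
        then show ?thesis
          using id_Aut by blast
      next
        case False
        \<comment> \<open>A finite part of the union lies in one member of the chain, whose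
          automorphism agrees with \<open>f\<close> there; this is all that
          \<open>homogeneous_exact\<close> asks for.\<close>
        have "subset.chain UNIV ((\<lambda>c. Domain (fst c)) ` \<C>)"
          unfolding subset_chain_def
        proof (intro conjI ballI)
          fix X Y assume "X \<in> (\<lambda>c. Domain (fst c)) ` \<C>" "Y \<in> (\<lambda>c. Domain (fst c)) ` \<C>"
          then obtain c c' where c: "c \<in> \<C>" "c' \<in> \<C>" "X = Domain (fst c)" "Y = Domain (fst c')"
            by blast
          then show "X \<subseteq> Y \<or> Y \<subseteq> X"
            using C_total[OF c(1,2)] Domain_mono unfolding P_def by metis
        qed simp
        then obtain B where "B \<in> (\<lambda>c. Domain (fst c)) ` \<C>" "W \<subseteq> B"
          using finite_subset_Union_chain[OF W(1), of "(\<lambda>c. Domain (fst c)) ` \<C>"] W(2) False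
          unfolding DG by blast
        then obtain c where c: "c \<in> \<C>" "W \<subseteq> Domain (fst c)"
          by blast
        then obtain h where h: "h \<in> Aut" "fst c = (\<lambda>x. (x, h x)) ` Domain (fst c)"
          using graph by blast
        have "\<forall>x\<in>W. h x = f x"
          using graph_f[OF c(1) h(2)] c(2) by blast
        then show ?thesis
          using h(1) by blast
      qed
    qed
    then obtain h where h: "h \<in> Aut" "\<And>x. x \<in> Domain G \<Longrightarrow> h x = f x"
      by blast
    have h_graph: "G = (\<lambda>x. (x, h x)) ` Domain G"
    proof
      show "G \<subseteq> (\<lambda>x. (x, h x)) ` Domain G"
      proof
        fix p assume p: "p \<in> G"
        then have D: "fst p \<in> Domain G"
          by (metis DomainI prod.collapse)
        then have "snd p = h (fst p)"
          using single[of "fst p" "snd p" "f (fst p)"] p f[OF D] h(2)[OF D] by simp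
        then have "p = (fst p, h (fst p))"
          by (simp add: prod_eq_iff)
        then show "p \<in> (\<lambda>x. (x, h x)) ` Domain G"
          using D by (rule image_eqI)
      qed
      show "(\<lambda>x. (x, h x)) ` Domain G \<subseteq> G"
        using f h(2) by auto
    qed
    have cl_c: "cl (h ` Domain (fst c)) = cl (snd c)" if c: "c \<in> \<C>" for c
    proof -
      obtain k where k: "k \<in> Aut" "fst c = (\<lambda>x. (x, k x)) ` Domain (fst c)" "k ` cl (Domain (fst c)) = cl (snd c)"
        using graph[OF c] by blast
      have "h ` Domain (fst c) = k ` Domain (fst c)"
        using graph_f[OF c k(2)] h(2) c by (intro image_cong) (auto simp: DG)
      moreover have "Domain (fst c) \<subseteq> univ U"
        using DU c by (auto simp: DG)
      ultimately show ?thesis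
        using Aut_cl[OF k(1)] k(3) by simp
    qed
    have hDU: "h ` Domain G \<subseteq> univ U"
      using DU Aut_in[OF h(1)] by blast
    have "h ` cl (Domain G) = cl (h ` Domain G)"
      using h(1) DU by (rule Aut_cl)
    also have "\<dots> = cl C"
    proof (rule cl_eqI[OF _ _ hDU CU])
      show "h ` Domain G \<subseteq> cl C"
      proof (rule image_subsetI)
        fix x assume "x \<in> Domain G"
        then obtain c where c: "c \<in> \<C>" "x \<in> Domain (fst c)"
          unfolding DG by blast
        have "h ` Domain (fst c) \<subseteq> univ U"
          using hDU c(1) unfolding DG by blast
        then have "h x \<in> cl (snd c)"
          using cl_subset cl_c[OF c(1)] c(2) by blast
        moreover have "cl (snd c) \<subseteq> cl C"
          using c(1) by (intro cl_mono) (auto simp: C_def)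
        ultimately show "h x \<in> cl C"
          by blast
      qed
      show "C \<subseteq> cl (h ` Domain G)"
      proof
        fix y assume "y \<in> C"
        then obtain c where c: "c \<in> \<C>" "y \<in> snd c"
          unfolding C_def by blast
        have "snd c \<subseteq> univ U"
          using CU c(1) unfolding C_def by blast
        then have "y \<in> cl (h ` Domain (fst c))"
          using cl_subset cl_c[OF c(1)] c(2) by blast
        moreover have "cl (h ` Domain (fst c)) \<subseteq> cl (h ` Domain G)"
          using c(1) by (intro cl_mono) (auto simp: DG)
        ultimately show "y \<in> cl (h ` Domain G)"
          by blast
      qed
    qed
    finally have "(G, C) \<in> S"
      unfolding S_def using h(1) h_graph closed_G closed_C by blast
    then show "\<exists>u\<in>S. \<forall>a\<in>\<C>. P a u"
      by (intro bexI[of _ "(G, C)"]) (auto simp: P_def G_def C_def)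
  qed
  then obtain G C where GC: "(G, C) \<in> S" and max: "\<And>a. a \<in> S \<Longrightarrow> P (G, C) a \<Longrightarrow> a = (G, C)"
    by auto
  define D where "D = Domain G"
  obtain h where h: "h \<in> Aut" "G = (\<lambda>x. (x, h x)) ` D" "h ` cl D = cl C"
    and D: "C0.closed D" and C: "C1.closed C"
    using GC unfolding S_def D_def by blast
  have DN: "D \<subseteq> N0" and CN: "C \<subseteq> N1"
    using D C by (auto simp: C0.closed_def C1.closed_def)
  then have DU: "D \<subseteq> univ U" and CU: "C \<subseteq> univ U"
    using N0U N1U by auto
  have clDN: "cl D \<subseteq> N0" and clCN: "cl C \<subseteq> N1"
    using cl_mono[OF DN] cl_mono[OF CN] cl by auto
  \<comment> \<open>The pair is enlarged by countable sets containing the given \<open>x\<close> and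
    \<open>y\<close>; maximality forces them to have been included already.\<close>
  have "x \<in> D \<and> y \<in> C" if x: "x \<in> N0" and y: "y \<in> N1" for x y
  proof -
    have iso0: "isolated (cl D) (cl D) V" if "finite V" "V \<subseteq> N0" for V
      using C0.isolated_over_closed[OF D that] DU by (rule isolated_cl)
    have iso1: "isolated (cl C) (cl C) V" if "finite V" "V \<subseteq> N1" for V
      using C1.isolated_over_closed[OF C that] CU by (rule isolated_cl)
    have "aut_inv h ` cl C = cl D"
      unfolding h(3)[symmetric] using h(1) clDN N0U by (force simp: image_image)
    then have "forth_closed (cl C) (aut_inv h) N1 N0"
      using iso1 clCN N1U el(1) clDN by (intro forth_closed_elementary) auto
    moreover have "forth_closed (cl D) h N0 N1"
      using iso0 clDN N0U el(2) clCN h(3) by (intro forth_closed_elementary) auto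
    moreover have "countable (supp0 z) \<and> supp0 z \<subseteq> N0" if "z \<in> N0" for z
      using C0.countable_supp[OF that] C0.supp_less[OF that] by auto
    moreover have "countable (supp1 z) \<and> supp1 z \<subseteq> N1" if "z \<in> N1" for z
      using C1.countable_supp[OF that] C1.supp_less[OF that] by auto
    ultimately obtain E E' where E: "x \<in> E" "y \<in> E'" "E \<subseteq> N0" "E' \<subseteq> N1" "countable E" "countable E'"
      "\<forall>x\<in>E. supp0 x \<subseteq> E" "\<forall>x\<in>E'. supp1 x \<subseteq> E'"
      "forth_closed (cl D) h E E'" "forth_closed (cl C) (aut_inv h) E' E"
      using countable_forth_closed[of "cl D" h N0 N1 "cl C" "aut_inv h" supp0 supp1 x y] x y by blast
    have "\<exists>k\<in>Aut. (\<forall>a\<in>cl D. k a = h a) \<and> k ` cl (cl D \<union> E) = cl (h ` cl D \<union> E')"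
    proof (rule back_and_forth_limit[OF C0.small_N _ clDN h(1)])
      show "forth_closed (h ` cl D) (aut_inv h) E' E"
        unfolding h(3) by (rule E(10))
    qed (use cl E N1U in auto)
    then obtain k where k: "k \<in> Aut" "\<forall>a\<in>cl D. k a = h a" "k ` cl (cl D \<union> E) = cl (cl C \<union> E')"
      unfolding h(3) by (elim bexE conjE)
    have EU: "E \<subseteq> univ U" "E' \<subseteq> univ U"
      using E N0U N1U by auto
    \<comment> \<open>The back-and-forth runs over the closures \<open>cl D\<close> and
      \<open>cl C\<close>, whereas \<open>S\<close> records the sets closed under supports that
      generate them.\<close>
    have absorb: "cl (cl X \<union> Y) = cl (X \<union> Y)" if "X \<subseteq> univ U" "Y \<subseteq> univ U" for X Y
    proof (rule cl_eqI)
      show "cl X \<union> Y \<subseteq> cl (X \<union> Y)"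
        using cl_mono[of X "X \<union> Y"] cl_subset[of "X \<union> Y"] that by blast
      show "X \<union> Y \<subseteq> cl (cl X \<union> Y)"
        using cl_subset[of X] cl_subset[of "cl X \<union> Y"] that cl_in_univ by blast
    qed (use that cl_in_univ in auto)
    let ?G = "(\<lambda>x. (x, k x)) ` (D \<union> E)"
    have dom: "Domain ?G = D \<union> E"
      by auto
    have "k ` cl (D \<union> E) = cl (C \<union> E')"
      using k(3) by (simp only: absorb[OF DU EU(1)] absorb[OF CU EU(2)])
    moreover have "C0.closed (D \<union> E)" "C1.closed (C \<union> E')"
      using D C E unfolding C0.closed_def C1.closed_def by blast+
    ultimately have "(?G, C \<union> E') \<in> S"
      unfolding S_def mem_Collect_eq prod.case dom using k(1) by blast
    moreover have "P (G, C) (?G, C \<union> E')"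
    proof -
      have "k z = h z" if "z \<in> D" for z
        using k(2) cl_subset[OF DU] that by blast
      then have "G \<subseteq> ?G"
        unfolding h(2) by auto
      then show ?thesis
        by (simp add: P_def)
    qed
    ultimately have "(?G, C \<union> E') = (G, C)"
      by (rule max)
    then have "D \<union> E = D" "C \<union> E' = C"
      using dom unfolding D_def by auto
    then show ?thesis
      using E(1,2) by blast
  qed
  \<comment> \<open>The preceding claim treats \<open>x\<close> and \<open>y\<close> together, so
    each inclusion needs a point of the other model.\<close>
  moreover have "N0 \<noteq> {}" "N1 \<noteq> {}"
    using el by (auto simp: elementary_def)
  ultimately have "D = N0" "C = N1"
    using DN CN by blast+
  then show ?thesis
    using h(1,3) cl by auto
qed

lemma (in language_structure) Aut_isomorphism:
  assumes M: "elementary_substructure L M U" and N: "elementary_substructure L N U"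
    and g: "g \<in> Aut" "g ` univ M = univ N"
  shows "isomorphism L M N g"
proof -
  have MU: "univ M \<subseteq> univ U"
    using M by (simp add: elementary_substructure_def)
  have gM: "map g xs \<in> tuples N n" if "xs \<in> tuples M n" for xs n
    using that g(2) by (auto simp: tuples_def)
  have MU': "xs \<in> tuples U n" if "xs \<in> tuples M n" for xs n
    using that MU by (auto simp: tuples_def)
  show ?thesis
    unfolding isomorphism_def
  proof (intro conjI ballI)
    have "inj_on g (univ M)"
      using Aut_bij[OF g(1)] MU by (auto simp: bij_betw_def intro: inj_on_subset)
    then show "bij_betw g (univ M) (univ N)"
      using g(2) by (simp add: bij_betw_def)
  next
    fix x y assume xy: "x \<in> univ M" "y \<in> univ M"
    then have "g x \<in> univ N" "g y \<in> univ N"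
      using g(2) by auto
    then have "mdist N (g x) (g y) = d (g x) (g y)"
      using N by (simp add: elementary_substructure_def)
    also have "\<dots> = d x y"
      using xy MU by (intro Aut_dist[OF g(1)]) auto
    also have "\<dots> = mdist M x y"
      using M xy by (simp add: elementary_substructure_def)
    finally show "mdist N (g x) (g y) = mdist M x y" .
  next
    fix f xs assume f: "f \<in> Funs L" and xs: "xs \<in> tuples M (farity L f)"
    have "fun_int N f (map g xs) = fun_int U f (map g xs)"
      using N f gM[OF xs] by (simp add: elementary_substructure_def)
    also have "\<dots> = g (fun_int U f xs)"
      using Aut_fun[OF g(1) f MU'[OF xs]] .
    also have "fun_int U f xs = fun_int M f xs"
      using M f xs by (simp add: elementary_substructure_def)
    finally show "fun_int N f (map g xs) = g (fun_int M f xs)" .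
  next
    fix R xs assume R: "R \<in> Rels L" and xs: "xs \<in> tuples M (rarity L R)"
    have "rel_int N R (map g xs) = rel_int U R (map g xs)"
      using N R gM[OF xs] by (simp add: elementary_substructure_def)
    also have "\<dots> = rel_int U R xs"
      using Aut_rel[OF g(1) R MU'[OF xs]] .
    also have "\<dots> = rel_int M R xs"
      using M R xs by (simp add: elementary_substructure_def)
    finally show "rel_int N R (map g xs) = rel_int M R xs" .
  qed
qed

lemma card_isomorphism_less:
  assumes "isomorphism L M N h" "|univ M| <o r"
  shows "|univ N| <o r"
proof -
  have "bij_betw h (univ M) (univ N)"
    using assms(1) by (simp add: isomorphism_def)
  from ordIso_ordLess_trans[OF ordIso_symmetric[OF card_of_ordIsoI[OF this]] assms(2)] show ?thesis .
qed

theorem theorem3p4: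
  fixes L :: "('f, 'r) language"
    and T :: "('f, 'r) fm set"
    and \<kappa> :: "'k rel"
    and U :: "('u, 'f, 'r) metric_structure"
    and M0 :: "('a, 'f, 'r) metric_structure"
    and M1 :: "('b, 'f, 'r) metric_structure"
  assumes "wf_language L"
    and "complete_theory TYPE('c) L T"
    and "monster_model L T \<kappa> U"
    and "is_model L T M0" and "|univ M0| <o \<kappa>" and "constructible TYPE('i) L U M0"
    and "is_model L T M1" and "|univ M1| <o \<kappa>" and "constructible TYPE('j) L U M1"
  shows "isomorphic L M0 M1"
proof -
  interpret homogeneous_structure L U \<kappa>
    using assms(1,3) by unfold_locales (auto simp: monster_model_def is_model_def)
  obtain N0 h0 where N0: "isomorphism L M0 N0 h0" "constructible_over TYPE('i) L U {} N0"
    using assms(6) by (auto simp: constructible_def isomorphic_def)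
  obtain N1 h1 where N1: "isomorphism L M1 N1 h1" "constructible_over TYPE('j) L U {} N1"
    using assms(9) by (auto simp: constructible_def isomorphic_def)
  have sub: "elementary_substructure L N0 U" "elementary_substructure L N1 U"
    using N0(2) N1(2) by (auto simp: constructible_over_def)
  \<comment> \<open>The cardinality bounds on the models pass to their copies inside
    \<open>U\<close>; smallness is what strong homogeneity requires of the domain of a partial
    map.\<close>
  then have "small (univ N0)" "small (univ N1)"
    using card_isomorphism_less[OF N0(1) assms(5)] card_isomorphism_less[OF N1(1) assms(8)]
    by (auto simp: small_def elementary_substructure_def)
  then obtain lt0 supp0 lt1 supp1 where
    "constructed L U \<kappa> (univ N0) lt0 supp0" "constructed L U \<kappa> (univ N1) lt1 supp1"
    using constructible_constructed[OF N0(2)] constructible_constructed[OF N1(2)] by blast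
  then obtain g where g: "g \<in> Aut" "g ` univ N0 = univ N1"
    using constructed_conjugate elementary_univ[OF sub(1)] elementary_univ[OF sub(2)]
      cl_univ_eq[OF sub(1)] cl_univ_eq[OF sub(2)] by blast
  have "isomorphism L N0 N1 g"
    using sub g by (rule Aut_isomorphism)
  from isomorphism_comp[OF N0(1) this] have "isomorphism L M0 N1 (g \<circ> h0)" .
  moreover have "isomorphism L N1 M1 (inv_into (univ M1) h1)"
    using N1(1) assms(7) by (intro isomorphism_inv) (auto simp: is_model_def)
  ultimately have "isomorphism L M0 M1 (inv_into (univ M1) h1 \<circ> (g \<circ> h0))"
    by (rule isomorphism_comp)
  then show ?thesis
    by (auto simp: isomorphic_def)
qed

end
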